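(* Let $1<p<N$ and $0\le\mu<\left(\frac{N-p}{p}\right)^p$. Let $\Omega\subset\mathbb{R}^N$ be a bounded domain containing the origin and let $f\in L^{\frac Np}(\Omega)$ be a function satisfying $f(x)\le A|x|^{-\alpha}$ in $\Omega$ for some given constants $A,\alpha$ with $A>0$ and $p>\alpha$. If $u\in\mathcal{D}^{1,p}(\Omega)$ is a weak subsolution of $$-\Delta_p u-\frac{\mu}{|x|^p}|u|^{p-2}u=f|u|^{p-2}u\quad\text{in }\Omega,$$ then there exists a positive constant $C$ depending on $N,p,\mu,A$ and $\alpha$ such that $$u(x)\le CM|x|^{-\gamma_1}\quad\text{for } x\in B_{R_0}(0),$$ where $M=\sup_{\partial B_{R_0}(0)}u^+$ and $R_0>0$ is a constant depending on $N,p,\mu,A,\alpha$.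
   Context: $\Delta_p u=\sum_{i=1}^N\partial_{x_i}(|\nabla u|^{p-2}\partial_{x_i}u)$ is the $p$-Laplacian, $p^*=\frac{Np}{N-p}$, $u^+=\max(u,0)$, and $B_R(0)$ is the ball of radius $R$ centered at the origin. $\mathcal{D}^{1,p}(\Omega)=\{v\in L^{p^*}(\Omega): v\text{ is weakly differentiable and }\nabla v\in L^p(\Omega)\}$, equipped with the seminorm $\|\nabla v\|_{L^p(\Omega)}$. A function $u\in\mathcal{D}^{1,p}(\Omega)$ is a weak subsolution of the equation in $\Omega$ if for all nonnegative $\varphi\in C_0^\infty(\Omega)$, $$\int_{\Omega}\Big(|\nabla u|^{p-2}\nabla u\cdot\nabla\varphi-\frac{\mu}{|x|^p}|u|^{p-2}u\varphi\Big)\le\int_{\Omega}f|u|^{p-2}u\varphi .$$ $\gamma_1,\gamma_2\in[0,\infty)$, $\gamma_1<\gamma_2$, are the two roots of $\gamma^{p-2}[(p-1)\gamma^2-(N-p)\gamma]+\mu=0$. They satisfy $0\le\gamma_1<\frac{N-p}{p}<\gamma_2\le\frac{N-p}{p-1}$; in the case $\mu=0$, $\gamma_1=0$ and $\gamma_2=\frac{N-p}{p-1}$. *)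

theory Defs
  imports "HOL-Analysis.Analysis" "HOL-Probability.Essential_Supremum"
begin

primrec Ck :: "nat \<Rightarrow> (real^'n \<Rightarrow> real) \<Rightarrow> bool" where
  "Ck 0 f \<longleftrightarrow> continuous_on UNIV f"
| "Ck (Suc k) f \<longleftrightarrow>
     (\<forall>x. f differentiable (at x)) \<and>
     (\<forall>i. Ck k (\<lambda>x. frechet_derivative f (at x) (axis i 1)))"

text \<open>Elements of \<open>C\<^sub>0\<^sup>\<infinity>(\<Omega>)\<close> are taken to be defined on the whole space, extended by zero
  outside \<open>\<Omega>\<close>.\<close>

definition test_functions :: "(real^'n) set \<Rightarrow> (real^'n \<Rightarrow> real) set" where
  "test_functions \<Omega> =
     {\<phi>. (\<forall>k. Ck k \<phi>) \<and> compact (closure {x. \<phi> x \<noteq> 0}) \<and> closure {x. \<phi> x \<noteq> 0} \<subseteq> \<Omega>}"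

definition gradient :: "(real^'n \<Rightarrow> real) \<Rightarrow> real^'n \<Rightarrow> real^'n" where
  "gradient \<phi> x = (\<chi> i. frechet_derivative \<phi> (at x) (axis i 1))"

text \<open>Functions are not identified up to null sets; only their restriction to \<open>\<Omega>\<close> matters.\<close>

definition Lp :: "real \<Rightarrow> (real^'n) set \<Rightarrow> (real^'n \<Rightarrow> 'b::euclidean_space) set" where
  "Lp q \<Omega> =
     {f. f \<in> borel_measurable (lebesgue_on \<Omega>) \<and>
         integrable (lebesgue_on \<Omega>) (\<lambda>x. norm (f x) powr q)}"

definition locally_integrable :: "(real^'n) set \<Rightarrow> (real^'n \<Rightarrow> 'b::euclidean_space) \<Rightarrow> bool" where
  "locally_integrable \<Omega> f \<longleftrightarrow>
     (\<forall>K. compact K \<and> K \<subseteq> \<Omega> \<longrightarrow> integrable (lebesgue_on K) f)"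

definition has_weak_gradient ::
  "(real^'n) set \<Rightarrow> (real^'n \<Rightarrow> real) \<Rightarrow> (real^'n \<Rightarrow> real^'n) \<Rightarrow> bool" where
  "has_weak_gradient \<Omega> u G \<longleftrightarrow>
     locally_integrable \<Omega> u \<and> locally_integrable \<Omega> G \<and>
     (\<forall>\<phi>\<in>test_functions \<Omega>.
        (LINT x|lebesgue_on \<Omega>. u x *\<^sub>R gradient \<phi> x) = - (LINT x|lebesgue_on \<Omega>. \<phi> x *\<^sub>R G x))"

definition weakly_differentiable :: "(real^'n) set \<Rightarrow> (real^'n \<Rightarrow> real) \<Rightarrow> bool" where
  "weakly_differentiable \<Omega> u \<longleftrightarrow> (\<exists>G. has_weak_gradient \<Omega> u G)"

text \<open>The weak gradient is unique up to null sets; the choice of version is immaterial below.\<close>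

definition weak_gradient :: "(real^'n) set \<Rightarrow> (real^'n \<Rightarrow> real) \<Rightarrow> real^'n \<Rightarrow> real^'n" where
  "weak_gradient \<Omega> u = (SOME G. has_weak_gradient \<Omega> u G)"

definition D1p :: "real \<Rightarrow> (real^'n) set \<Rightarrow> (real^'n \<Rightarrow> real) set" where
  "D1p p \<Omega> =
     {v \<in> Lp (real CARD('n) * p / (real CARD('n) - p)) \<Omega>.
        weakly_differentiable \<Omega> v \<and> weak_gradient \<Omega> v \<in> Lp p \<Omega>}"

text \<open>For \<open>u \<in> D1p p \<Omega>\<close>, \<open>f \<in> Lp (N/p) \<Omega>\<close> and \<open>1 < p < N\<close> all integrands below are integrable (by
  Hoelder), so the convention that non-integrable functions have integral zero plays no role.
  Where \<open>p < 2\<close>, the convention \<open>0 powr a = 0\<close> gives the flux \<open>|\<nabla>u|\<^sup>p\<^sup>-\<^sup>2 \<nabla>u\<close> its usual value \<open>0\<close>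
  at points with \<open>\<nabla>u = 0\<close>, and similarly for \<open>|u|\<^sup>p\<^sup>-\<^sup>2 u\<close>.\<close>

definition weak_subsolution ::
  "real \<Rightarrow> real \<Rightarrow> (real^'n) set \<Rightarrow> (real^'n \<Rightarrow> real) \<Rightarrow> (real^'n \<Rightarrow> real) \<Rightarrow> bool" where
  "weak_subsolution p \<mu> \<Omega> f u \<longleftrightarrow>
     u \<in> D1p p \<Omega> \<and>
     (\<forall>\<phi>\<in>test_functions \<Omega>. (\<forall>x. 0 \<le> \<phi> x) \<longrightarrow>
        (LINT x|lebesgue_on \<Omega>.
           norm (weak_gradient \<Omega> u x) powr (p - 2) * (weak_gradient \<Omega> u x \<bullet> gradient \<phi> x)
           - \<mu> / norm x powr p * \<bar>u x\<bar> powr (p - 2) * u x * \<phi> x)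
        \<le> (LINT x|lebesgue_on \<Omega>. f x * \<bar>u x\<bar> powr (p - 2) * u x * \<phi> x))"

text \<open>The Hardy exponent equation \<open>\<gamma>\<^sup>p\<^sup>-\<^sup>2 [(p-1) \<gamma>\<^sup>2 - (N-p) \<gamma>] + \<mu> = 0\<close> on \<open>[0,\<infinity>)\<close>. At \<open>\<gamma> = 0\<close> the first
  summand is \<open>0\<close> for every \<open>p > 1\<close> (it is \<open>(p-1) \<gamma>\<^sup>p - (N-p) \<gamma>\<^sup>p\<^sup>-\<^sup>1\<close>), so \<open>0\<close> is a root iff \<open>\<mu> = 0\<close>.\<close>

definition hardy_root :: "real \<Rightarrow> real \<Rightarrow> real \<Rightarrow> real \<Rightarrow> bool" where
  "hardy_root N p \<mu> \<gamma> \<longleftrightarrow>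
     0 \<le> \<gamma> \<and> \<gamma> powr (p - 2) * ((p - 1) * \<gamma>\<^sup>2 - (N - p) * \<gamma>) + \<mu> = 0"

text \<open>A function in \<open>D1p p \<Omega>\<close> is only defined up to null sets, so its values on a sphere are those of
  the canonical upper semicontinuous representative \<open>x \<mapsto> lim\<^bsub>r\<rightarrow>0\<^esub> ess sup\<^bsub>B(x,r)\<^esub> u\<close>. It agrees
  with \<open>u\<close> wherever \<open>u\<close> is continuous, and depends only on the class of \<open>u\<close>.\<close>

definition usc_rep :: "(real^'n) set \<Rightarrow> (real^'n \<Rightarrow> real) \<Rightarrow> real^'n \<Rightarrow> ereal" where
  "usc_rep \<Omega> u x = (INF r\<in>{0<..}. esssup (lebesgue_on (\<Omega> \<inter> ball x r)) (\<lambda>y. ereal (u y)))"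

definition sphere_sup_pos :: "(real^'n) set \<Rightarrow> (real^'n \<Rightarrow> real) \<Rightarrow> real \<Rightarrow> ereal" where
  "sphere_sup_pos \<Omega> u R = (SUP x\<in>sphere 0 R. max (usc_rep \<Omega> u x) 0)"

end

theory Submission
  imports Defs "HOL-Computational_Algebra.Polynomial"
begin

text \<open>Compare \<open>u\<close> with the radial barrier \<open>v\<close> that solves \<open>v' / v = - (\<gamma>\<^sub>1 + K r\<^sup>\<epsilon>) / r\<close>. It behaves like \<open>r\<close> to the
  power \<open>-\<gamma>\<^sub>1\<close> at the origin, and since \<open>\<gamma>\<^sub>1 < (N - p) / p\<close> it is a strict supersolution in a small
  punctured ball. If \<open>u < m\<close> on the sphere of radius \<open>R\<^sub>0\<close> and \<open>v = m\<close> there, then \<open>(u - v)\<^sup>+\<close> vanishes near the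
  sphere. Test the inequality for \<open>u\<close> with \<open>u h(u/v)\<close> and the one for \<open>v\<close> with \<open>u\<^sup>p h(u/v) / v\<^sup>p\<^sup>-\<^sup>1\<close>, where \<open>h\<close> is
  nondecreasing and vanishes on \<open>(-\<infinity>, 1]\<close>. In the difference the gradient terms are nonnegative by the
  convexity of \<open>|\<cdot>|\<^sup>p\<close> (a form of Picone's inequality), while strictness gives the other sign unless
  \<open>u \<le> v\<close>. The origin is removed by a cutoff whose error vanishes because \<open>u\<close> is in \<open>L\<close> to the power
  \<open>p\<^sup>*\<close>. The test functions are made legitimate by replacing \<open>u\<close> with its mollifications; Jensen's inequality
  dominates these by mollified integrable functions, so that convergence of mollifications in
  \<open>L\<^sup>1\<close> is all that is needed to pass to the limit.\<close>

section \<open>Test functions\<close>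

text \<open>The weak formulation admits only smooth test functions, while \<open>u\<close> has
  merely a weak gradient. The inequality is linear in the test function, so the flux keeps the given
  gradient \<open>G\<close> and only the occurrences of \<open>u\<close> inside the test functions
  are mollified; all chain rules are then classical. The profile h(s) = (1 - 1/s)^2 is chosen for
  this: it vanishes to second order at s = 1, so that truncating at u = v keeps the test functions
  C^1, and it is bounded together with s h'(s), which controls them where u/v is large. The Hardy
  weight is harmless because every test function of the comparison vanishes near the origin. The
  barrier equation is divided by v^(p-1), so that only the logarithmic gradient of \<open>v\<close>
  occurs; its flux is radial, which reduces the divergence theorem to fields of the form \<xi> x.
  The exponent \<gamma>_1 + K r^\<epsilon> does not exceed (N-p)/p, up to which the function whose
  level set at \<mu> consists of the Hardy roots increases; the variation of the exponent supplies a
  further term that beats A r^(-\<alpha>). All constants are chosen before the domain, f and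
  u.\<close>

lemma gderiv_gradient:
  fixes f :: "real^'n \<Rightarrow> real"
  assumes "GDERIV f x :> D"
  shows "gradient f x = D"
proof -
  have "frechet_derivative f (at x) = (\<lambda>h. h \<bullet> D)"
    using assms frechet_derivative_at unfolding gderiv_def by metis
  then show ?thesis by (simp add: gradient_def vec_eq_iff inner_axis')
qed

lemma gradient_gderiv:
  fixes f :: "real^'n \<Rightarrow> real"
  assumes "f differentiable (at x)"
  shows "GDERIV f x :> gradient f x"
proof -
  let ?f = "frechet_derivative f (at x)"
  have d: "(f has_derivative ?f) (at x)"
    using assms frechet_derivative_works by blast
  then have lin: "linear ?f" by (rule has_derivative_linear)
  have "?f h = h \<bullet> gradient f x" for h
  proof -
    have "?f h = ?f (\<Sum>i\<in>UNIV. (h $ i) *\<^sub>R axis i 1)"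
      using basis_expansion[of h] by (simp add: scalar_mult_eq_scaleR)
    also have "\<dots> = (\<Sum>i\<in>UNIV. (h $ i) * ?f (axis i 1))"
      using lin by (simp add: linear_sum linear_cmul)
    finally show ?thesis by (simp add: inner_vec_def gradient_def)
  qed
  then have "?f = (\<lambda>h. h \<bullet> gradient f x)" by blast
  with d show ?thesis unfolding gderiv_def by simp
qed

lemma Ck_SucI:
  fixes f :: "real^'n \<Rightarrow> real"
  assumes "\<And>x. GDERIV f x :> D x" and "\<And>i. Ck k (\<lambda>x. D x $ i)"
  shows "Ck (Suc k) f"
proof -
  have g: "gradient f x = D x" for x using gderiv_gradient[OF assms(1)] .
  have "f differentiable (at x)" for x
    using assms(1) unfolding gderiv_def differentiable_def by blast
  moreover have "(\<lambda>x. frechet_derivative f (at x) (axis i 1)) = (\<lambda>x. D x $ i)" for i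
    using g by (simp add: gradient_def vec_eq_iff)
  ultimately show ?thesis using assms(2) by simp
qed

lemma Ck_SucD:
  fixes f :: "real^'n \<Rightarrow> real"
  assumes "Ck (Suc k) f"
  shows "GDERIV f x :> gradient f x" and "Ck k (\<lambda>x. gradient f x $ i)"
  using assms gradient_gderiv by (auto simp: gradient_def)

lemma gderiv_isCont: "GDERIV f x :> D \<Longrightarrow> isCont f x"
  unfolding gderiv_def by (rule has_derivative_continuous)

lemma Ck_imp_continuous:
  assumes "Ck k f"
  shows "continuous_on UNIV f"
proof (cases k)
  case 0
  with assms show ?thesis by simp
next
  case (Suc l)
  with assms have "isCont f x" for x
    using Ck_SucD(1)[of l f x] gderiv_isCont by blast
  then show ?thesis by (simp add: continuous_at_imp_continuous_on)
qed

lemma Ck_Suc_imp_Ck: "Ck (Suc k) f \<Longrightarrow> Ck k f"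
proof (induction k arbitrary: f)
  case 0
  then show ?case using Ck_imp_continuous[OF 0] by simp
next
  case (Suc k)
  show ?case
    by (rule Ck_SucI[where D = "gradient f"]) (use Ck_SucD[OF Suc.prems] Suc.IH in auto)
qed

lemma Ck_const: "Ck k (\<lambda>x::real^'n. c)"
proof (induction k arbitrary: c)
  case (Suc k)
  show ?case by (rule Ck_SucI[where D = "\<lambda>_. 0"]) (use Suc in \<open>auto intro: GDERIV_const\<close>)
qed simp

lemma Ck_component: "Ck k (\<lambda>x::real^'n. x $ i)"
proof (cases k)
  case (Suc l)
  have "GDERIV (\<lambda>x::real^'n. x $ i) x :> axis i 1" for x
    unfolding gderiv_def inner_axis by (simp add: bounded_linear_imp_has_derivative[OF bounded_linear_vec_nth])
  then show ?thesis unfolding Suc by (rule Ck_SucI) (rule Ck_const)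
qed (auto intro: continuous_intros)

lemma Ck_add:
  fixes f g :: "real^'n \<Rightarrow> real"
  shows "Ck k f \<Longrightarrow> Ck k g \<Longrightarrow> Ck k (\<lambda>x. f x + g x)"
proof (induction k arbitrary: f g)
  case (Suc k)
  show ?case
    by (rule Ck_SucI[where D = "\<lambda>x. gradient f x + gradient g x"])
      (use Ck_SucD[OF Suc.prems(1)] Ck_SucD[OF Suc.prems(2)] Suc.IH in \<open>auto intro: GDERIV_add\<close>)
qed (auto intro: continuous_intros)

lemma Ck_mult:
  fixes f g :: "real^'n \<Rightarrow> real"
  shows "Ck k f \<Longrightarrow> Ck k g \<Longrightarrow> Ck k (\<lambda>x. f x * g x)"
proof (induction k arbitrary: f g)
  case (Suc k)
  have "Ck k (\<lambda>x. f x * gradient g x $ i + g x * gradient f x $ i)" for i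
    using Suc Ck_Suc_imp_Ck[OF Suc.prems(1)] Ck_Suc_imp_Ck[OF Suc.prems(2)] Ck_SucD(2)
    by (intro Ck_add Suc.IH) blast+
  then show ?case
    using Ck_SucD(1)[OF Suc.prems(1)] Ck_SucD(1)[OF Suc.prems(2)]
    by (intro Ck_SucI[where D = "\<lambda>x. f x *\<^sub>R gradient g x + g x *\<^sub>R gradient f x"])
      (auto intro: GDERIV_mult)
qed (auto intro: continuous_intros)

text \<open>The factor P(1/t) makes the family closed under differentiation, so that smoothness of
  exp(-1/t), extended by zero, takes a single induction over all P.\<close>

definition flat_exp :: "real poly \<Rightarrow> real \<Rightarrow> real" where
  "flat_exp P t = (if t > 0 then poly P (1 / t) * exp (- 1 / t) else 0)"

text \<open>The spare power s^k is what the induction on \<open>P\<close> needs: peeling off a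
  coefficient shifts one factor s from the polynomial into it.\<close>

lemma poly_mult_exp_tendsto_0:
  "((\<lambda>s. s ^ k * poly P s * exp (- s)) \<longlongrightarrow> (0::real)) at_top"
proof (induction P arbitrary: k)
  case (pCons a P)
  have "((\<lambda>s. a * (s ^ k / exp s) + s ^ Suc k * poly P s * exp (- s)) \<longlongrightarrow> a * 0 + 0) at_top"
    by (intro tendsto_add tendsto_mult_left tendsto_power_div_exp_0 pCons.IH)
  moreover have "(\<lambda>s. a * (s ^ k / exp s) + s ^ Suc k * poly P s * exp (- s))
      = (\<lambda>s. s ^ k * poly (pCons a P) s * exp (- s))"
  proof
    fix s :: real
    have "s ^ k / exp s = s ^ k * exp (- s)" by (simp add: exp_minus divide_inverse)
    then show "a * (s ^ k / exp s) + s ^ Suc k * poly P s * exp (- s)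
        = s ^ k * poly (pCons a P) s * exp (- s)"
      by (simp only: poly_pCons power_Suc distrib_left distrib_right ac_simps)
  qed
  ultimately show ?case by simp
qed simp

text \<open>With s = 1/t one has ds/dt = -s^2, so the derivative of P(s) exp(-s) is s^2 (P(s) -
  P'(s)) exp(-s). At t = 0 the difference quotient from the right is s P(s) exp(-s), which tends to
  0.\<close>

lemma flat_exp_deriv:
  "(flat_exp P has_real_derivative flat_exp ([:0, 0, 1:] * (P - pderiv P)) t) (at t)"
proof -
  consider "t > 0" | "t < 0" | "t = 0" by linarith
  then show ?thesis
  proof cases
    case 1
    have i: "((\<lambda>t. 1 / t) has_real_derivative - (1 / t\<^sup>2)) (at t)"
      using 1 by (auto intro!: derivative_eq_intros simp: power2_eq_square)
    have "((\<lambda>t. poly P (1 / t)) has_real_derivative poly (pderiv P) (1 / t) * - (1 / t\<^sup>2)) (at t)"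
      by (rule DERIV_chain2[OF poly_DERIV i])
    moreover have "((\<lambda>t. exp (- (1 / t))) has_real_derivative exp (- (1 / t)) * (- (- (1 / t\<^sup>2)))) (at t)"
      by (rule DERIV_chain2[OF DERIV_exp DERIV_minus[OF i]])
    ultimately have "((\<lambda>t. poly P (1 / t) * exp (- (1 / t))) has_real_derivative
       poly (pderiv P) (1 / t) * - (1 / t\<^sup>2) * exp (- (1 / t))
       + exp (- (1 / t)) * (- (- (1 / t\<^sup>2))) * poly P (1 / t)) (at t)"
      by (rule DERIV_mult)
    moreover have "poly (pderiv P) (1 / t) * - (1 / t\<^sup>2) * exp (- (1 / t))
       + exp (- (1 / t)) * (- (- (1 / t\<^sup>2))) * poly P (1 / t)
       = flat_exp ([:0, 0, 1:] * (P - pderiv P)) t"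
    proof -
      have "q * - (1 / t\<^sup>2) * e + e * (- (- (1 / t\<^sup>2))) * p = (1 / t * (1 / t)) * (p - q) * e"
        for p q e :: real
        by (simp add: power2_eq_square left_diff_distrib right_diff_distrib)
      then show ?thesis using 1 by (simp only: flat_exp_def if_True) simp
    qed
    ultimately have "((\<lambda>t. poly P (1 / t) * exp (- (1 / t))) has_real_derivative
       flat_exp ([:0, 0, 1:] * (P - pderiv P)) t) (at t)" by simp
    then show ?thesis
      by (rule has_field_derivative_transform_within_open[where S = "{0<..}"])
        (use 1 in \<open>auto simp: flat_exp_def\<close>)
  next
    case 2
    have "((\<lambda>t. 0) has_real_derivative flat_exp ([:0, 0, 1:] * (P - pderiv P)) t) (at t)"
      using 2 by (auto simp: flat_exp_def)
    then show ?thesis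
      by (rule has_field_derivative_transform_within_open[where S = "{..<0}"])
        (use 2 in \<open>auto simp: flat_exp_def\<close>)
  next
    case 3
    have "((\<lambda>y. flat_exp P y / y) \<longlongrightarrow> 0) (at 0)"
    proof (rule filterlim_split_at)
      show "((\<lambda>y. flat_exp P y / y) \<longlongrightarrow> 0) (at_left 0)"
        by (rule tendsto_eventually, rule eventually_at_leftI[of "-1"]) (simp_all add: flat_exp_def)
      have "((\<lambda>y. (inverse y) ^ 1 * poly P (inverse y) * exp (- inverse y)) \<longlongrightarrow> 0) (at_right (0::real))"
        using filterlim_compose[OF poly_mult_exp_tendsto_0[of 1 P] filterlim_inverse_at_top_right] .
      then show "((\<lambda>y. flat_exp P y / y) \<longlongrightarrow> 0) (at_right 0)"
        by (rule Lim_transform_eventually, intro eventually_at_rightI[of 0 1])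
          (simp_all add: flat_exp_def divide_inverse)
    qed
    then show ?thesis unfolding 3 has_field_derivative_iff by (simp add: flat_exp_def)
  qed
qed

text \<open>Proved for all \<open>P\<close> at once because each derivative brings in a new
  polynomial; the other factor is affine in x, so the product rule closes the induction.\<close>

lemma Ck_flat_exp:
  fixes a :: "real^'n"
  shows "Ck k (\<lambda>x. flat_exp P (c - (x - a) \<bullet> (x - a)))"
proof (induction k arbitrary: P)
  case 0
  have "isCont (flat_exp P) t" for t using flat_exp_deriv DERIV_isCont by blast
  then have "continuous_on UNIV (flat_exp P)" by (simp add: continuous_at_imp_continuous_on)
  moreover have "continuous_on UNIV (\<lambda>x. c - (x - a) \<bullet> (x - a))"
    by (intro continuous_intros)
  ultimately show ?case unfolding Ck.simps
    by (rule continuous_on_compose2) simp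
next
  case (Suc k)
  let ?Q = "[:0, 0, 1:] * (P - pderiv P)"
  have "GDERIV (\<lambda>x. c - (x - a) \<bullet> (x - a)) x :> (- 2) *\<^sub>R (x - a)" for x
    unfolding gderiv_def by (auto intro!: derivative_eq_intros simp: inner_commute)
  then have "GDERIV (\<lambda>x. flat_exp P (c - (x - a) \<bullet> (x - a))) x :>
      flat_exp ?Q (c - (x - a) \<bullet> (x - a)) *\<^sub>R ((- 2) *\<^sub>R (x - a))" for x
    by (rule GDERIV_DERIV_compose) (rule flat_exp_deriv)
  moreover have "Ck k (\<lambda>x. flat_exp ?Q (c - (x - a) \<bullet> (x - a)) * (- 2 * (x $ i + - a $ i)))" for i
    by (intro Ck_mult Ck_add Ck_const Ck_component Suc.IH)
  ultimately show ?case
    by (intro Ck_SucI) (auto simp: algebra_simps)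
qed

section \<open>Convolution\<close>

lemma lborel_integrable_reflect:
  fixes f :: "'a::euclidean_space \<Rightarrow> 'b::{banach, second_countable_topology}"
  assumes [measurable]: "f \<in> borel_measurable borel"
  shows "integrable lborel (\<lambda>y. f (x - y)) \<longleftrightarrow> integrable lborel f"
    and "(LINT y|lborel. f (x - y)) = (LINT y|lborel. f y)"
proof -
  have d: "(lborel :: 'a measure) = distr lborel borel (\<lambda>y. x - y)"
    using lborel_affine[of "- 1" x] by (simp add: density_1)
  show "integrable lborel (\<lambda>y. f (x - y)) \<longleftrightarrow> integrable lborel f"
    by (subst (2) d, subst integrable_distr_eq) auto
  show "(LINT y|lborel. f (x - y)) = (LINT y|lborel. f y)"
    by (subst (2) d, subst integral_distr) auto
qed

lemma lborel_integrable_translate: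
  fixes f :: "'a::euclidean_space \<Rightarrow> 'b::{banach, second_countable_topology}"
  assumes [measurable]: "f \<in> borel_measurable borel"
  shows "integrable lborel (\<lambda>y. f (y + x)) \<longleftrightarrow> integrable lborel f"
    and "(LINT y|lborel. f (y + x)) = (LINT y|lborel. f y)"
proof -
  have d: "(lborel :: 'a measure) = distr lborel borel (\<lambda>y. y + x)"
  proof -
    have "(\<lambda>y::'a. y + x) = (+) x" by (simp add: fun_eq_iff add.commute)
    then show ?thesis using lborel_distr_plus[of x] by simp
  qed
  show "integrable lborel (\<lambda>y. f (y + x)) \<longleftrightarrow> integrable lborel f"
    by (subst (2) d, subst integrable_distr_eq) auto
  show "(LINT y|lborel. f (y + x)) = (LINT y|lborel. f y)"
    by (subst (2) d, subst integral_distr) auto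
qed

text \<open>The first factor is scalar and the second may be vector-valued, so that one operator
  serves for mollifying functions and fields and for placing a gradient on the kernel.\<close>

definition convol :: "('a::euclidean_space \<Rightarrow> real) \<Rightarrow> ('a \<Rightarrow> 'b::euclidean_space) \<Rightarrow> 'a \<Rightarrow> 'b" where
  "convol f g x = (LINT y|lborel. f y *\<^sub>R g (x - y))"

lemma convol_commute:
  fixes f g :: "'a::euclidean_space \<Rightarrow> real"
  assumes [measurable]: "f \<in> borel_measurable borel" "g \<in> borel_measurable borel"
  shows "convol f g = convol g f"
proof
  fix x
  show "convol f g x = convol g f x"
    unfolding convol_def
    using lborel_integrable_reflect(2)[of "\<lambda>y. g y *\<^sub>R f (x - y)" x] by (simp add: mult.commute)
qed

lemma convol_swap:
  fixes f :: "'a::euclidean_space \<Rightarrow> real" and g :: "'a \<Rightarrow> 'b::euclidean_space"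
  assumes [measurable]: "f \<in> borel_measurable borel" "g \<in> borel_measurable borel"
  shows "convol f g x = (LINT y|lborel. f (x - y) *\<^sub>R g y)"
  unfolding convol_def
  using lborel_integrable_reflect(2)[of "\<lambda>y. f (x - y) *\<^sub>R g y" x] by simp

lemma compact_support_bounded:
  fixes f :: "'a::euclidean_space \<Rightarrow> 'b::euclidean_space"
  assumes "continuous_on UNIV f" and "\<And>x. norm x > R \<Longrightarrow> f x = 0"
  obtains B where "B > 0" "\<And>x. norm (f x) \<le> B"
proof -
  have "bounded (f ` cball 0 R)"
    using assms(1) by (intro compact_imp_bounded compact_continuous_image)
      (auto intro: continuous_on_subset)
  then obtain B where B: "B > 0" "\<And>x. x \<in> cball 0 R \<Longrightarrow> norm (f x) \<le> B"
    unfolding bounded_pos by auto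
  then have "norm (f x) \<le> B" for x using assms(2)[of x] by (cases "norm x > R") auto
  with B(1) show ?thesis by (rule that)
qed

lemma compact_support_uniformly_continuous:
  fixes f :: "'a::euclidean_space \<Rightarrow> 'b::euclidean_space"
  assumes "continuous_on UNIV f" and "\<And>x. norm x > R \<Longrightarrow> f x = 0" and "e > 0"
  obtains d where "d > 0" "\<And>x y. norm (x - y) < d \<Longrightarrow> norm (f x - f y) < e"
proof -
  have "uniformly_continuous_on (cball 0 (R + 1)) f"
    using assms(1) by (intro compact_uniformly_continuous) (auto intro: continuous_on_subset)
  then obtain d where d: "d > 0" "\<And>x y. x \<in> cball 0 (R + 1) \<Longrightarrow> y \<in> cball 0 (R + 1) \<Longrightarrow>
      dist y x < d \<Longrightarrow> dist (f y) (f x) < e"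
    using \<open>e > 0\<close> unfolding uniformly_continuous_on_def by metis
  have "norm (f x - f y) < e" if "norm (x - y) < min d 1" for x y
  proof -
    have n: "norm x \<le> norm y + norm (x - y)" "norm y \<le> norm x + norm (x - y)"
      using norm_triangle_sub[of x y] norm_triangle_sub[of y x] by (auto simp: norm_minus_commute)
    show ?thesis
    proof (cases "norm x > R \<and> norm y > R")
      case True
      then show ?thesis using assms(2,3) by simp
    next
      case False
      then have "x \<in> cball 0 (R + 1)" "y \<in> cball 0 (R + 1)" using n that by auto
      then show ?thesis using d(2)[of y x] that by (simp add: dist_norm)
    qed
  qed
  moreover have "min d 1 > 0" using d(1) by simp
  ultimately show ?thesis using that by blast
qed

lemma integrable_compact_support:
  fixes g :: "'a::euclidean_space \<Rightarrow> 'b::euclidean_space"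
  assumes "continuous_on UNIV g" "\<And>x. norm x > R \<Longrightarrow> g x = 0"
  shows "integrable lborel g"
proof -
  have "integrable lborel (\<lambda>x. indicator (cball 0 R) x *\<^sub>R g x)"
    by (rule borel_integrable_compact) (auto intro: continuous_on_subset[OF assms(1)])
  moreover have "(\<lambda>x. indicator (cball 0 R) x *\<^sub>R g x) = g"
  proof
    show "indicator (cball 0 R) x *\<^sub>R g x = g x" for x
      using assms(2)[of x] by (cases "norm x > R") (auto simp: indicator_def)
  qed
  ultimately show ?thesis by simp
qed

lemma gderiv_eq_0_on_open:
  fixes K :: "'a::real_inner \<Rightarrow> real"
  assumes "GDERIV K x :> D" and "open S" and "\<And>y. y \<in> S \<Longrightarrow> K y = 0" and "x \<in> S"
  shows "D = 0"
proof -
  have "(K has_derivative (\<lambda>h. 0)) (at x)"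
    by (rule has_derivative_transform_within_open[OF has_derivative_const assms(2,4)])
      (use assms(3) in simp)
  then have "(\<lambda>h. h \<bullet> D) = (\<lambda>h. 0)"
    using assms(1) has_derivative_unique unfolding gderiv_def by blast
  then show ?thesis by (metis inner_eq_zero_iff)
qed

lemma gderiv_zero_outside:
  fixes K :: "'a::euclidean_space \<Rightarrow> real"
  assumes "GDERIV K x :> D" and "\<And>x. norm x > R \<Longrightarrow> K x = 0" and "norm x > R"
  shows "D = 0"
proof -
  have "open {x::'a. norm x > R}" by (intro open_Collect_less continuous_intros)
  then show ?thesis using assms by (intro gderiv_eq_0_on_open[of K x D "{x. norm x > R}"]) auto
qed

text \<open>A continuous gradient of compact support is uniformly continuous, which makes the
  first-order Taylor remainder small uniformly in the base point \<open>z\<close>. This is the form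
  needed under an integral.\<close>

lemma gderiv_uniform:
  fixes K :: "'a::euclidean_space \<Rightarrow> real"
  assumes K: "\<And>z. GDERIV K z :> D z" "continuous_on UNIV D" "\<And>z. norm z > R \<Longrightarrow> K z = 0" and "e > 0"
  obtains d where "d > 0" "\<And>z h. norm h < d \<Longrightarrow> \<bar>K (z + h) - K z - h \<bullet> D z\<bar> \<le> e * norm h"
proof -
  have D0: "\<And>z. norm z > R \<Longrightarrow> D z = 0" using gderiv_zero_outside[OF K(1,3)] by blast
  obtain d where d: "d > 0" "\<And>x y. norm (x - y) < d \<Longrightarrow> norm (D x - D y) < e"
    using compact_support_uniformly_continuous[OF K(2) D0 \<open>e > 0\<close>] by metis
  have "\<bar>K (z + h) - K z - h \<bullet> D z\<bar> \<le> e * norm h" if h: "norm h < d" for z h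
  proof -
    \<comment> \<open>The mean value estimate is applied to \<open>K\<close> minus its linearisation
      at \<open>z\<close>, whose gradient at x is D x - D z.\<close>
    have "norm ((K (z + h) - (z + h) \<bullet> D z) - (K z - z \<bullet> D z)) \<le> e * norm ((z + h) - z)"
    proof (rule differentiable_bound[where S = "ball z d" and f' = "\<lambda>x k. k \<bullet> (D x - D z)"])
      fix x assume x: "x \<in> ball z d"
      have "(K has_derivative (\<lambda>k. k \<bullet> D x)) (at x within ball z d)"
        using K(1)[of x] unfolding gderiv_def by (rule has_derivative_at_withinI)
      then show "((\<lambda>x. K x - x \<bullet> D z) has_derivative (\<lambda>k. k \<bullet> (D x - D z))) (at x within ball z d)"
        by (auto intro!: derivative_eq_intros simp: inner_diff_right)
      have "norm (D x - D z) \<le> e"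
        using d(2)[of x z] x by (simp add: dist_norm norm_minus_commute less_imp_le)
      then show "onorm (\<lambda>k. k \<bullet> (D x - D z)) \<le> e"
      proof -
        assume a: "norm (D x - D z) \<le> e"
        have "norm (k \<bullet> (D x - D z)) \<le> e * norm k" for k
          using Cauchy_Schwarz_ineq2[of k "D x - D z"] mult_left_mono[OF a norm_ge_zero[of k]]
          by (simp add: mult.commute)
        then show ?thesis by (rule onorm_le)
      qed
    qed (use h d(1) in \<open>auto simp: dist_norm\<close>)
    then show ?thesis by (simp add: inner_add_left algebra_simps)
  qed
  with d(1) show ?thesis using that by blast
qed

lemma integrable_scaleR_bounded:
  fixes f :: "'a::euclidean_space \<Rightarrow> real" and g :: "'a \<Rightarrow> 'b::euclidean_space"
  assumes "integrable lborel f" and [measurable]: "g \<in> borel_measurable borel"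
    and "\<And>x. norm (g x) \<le> B"
  shows "integrable lborel (\<lambda>y. f y *\<^sub>R g y)"
proof (rule Bochner_Integration.integrable_bound[of _ "\<lambda>y. B * f y"])
  have [measurable]: "f \<in> borel_measurable borel"
    using assms(1) borel_measurable_integrable by auto
  show "(\<lambda>y. f y *\<^sub>R g y) \<in> borel_measurable lborel" by simp
  have "0 \<le> B" using assms(3) norm_ge_zero order_trans by blast
  then have "norm (f y *\<^sub>R g y) \<le> norm (B * f y)" for y
    using mult_mono[OF order_refl assms(3)[of y], of "\<bar>f y\<bar>"] by (simp add: abs_mult mult.commute)
  then show "AE y in lborel. norm (f y *\<^sub>R g y) \<le> norm (B * f y)" by simp
qed (use assms(1) in simp)

lemma convol_integrand_integrable:
  fixes f :: "'a::euclidean_space \<Rightarrow> real" and g :: "'a \<Rightarrow> 'b::euclidean_space"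
  assumes "integrable lborel f" and "continuous_on UNIV g" and "\<And>x. norm x > R \<Longrightarrow> g x = 0"
  shows "integrable lborel (\<lambda>y. f y *\<^sub>R g (x - y))"
proof -
  obtain B where "\<And>x. norm (g x) \<le> B" using compact_support_bounded[OF assms(2,3)] by metis
  moreover have [measurable]: "g \<in> borel_measurable borel"
    using assms(2) borel_measurable_continuous_onI by blast
  ultimately show ?thesis using assms(1) by (intro integrable_scaleR_bounded) auto
qed

lemma continuous_on_convol:
  fixes f :: "'a::euclidean_space \<Rightarrow> real" and g :: "'a \<Rightarrow> 'b::euclidean_space"
  assumes f: "integrable lborel f" and g: "continuous_on UNIV g" "\<And>x. norm x > R \<Longrightarrow> g x = 0"
  shows "continuous_on UNIV (convol f g)"
proof -
  have "isCont (convol f g) x" for x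
    unfolding continuous_at_eps_delta
  proof (intro allI impI)
    fix e :: real assume "e > 0"
    define I where "I = (LINT y|lborel. \<bar>f y\<bar>)"
    have I: "I \<ge> 0" unfolding I_def by simp
    define c where "c = e / (I + 1)"
    have "c > 0" using \<open>e > 0\<close> I by (simp add: c_def)
    then obtain d where d: "d > 0" "\<And>x y. norm (x - y) < d \<Longrightarrow> norm (g x - g y) < c"
      using compact_support_uniformly_continuous[OF g] by metis
    have "norm (convol f g x' - convol f g x) < e" if "norm (x' - x) < d" for x'
    proof -
      have i: "integrable lborel (\<lambda>y. f y *\<^sub>R g (z - y))" for z
        by (rule convol_integrand_integrable[OF f g])
      have "convol f g x' - convol f g x = (LINT y|lborel. f y *\<^sub>R g (x' - y) - f y *\<^sub>R g (x - y))"
        unfolding convol_def using i by simp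
      also have "norm \<dots> \<le> (LINT y|lborel. norm (f y *\<^sub>R g (x' - y) - f y *\<^sub>R g (x - y)))"
        by (rule integral_norm_bound)
      also have "\<dots> \<le> (LINT y|lborel. c * \<bar>f y\<bar>)"
      proof (rule integral_mono)
        fix y
        have "norm (g (x' - y) - g (x - y)) \<le> c"
          using d(2)[of "x' - y" "x - y"] that by simp
        then show "norm (f y *\<^sub>R g (x' - y) - f y *\<^sub>R g (x - y)) \<le> c * \<bar>f y\<bar>"
          by (metis abs_ge_zero mult.commute mult_left_mono norm_scaleR scaleR_right_diff_distrib)
      qed (use i f in auto)
      also have "\<dots> = c * I" unfolding I_def by simp
      also have "\<dots> < e" unfolding c_def using \<open>e > 0\<close> I by (simp add: field_simps)
      finally show ?thesis .
    qed
    then show "\<exists>d>0. \<forall>x'. dist x' x < d \<longrightarrow> dist (convol f g x') (convol f g x) < e"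
      using d(1) by (auto simp: dist_norm)
  qed
  then show ?thesis by (simp add: continuous_at_imp_continuous_on)
qed

text \<open>The uniform remainder of \<open>gderiv_uniform\<close> is integrated against |f|, so the
  error is at most a small constant times |y - x| and the L^1 norm of \<open>f\<close>.\<close>

lemma convol_gderiv:
  fixes f :: "'a::euclidean_space \<Rightarrow> real"
  assumes f: "integrable lborel f" and K: "\<And>z. GDERIV K z :> D z" "continuous_on UNIV D"
    "\<And>z. norm z > R \<Longrightarrow> K z = 0"
  shows "GDERIV (convol f K) x :> convol f D x"
proof -
  have D0: "\<And>z. norm z > R \<Longrightarrow> D z = 0" using gderiv_zero_outside[OF K(1,3)] by blast
  have Kc: "continuous_on UNIV K"
    by (intro continuous_at_imp_continuous_on ballI gderiv_isCont[OF K(1)])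
  have iK: "integrable lborel (\<lambda>y. f y *\<^sub>R K (z - y))" for z
    by (rule convol_integrand_integrable[OF f Kc K(3)])
  have iD: "integrable lborel (\<lambda>y. f y *\<^sub>R D (z - y))" for z
    by (rule convol_integrand_integrable[OF f K(2) D0])
  define I where "I = (LINT y|lborel. \<bar>f y\<bar>)"
  have I: "I \<ge> 0" unfolding I_def by simp
  show ?thesis unfolding gderiv_def has_derivative_at_alt
  proof (intro conjI allI impI)
    show "bounded_linear (\<lambda>h. h \<bullet> convol f D x)" by (rule bounded_linear_inner_left)
    fix e :: real assume "e > 0"
    define c where "c = e / (I + 1)"
    have c: "c > 0" "c * I \<le> e" using \<open>e > 0\<close> I by (simp_all add: c_def field_simps)
    obtain d where d: "d > 0" "\<And>z h. norm h < d \<Longrightarrow> \<bar>K (z + h) - K z - h \<bullet> D z\<bar> \<le> c * norm h"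
      using gderiv_uniform[OF K c(1)] by metis
    have "norm (convol f K y - convol f K x - (y - x) \<bullet> convol f D x) \<le> e * norm (y - x)"
      if y: "norm (y - x) < d" for y
    proof -
      have e1: "(y - x) \<bullet> convol f D x = (LINT z|lborel. (y - x) \<bullet> (f z *\<^sub>R D (x - z)))"
        unfolding convol_def by (rule integral_inner_right[symmetric]) (rule iD)
      have i1: "integrable lborel (\<lambda>z. f z * ((y - x) \<bullet> D (x - z)))"
        using integrable_inner_right[OF iD, of "y - x" x] by simp
      define q where "q z = f z *\<^sub>R K (y - z) - f z *\<^sub>R K (x - z) - (y - x) \<bullet> (f z *\<^sub>R D (x - z))" for z
      have qi: "integrable lborel q"
        unfolding q_def by (intro Bochner_Integration.integrable_diff integrable_inner_right iK iD)
      have q_le: "norm (q z) \<le> c * norm (y - x) * \<bar>f z\<bar>" for z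
      proof -
        have "q z = f z * (K ((x - z) + (y - x)) - K (x - z) - (y - x) \<bullet> D (x - z))"
          (is "_ = _ * ?q") by (simp add: q_def right_diff_distrib)
        moreover have "\<bar>?q\<bar> \<le> c * norm (y - x)" by (rule d(2)[OF y])
        ultimately show ?thesis
          using mult_left_mono[of "\<bar>?q\<bar>" "c * norm (y - x)" "\<bar>f z\<bar>"]
          by (simp only: real_norm_def abs_mult mult.commute abs_ge_zero)
      qed
      have "convol f K y - convol f K x - (y - x) \<bullet> convol f D x = (LINT z|lborel. q z)"
        unfolding e1 q_def by (simp add: convol_def i1 iK[simplified])
      then have "norm (convol f K y - convol f K x - (y - x) \<bullet> convol f D x) \<le> (LINT z|lborel. norm (q z))"
        using integral_norm_bound[of lborel q] by simp
      also have "\<dots> \<le> (LINT z|lborel. c * norm (y - x) * \<bar>f z\<bar>)"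
        by (rule integral_mono[OF integrable_norm[OF qi] _ q_le]) (use f in auto)
      also have "\<dots> = c * I * norm (y - x)" unfolding I_def by simp
      also have "\<dots> \<le> e * norm (y - x)" using c(2) by (rule mult_right_mono) simp
      finally show ?thesis .
    qed
    then show "\<exists>d>0. \<forall>y. norm (y - x) < d \<longrightarrow>
        norm (convol f K y - convol f K x - (y - x) \<bullet> convol f D x) \<le> e * norm (y - x)"
      using d(1) by blast
  qed
qed

lemma Ck_Suc_gradient_continuous:
  fixes K :: "real^'n \<Rightarrow> real"
  assumes "Ck (Suc k) K"
  shows "continuous_on UNIV (gradient K)"
proof -
  have "continuous_on UNIV (\<lambda>x. \<chi> i. gradient K x $ i)"
    using Ck_imp_continuous[OF Ck_SucD(2)[OF assms]] by (intro continuous_on_vec_lambda) simp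
  then show ?thesis by simp
qed

text \<open>All derivatives fall on the kernel, so \<open>f\<close> contributes nothing beyond its
  integrability.\<close>

lemma Ck_convol:
  fixes K f :: "real^'n \<Rightarrow> real"
  assumes "integrable lborel f" and "Ck k K" and "\<And>z. norm z > R \<Longrightarrow> K z = 0"
  shows "Ck k (convol f K)"
  using assms(2,3)
proof (induction k arbitrary: K)
  case 0
  then show ?case using continuous_on_convol[OF assms(1), of K R] by simp
next
  case (Suc k)
  note gK = Ck_SucD[OF Suc.prems(1)]
  have c: "continuous_on UNIV (gradient K)" by (rule Ck_Suc_gradient_continuous[OF Suc.prems(1)])
  have g0: "gradient K z = 0" if "norm z > R" for z
    using gderiv_zero_outside[OF gK(1) Suc.prems(2) that] .
  show ?case
  proof (rule Ck_SucI)
    show "GDERIV (convol f K) x :> convol f (gradient K) x" for x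
      by (rule convol_gderiv[OF assms(1) gK(1) c Suc.prems(2)])
    have "(\<lambda>x. convol f (gradient K) x $ i) = convol f (\<lambda>x. gradient K x $ i)" for i
    proof
      fix x
      have "integrable lborel (\<lambda>y. f y *\<^sub>R gradient K (x - y))"
        by (rule convol_integrand_integrable[OF assms(1) c g0])
      then show "convol f (gradient K) x $ i = convol f (\<lambda>x. gradient K x $ i) x"
        unfolding convol_def
        by (simp add: integral_bounded_linear[OF bounded_linear_vec_nth, symmetric])
    qed
    then show "Ck k (\<lambda>x. convol f (gradient K) x $ i)" for i
      using Suc.IH[OF gK(2)] g0 by simp
  qed
qed

section \<open>Mollification\<close>

text \<open>A three-epsilon argument: translation does not change the L^1 distance of
  \<open>s i\<close> and \<open>f\<close>. The factor 2 in the domination is the one delivered by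
  the induction principle for integrable functions.\<close>

lemma L1_translation_limit:
  fixes f :: "'a::euclidean_space \<Rightarrow> 'b::{banach, second_countable_topology}"
  assumes s: "\<And>i. integrable lborel (s i)" and f: "integrable lborel f"
    and T: "\<And>i e. e > 0 \<Longrightarrow> \<exists>d>0. \<forall>h. norm h < d \<longrightarrow> (LINT x|lborel. norm (s i (x + h) - s i x)) < e"
    and lim: "\<And>x. (\<lambda>i. s i x) \<longlonglongrightarrow> f x" and dom: "\<And>i x. norm (s i x) \<le> 2 * norm (f x)" and "e > 0"
  shows "\<exists>d>0. \<forall>h. norm h < d \<longrightarrow> (LINT x|lborel. norm (f (x + h) - f x)) < e"
proof -
  have sb[measurable]: "s i \<in> borel_measurable borel" and fb[measurable]: "f \<in> borel_measurable borel" for i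
    using s f borel_measurable_integrable by auto
  have "(\<lambda>i. LINT x|lborel. norm (s i x - f x)) \<longlonglongrightarrow> (LINT x|(lborel :: 'a measure). (0::real))"
  proof (rule integral_dominated_convergence[where w = "\<lambda>x. 3 * norm (f x)"])
    show "AE x in lborel. (\<lambda>i. norm (s i x - f x)) \<longlonglongrightarrow> 0"
      using lim by (simp add: tendsto_norm_zero_iff LIM_zero_iff)
    show "AE x in lborel. norm (norm (s i x - f x)) \<le> 3 * norm (f x)" for i
    proof (rule AE_I2)
      fix x
      show "norm (norm (s i x - f x)) \<le> 3 * norm (f x)"
        using norm_triangle_ineq4[of "s i x" "f x"] dom[of i x] by simp
    qed
  qed (use f in auto)
  then have "eventually (\<lambda>i. (LINT x|lborel. norm (s i x - f x)) < e / 3) sequentially"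
    using \<open>e > 0\<close> by (intro order_tendstoD) auto
  then obtain i where i: "(LINT x|lborel. norm (s i x - f x)) < e / 3"
    by (auto simp: eventually_sequentially)
  obtain d where d: "d > 0" "\<And>h. norm h < d \<Longrightarrow> (LINT x|lborel. norm (s i (x + h) - s i x)) < e / 3"
    using T[of "e / 3" i] \<open>e > 0\<close> by auto
  have "(LINT x|lborel. norm (f (x + h) - f x)) < e" if h: "norm h < d" for h
  proof -
    have it: "integrable lborel (\<lambda>x. g (x + h))" if "integrable lborel g" for g :: "'a \<Rightarrow> 'b"
      using that lborel_integrable_translate(1)[of g h] borel_measurable_integrable by auto
    have "(LINT x|lborel. norm (f (x + h) - f x)) \<le> (LINT x|lborel. norm (s i (x + h) - f (x + h))
        + norm (s i (x + h) - s i x) + norm (s i x - f x))"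
    proof (rule integral_mono)
      fix x
      show "norm (f (x + h) - f x) \<le> norm (s i (x + h) - f (x + h))
        + norm (s i (x + h) - s i x) + norm (s i x - f x)"
        using norm_triangle_ineq[of "f (x + h) - s i (x + h) + (s i (x + h) - s i x)" "s i x - f x"]
          norm_triangle_ineq[of "f (x + h) - s i (x + h)" "s i (x + h) - s i x"]
        by (simp add: norm_minus_commute)
    qed (use it[OF f] it[OF s] s f in auto)
    also have "\<dots> = (LINT x|lborel. norm (s i (x + h) - f (x + h)))
        + (LINT x|lborel. norm (s i (x + h) - s i x)) + (LINT x|lborel. norm (s i x - f x))"
      using it[OF f] it[OF s] s f by simp
    also have "(LINT x|lborel. norm (s i (x + h) - f (x + h))) = (LINT x|lborel. norm (s i x - f x))"
      by (rule lborel_integrable_translate(2)[where f = "\<lambda>x. norm (s i x - f x)"]) simp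
    finally show ?thesis using i d(2)[OF h] by simp
  qed
  with d(1) show ?thesis by blast
qed

text \<open>Squeeze \<open>A\<close> between a compact \<open>K\<close> and an open \<open>U\<close>
  with U - K small. If h is so short that \<open>K\<close> moved by h or -h stays in
  \<open>U\<close>, the indicators at x and x + h can differ only when x or x + h lies in U -
  K.\<close>

lemma L1_translation_indicator:
  fixes A :: "'a::euclidean_space set" and c :: "'b::{banach, second_countable_topology}"
  assumes A: "A \<in> sets lborel" "bounded A" and "e > 0"
  shows "\<exists>d>0. \<forall>h. norm h < d \<longrightarrow>
    (LINT x|lborel. norm (indicator A (x + h) *\<^sub>R c - indicator A x *\<^sub>R c)) < e"
proof -
  have AL: "A \<in> sets lebesgue" using A(1) by simp
  \<comment> \<open>U - K has measure at most 2 e' and occurs twice, hence the 4; the +1 admits c =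
    0.\<close>
  define e' where "e' = e / (4 * (norm c + 1))"
  have "e' > 0" using \<open>e > 0\<close> unfolding e'_def by (simp add: add_nonneg_pos)
  obtain U where U: "open U" "A \<subseteq> U" "U - A \<in> lmeasurable" "emeasure lebesgue (U - A) < ennreal e'"
    using sets_lebesgue_outer_open[OF AL \<open>e' > 0\<close>] .
  obtain K where K: "closed K" "K \<subseteq> A" "A - K \<in> lmeasurable" "emeasure lebesgue (A - K) < ennreal e'"
    using sets_lebesgue_inner_closed[OF AL \<open>e' > 0\<close>] .
  have "compact K" using K A(2) compact_eq_bounded_closed bounded_subset by blast
  then obtain d where d: "d > 0" "(\<Union>x\<in>K. ball x d) \<subseteq> U"
    using compact_subset_open_imp_ball_epsilon_subset[OF _ U(1)] K(2) U(2) by (metis subset_trans)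
  let ?D = "U - K"
  have Db[measurable]: "?D \<in> sets borel" using U(1) K(1) by auto
  have DU: "?D = (U - A) \<union> (A - K)" using U(2) K(2) by auto
  have "emeasure lborel ?D = emeasure lebesgue ?D" using Db by simp
  also have "\<dots> \<le> emeasure lebesgue (U - A) + emeasure lebesgue (A - K)"
    unfolding DU using U(3) K(3) by (intro emeasure_subadditive) (auto simp: fmeasurable_def)
  also have "\<dots> \<le> ennreal (2 * e')"
    using U(4) K(4) \<open>e' > 0\<close> by (metis add_mono less_imp_le ennreal_plus mult_2)
  finally have De: "emeasure lborel ?D \<le> ennreal (2 * e')" .
  then have fin: "emeasure lborel ?D < \<infinity>" by (metis ennreal_less_top infinity_ennreal_def le_less_trans)
  have Dm: "measure lborel ?D \<le> 2 * e'"
    using De \<open>e' > 0\<close> by (simp add: measure_def enn2real_leI)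
  have iD: "integrable lborel (\<lambda>x. indicator ?D x :: real)" using fin by (simp add: integrable_indicator_iff)
  have iDh: "integrable lborel (\<lambda>x. indicator ?D (x + h) :: real)" for h
    using iD lborel_integrable_translate(1)[of "indicator ?D :: 'a \<Rightarrow> real" h] by simp
  have "(LINT x|lborel. norm (indicator A (x + h) *\<^sub>R c - indicator A x *\<^sub>R c)) < e"
    if h: "norm h < d" for h
  proof -
    have 1: "x \<in> U" if "x + h \<in> K" for x
    proof -
      have "x \<in> ball (x + h) d" using h by (simp add: dist_norm)
      then show ?thesis using d(2) that by blast
    qed
    have 2: "x + h \<in> U" if "x \<in> K" for x
    proof -
      have "x + h \<in> ball x d" using h by (simp add: dist_norm)
      then show ?thesis using d(2) that by blast
    qed
    have "(LINT x|lborel. norm (indicator A (x + h) *\<^sub>R c - indicator A x *\<^sub>R c))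
      \<le> (LINT x|lborel. norm c * (indicator ?D (x + h) + indicator ?D x))"
    proof (rule Bochner_Integration.integral_mono')
      fix x
      have "A \<subseteq> U" "K \<subseteq> A" by fact+
      then show "norm (indicator A (x + h) *\<^sub>R c - indicator A x *\<^sub>R c) \<le> norm c * (indicator ?D (x + h)
          + indicator ?D x)"
        using 1[of x] 2[of x] by (auto simp: indicator_def)
    qed (use iD iDh in auto)
    also have "\<dots> = norm c * ((LINT x|lborel. indicator ?D (x + h)) + (LINT x|lborel. indicator ?D x))"
      using iD iDh by simp
    also have "(LINT x|lborel. indicator ?D (x + h) :: real) = (LINT x|lborel. indicator ?D x)"
      by (rule lborel_integrable_translate(2)[where f = "indicator ?D"]) simp
    also have "(LINT x|lborel. indicator ?D x :: real) = measure lborel ?D" using fin by simp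
    also have "norm c * (measure lborel ?D + measure lborel ?D) \<le> norm c * (4 * e')"
      using Dm by (intro mult_left_mono) auto
    also have "\<dots> < e" using \<open>e > 0\<close> unfolding e'_def by (simp add: field_simps add_pos_nonneg)
    finally show ?thesis .
  qed
  with d(1) show ?thesis by blast
qed

text \<open>The conclusion quantifies over \<open>e\<close> so that the induction hypotheses are
  available at e/2.\<close>

lemma L1_translation_continuous:
  fixes g :: "'a::euclidean_space \<Rightarrow> 'b::{banach, second_countable_topology}"
  assumes "integrable lborel g"
  shows "\<And>e. e > 0 \<Longrightarrow> \<exists>d>0. \<forall>h. norm h < d \<longrightarrow> (LINT x|lborel. norm (g (x + h) - g x)) < e"
  using assms
proof (induction rule: integrable_induct)
  case (base A c)
  \<comment> \<open>\<open>A\<close> has finite measure but may be unbounded, so it is first cut off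
    by balls.\<close>
  let ?s = "\<lambda>i x. indicator (A \<inter> cball 0 (real i)) x *\<^sub>R c"
  have A[measurable]: "A \<in> sets borel" using base by simp
  have fin: "emeasure lborel A < \<infinity>" using base by simp
  have finB: "emeasure lborel (A \<inter> cball 0 (real i)) < \<infinity>" for i
    by (rule le_less_trans[OF emeasure_mono fin]) auto
  show ?case
  proof (rule L1_translation_limit[of ?s])
    show "integrable lborel (?s i)" for i
      using finB[of i] by (intro integrable_scaleR_left) (auto simp: integrable_indicator_iff)
    show "integrable lborel (\<lambda>x. indicator A x *\<^sub>R c)"
      using fin by (intro integrable_scaleR_left) (auto simp: integrable_indicator_iff)
    show "(\<lambda>i. ?s i x) \<longlonglongrightarrow> indicator A x *\<^sub>R c" for x
    proof -
      obtain N where "norm x \<le> real N" using real_arch_simple by blast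
      then have "eventually (\<lambda>i. ?s i x = indicator A x *\<^sub>R c) sequentially"
        unfolding eventually_sequentially by (intro exI[of _ N]) (auto simp: indicator_def)
      then show ?thesis by (rule tendsto_eventually)
    qed
    show "norm (?s i x) \<le> 2 * norm (indicator A x *\<^sub>R c)" for i x by (auto simp: indicator_def)
    show "\<exists>d>0. \<forall>h. norm h < d \<longrightarrow> (LINT x|lborel. norm (?s i (x + h) - ?s i x)) < e" if "e > 0" for i e
      using that by (intro L1_translation_indicator) (auto intro: bounded_Int)
  qed (use base in auto)
next
  case (add f g)
  then have "e / 2 > 0" by simp
  obtain d1 where d1: "d1 > 0" "\<And>h. norm h < d1 \<Longrightarrow> (LINT x|lborel. norm (f (x + h) - f x)) < e / 2"
    using add.IH(1)[OF \<open>e / 2 > 0\<close>] by blast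
  obtain d2 where d2: "d2 > 0" "\<And>h. norm h < d2 \<Longrightarrow> (LINT x|lborel. norm (g (x + h) - g x)) < e / 2"
    using add.IH(2)[OF \<open>e / 2 > 0\<close>] by blast
  have "(LINT x|lborel. norm ((f (x + h) + g (x + h)) - (f x + g x))) < e" if h: "norm h < min d1 d2" for h
  proof -
    have it: "integrable lborel (\<lambda>x. k (x + h))" if "integrable lborel k" for k :: "'a \<Rightarrow> 'b"
      using that lborel_integrable_translate(1)[of k h] borel_measurable_integrable by auto
    have "(LINT x|lborel. norm ((f (x + h) + g (x + h)) - (f x + g x)))
      \<le> (LINT x|lborel. norm (f (x + h) - f x) + norm (g (x + h) - g x))"
    proof (rule integral_mono)
      show "norm ((f (x + h) + g (x + h)) - (f x + g x)) \<le> norm (f (x + h) - f x) + norm (g (x + h) - g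
          x)" for x
        using norm_triangle_ineq[of "f (x + h) - f x" "g (x + h) - g x"] by (simp add: algebra_simps)
    qed (use it[OF add.hyps(1)] it[OF add.hyps(2)] add.hyps in auto)
    also have "\<dots> = (LINT x|lborel. norm (f (x + h) - f x)) + (LINT x|lborel. norm (g (x + h) - g x))"
      using it[OF add.hyps(1)] it[OF add.hyps(2)] add.hyps by simp
    finally show ?thesis using d1(2)[of h] d2(2)[of h] h by simp
  qed
  moreover have "min d1 d2 > 0" using d1(1) d2(1) by simp
  ultimately show ?case by blast
next
  case (lim f s)
  show ?case
  proof (rule L1_translation_limit[of s f])
    show "integrable lborel (s i)" for i using lim.hyps by simp
    show "integrable lborel f" using lim.hyps by simp
    show "(\<lambda>i. s i x) \<longlonglongrightarrow> f x" for x using lim.hyps by simp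
    show "norm (s i x) \<le> 2 * norm (f x)" for i x using lim.hyps by simp
    show "\<exists>d>0. \<forall>h. norm h < d \<longrightarrow> (LINT x|lborel. norm (s i (x + h) - s i x)) < e" if "e > 0" for i e
      by (rule lim.IH[OF that])
  qed (rule lim.prems)
qed

section \<open>The mollifier and approximation in L^1\<close>

definition bump :: "real \<Rightarrow> real^'n \<Rightarrow> real" where
  "bump r z = flat_exp 1 (r\<^sup>2 - z \<bullet> z)"

text \<open>Each radius is normalised by its own integral rather than obtained by rescaling one
  fixed kernel.\<close>

definition mollifier :: "real \<Rightarrow> real^'n \<Rightarrow> real" where
  "mollifier r z = bump r z / (LINT z|lborel. bump r (z :: real^'n))"

lemma bump_nonneg: "bump r z \<ge> 0"
  by (simp add: bump_def flat_exp_def)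

lemma bump_pos_iff: "r > 0 \<Longrightarrow> bump r z > 0 \<longleftrightarrow> norm z < r"
  using power2_less_imp_less[of "norm z" r] power_strict_mono[of "norm z" r 2]
  by (auto simp: bump_def flat_exp_def dot_square_norm)

lemma bump_eq_0: "r > 0 \<Longrightarrow> norm z \<ge> r \<Longrightarrow> bump r z = 0"
  using bump_pos_iff[of r z] bump_nonneg[of r z] by simp

lemma Ck_bump: "Ck k (\<lambda>z. bump r (z - a))"
  unfolding bump_def by (rule Ck_flat_exp)

lemma continuous_bump: "continuous_on UNIV (bump r)"
  using Ck_imp_continuous[OF Ck_bump[of 0 r 0]] by simp

lemma integrable_bump: "r > 0 \<Longrightarrow> integrable lborel (bump r)"
  by (rule integrable_compact_support[OF continuous_bump, of r]) (simp add: bump_eq_0)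

lemma integral_bump_pos:
  assumes "r > 0"
  shows "(LINT z|lborel. bump r (z :: real^'n)) > 0"
proof (rule ccontr)
  assume "\<not> ?thesis"
  moreover have "(LINT z|lborel. bump r (z :: real^'n)) \<ge> 0"
    by (rule integral_nonneg_AE) (simp add: bump_nonneg)
  ultimately have "(LINT z|lborel. bump r (z :: real^'n)) = 0" by simp
  then have "AE z in lborel. bump r (z :: real^'n) = 0"
    by (subst (asm) integral_nonneg_eq_0_iff_AE[OF integrable_bump[OF assms]]) (simp_all add: bump_nonneg)
  then have "AE z in lborel. (z :: real^'n) \<notin> ball 0 r"
    by (rule eventually_mono) (use bump_pos_iff[OF assms] in force)
  then have "ball (0 :: real^'n) r \<in> null_sets lborel"
    by (subst AE_iff_null_sets) auto
  then have "measure lborel (ball (0 :: real^'n) r) = 0" by (simp add: measure_eq_0_null_sets)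
  then show False using content_ball_pos[OF assms, of "0 :: real^'n"] by simp
qed

lemma mollifier_nonneg: "r > 0 \<Longrightarrow> mollifier r z \<ge> 0"
  using integral_bump_pos[of r] by (simp add: mollifier_def bump_nonneg)

lemma mollifier_eq_0: "r > 0 \<Longrightarrow> norm z \<ge> r \<Longrightarrow> mollifier r z = 0"
  by (simp add: mollifier_def bump_eq_0)

lemma Ck_mollifier: "Ck k (\<lambda>z. mollifier r (z - a))"
  unfolding mollifier_def divide_inverse by (intro Ck_mult Ck_bump Ck_const)

lemma mollifier_minus: "mollifier r (- z) = mollifier r z"
  by (simp add: mollifier_def bump_def)

lemma mollifier_commute: "mollifier r (x - y) = mollifier r (y - x)"
  using mollifier_minus[of r "y - x"] by simp

lemma continuous_mollifier: "continuous_on UNIV (mollifier r)"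
  using Ck_imp_continuous[OF Ck_mollifier[of 0 r 0]] by simp

lemma borel_measurable_mollifier[measurable]: "mollifier r \<in> borel_measurable borel"
  using continuous_mollifier borel_measurable_continuous_onI by blast

lemma integrable_mollifier: "r > 0 \<Longrightarrow> integrable lborel (mollifier r)"
  by (simp add: mollifier_def[abs_def] integrable_bump)

lemma integral_mollifier: "r > 0 \<Longrightarrow> (LINT z|lborel. mollifier r z) = 1"
  by (simp add: mollifier_def integral_bump_pos less_imp_neq[symmetric])

lemma convol_mollifier_integrand:
  fixes g :: "real^'n \<Rightarrow> 'b::euclidean_space"
  assumes "r > 0" and g: "integrable lborel g"
  shows "integrable lborel (\<lambda>y. mollifier r y *\<^sub>R g (x - y))"
proof -
  have gb[measurable]: "g \<in> borel_measurable borel" using g borel_measurable_integrable by auto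
  obtain B where B: "\<And>z::real^'n. norm (mollifier r z) \<le> B"
    using compact_support_bounded[OF continuous_mollifier, of r r] mollifier_eq_0[OF assms(1)]
    by (metis less_imp_le)
  have "integrable lborel (\<lambda>y. g (x - y))"
    using g lborel_integrable_reflect(1)[of g x] by simp
  then show ?thesis
  proof (rule Bochner_Integration.integrable_bound[OF integrable_scaleR_right[of B]])
    have "B \<ge> 0" using B[of 0] norm_ge_zero order_trans by blast
    then have "norm (mollifier r y *\<^sub>R g (x - y)) \<le> norm (B *\<^sub>R g (x - y))" for y
      using mult_right_mono[OF B[of y] norm_ge_zero[of "g (x - y)"]] by simp
    then show "AE y in lborel. norm (mollifier r y *\<^sub>R g (x - y)) \<le> norm (B *\<^sub>R g (x - y))" by simp
  qed simp
qed

text \<open>Because the kernel has mass one, a constant can be moved under the integral; with c = g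
  x the approximation error becomes an average of differences of \<open>g\<close>.\<close>

lemma convol_mollifier_minus:
  fixes g :: "real^'n \<Rightarrow> 'b::euclidean_space"
  assumes "r > 0" and g: "integrable lborel g"
  shows "convol (mollifier r) g x - c = (LINT y|lborel. mollifier r y *\<^sub>R (g (x - y) - c))"
    and "integrable lborel (\<lambda>y. mollifier r y *\<^sub>R (g (x - y) - c))"
proof -
  have i: "integrable lborel (\<lambda>y::real^'n. mollifier r y *\<^sub>R c)"
    using integrable_mollifier[OF assms(1)] by (rule integrable_scaleR_left)
  then show "integrable lborel (\<lambda>y. mollifier r y *\<^sub>R (g (x - y) - c))"
    using Bochner_Integration.integrable_diff[OF convol_mollifier_integrand[OF assms]]
    by (simp add: scaleR_right_diff_distrib)
  have "c = (LINT y|lborel. mollifier r (y :: real^'n) *\<^sub>R c)"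
    by (simp add: integral_mollifier[OF assms(1)] integrable_mollifier[OF assms(1)])
  then show "convol (mollifier r) g x - c = (LINT y|lborel. mollifier r y *\<^sub>R (g (x - y) - c))"
    using Bochner_Integration.integral_diff[OF convol_mollifier_integrand[OF assms] i, of x]
    by (simp add: scaleR_right_diff_distrib convol_def)
qed

lemma borel_measurable_convol_mollifier:
  fixes g :: "real^'n \<Rightarrow> 'b::euclidean_space"
  assumes [measurable]: "g \<in> borel_measurable borel"
  shows "convol (mollifier r) g \<in> borel_measurable borel"
proof -
  have "(\<lambda>x. LINT y|lborel. mollifier r y *\<^sub>R g (x - y)) \<in> borel_measurable lborel"
    by measurable
  then show ?thesis unfolding convol_def[abs_def] by simp
qed

text \<open>Tonelli bounds the L^1 error by the average over |y| < r of the L^1 norms of g(x - y) -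
  g(x), which are small by continuity of translation. Working with nonnegative integrals yields
  integrability of the convolution at the same time.\<close>

lemma convol_mollifier_L1:
  fixes g :: "real^'n \<Rightarrow> 'b::euclidean_space"
  assumes g: "integrable lborel g" and "e > 0"
  obtains d where "d > 0"
    "\<And>r. 0 < r \<Longrightarrow> r < d \<Longrightarrow> integrable lborel (convol (mollifier r) g)"
    "\<And>r. 0 < r \<Longrightarrow> r < d \<Longrightarrow> (LINT x|lborel. norm (convol (mollifier r) g x - g x)) < e"
proof -
  have gb[measurable]: "g \<in> borel_measurable borel" using g borel_measurable_integrable by auto
  have cb[measurable]: "convol (mollifier r) g \<in> borel_measurable borel" for r
    by (rule borel_measurable_convol_mollifier) simp
  obtain d where d: "d > 0" "\<And>h. norm h < d \<Longrightarrow> (LINT x|lborel. norm (g (x + h) - g x)) < e / 2"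
    using L1_translation_continuous[OF g, of "e / 2"] \<open>e > 0\<close> by auto
  have *: "integrable lborel (convol (mollifier r) g) \<and>
      (LINT x|lborel. norm (convol (mollifier r) g x - g x)) < e" if r: "0 < r" "r < d" for r
  proof -
    let ?c = "\<lambda>x. convol (mollifier r) g x - g x"
    have T: "(\<integral>\<^sup>+x. ennreal (norm (g (x - y) - g x)) \<partial>lborel) \<le> ennreal (e / 2)" if "norm y < r" for y
    proof -
      have "integrable lborel (\<lambda>x. g (x - y))"
        using lborel_integrable_translate(1)[of g "- y"] g by simp
      then have "integrable lborel (\<lambda>x. norm (g (x - y) - g x))" using g by simp
      then have "(\<integral>\<^sup>+x. ennreal (norm (g (x - y) - g x)) \<partial>lborel) = ennreal (LINT x|lborel. norm (g (x -
          y) - g x))"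
        by (rule nn_integral_eq_integral) simp
      also have "\<dots> \<le> ennreal (e / 2)" using d(2)[of "- y"] that r by (intro ennreal_leI) simp
      finally show ?thesis .
    qed
    have "norm (?c x) \<le> (LINT y|lborel. norm (mollifier r y *\<^sub>R (g (x - y) - g x)))" for x
      unfolding convol_mollifier_minus(1)[OF r(1) g] by (rule integral_norm_bound)
    then have "ennreal (norm (?c x)) \<le> (\<integral>\<^sup>+y. ennreal (norm (mollifier r y *\<^sub>R (g (x - y) - g x)))
        \<partial>lborel)" for x
      by (subst nn_integral_eq_integral[OF integrable_norm[OF convol_mollifier_minus(2)[OF r(1) g]]])
        (auto intro: ennreal_leI)
    then have "(\<integral>\<^sup>+x. ennreal (norm (?c x)) \<partial>lborel) \<le>
        (\<integral>\<^sup>+x. (\<integral>\<^sup>+y. ennreal (norm (mollifier r y *\<^sub>R (g (x - y) - g x))) \<partial>lborel) \<partial>lborel)"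
      by (intro nn_integral_mono) simp
    also have "\<dots> = (\<integral>\<^sup>+y. (\<integral>\<^sup>+x. ennreal (norm (mollifier r y *\<^sub>R (g (x - y) - g x))) \<partial>lborel) \<partial>lborel)"
      by (rule lborel_pair.Fubini') measurable
    also have "\<dots> \<le> (\<integral>\<^sup>+y. ennreal (mollifier r (y :: real^'n)) * ennreal (e / 2) \<partial>lborel)"
    proof (rule nn_integral_mono)
      fix y :: "real^'n"
      have "(\<integral>\<^sup>+x. ennreal (norm (mollifier r y *\<^sub>R (g (x - y) - g x))) \<partial>lborel)
          = ennreal (mollifier r y) * (\<integral>\<^sup>+x. ennreal (norm (g (x - y) - g x)) \<partial>lborel)"
        using mollifier_nonneg[OF r(1), of y] by (subst nn_integral_cmult[symmetric]) (auto simp: ennreal_mult)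
      also have "\<dots> \<le> ennreal (mollifier r y) * ennreal (e / 2)"
        using T[of y] mollifier_eq_0[OF r(1), of y] by (cases "norm y < r") (auto intro: mult_left_mono)
      finally show "(\<integral>\<^sup>+x. ennreal (norm (mollifier r y *\<^sub>R (g (x - y) - g x))) \<partial>lborel)
        \<le> ennreal (mollifier r y) * ennreal (e / 2)" .
    qed
    also have "\<dots> = (\<integral>\<^sup>+y. ennreal (mollifier r (y :: real^'n)) \<partial>lborel) * ennreal (e / 2)"
      by (rule nn_integral_multc) simp
    also have "(\<integral>\<^sup>+y. ennreal (mollifier r (y :: real^'n)) \<partial>lborel) = 1"
      by (subst nn_integral_eq_integral)
        (auto simp: integrable_mollifier[OF r(1)] integral_mollifier[OF r(1)] mollifier_nonneg[OF r(1)])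
    finally have n: "(\<integral>\<^sup>+x. ennreal (norm (?c x)) \<partial>lborel) \<le> ennreal (e / 2)" by simp
    have ic: "integrable lborel ?c"
      by (rule integrableI_bounded) (use n in \<open>auto intro: le_less_trans\<close>)
    then have "integrable lborel (\<lambda>x. ?c x + g x)" using g by (rule Bochner_Integration.integrable_add)
    moreover have "(LINT x|lborel. norm (?c x)) < e"
    proof -
      have "ennreal (LINT x|lborel. norm (?c x)) \<le> ennreal (e / 2)"
        using n nn_integral_eq_integral[OF integrable_norm[OF ic]] by simp
      then have "(LINT x|lborel. norm (?c x)) \<le> e / 2" using \<open>e > 0\<close> by (subst (asm) ennreal_le_iff) auto
      then show ?thesis using \<open>e > 0\<close> by simp
    qed
    ultimately show ?thesis by simp
  qed
  show ?thesis by (rule that[OF d(1)]) (use * in auto)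
qed

lemma convol_mollifier_uniform:
  fixes g :: "real^'n \<Rightarrow> 'b::euclidean_space"
  assumes g: "continuous_on UNIV g" "\<And>x. norm x > R \<Longrightarrow> g x = 0" and i: "integrable lborel g" and "e > 0"
  obtains d where "d > 0" "\<And>r x. 0 < r \<Longrightarrow> r < d \<Longrightarrow> norm (convol (mollifier r) g x - g x) \<le> e"
proof -
  obtain d where d: "d > 0" "\<And>x y. norm (x - y) < d \<Longrightarrow> norm (g x - g y) < e"
    using compact_support_uniformly_continuous[OF g \<open>e > 0\<close>] by metis
  have "norm (convol (mollifier r) g x - g x) \<le> e" if r: "0 < r" "r < d" for r x
  proof -
    have "norm (convol (mollifier r) g x - g x) \<le> (LINT y|lborel. norm (mollifier r y *\<^sub>R (g (x - y) - g x)))"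
      unfolding convol_mollifier_minus(1)[OF r(1) i] by (rule integral_norm_bound)
    also have "\<dots> \<le> (LINT y|lborel. e * mollifier r (y :: real^'n))"
    proof (rule integral_mono[OF integrable_norm[OF convol_mollifier_minus(2)[OF r(1) i]]])
      show "norm (mollifier r y *\<^sub>R (g (x - y) - g x)) \<le> e * mollifier r y" for y
      proof (cases "norm y < r")
        case True
        then have "norm (g (x - y) - g x) \<le> e" using d(2)[of "x - y" x] r(2) by simp
        then show ?thesis using mollifier_nonneg[OF r(1), of y] using mult_left_mono[of "norm (g (x - y)
            - g x)" e "mollifier r y"] by (simp add: mult.commute)
      qed (use mollifier_eq_0[OF r(1), of y] in simp)
    qed (simp add: integrable_mollifier[OF r(1)])
    also have "\<dots> = e" by (simp add: integral_mollifier[OF r(1)])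
    finally show ?thesis .
  qed
  with d(1) show ?thesis using that by blast
qed

section \<open>Inequalities and convergence\<close>

text \<open>A weighted geometric mean is at most the maximum. It stands in for Hoelder's inequality:
  a product is bounded pointwise by a sum of integrable functions.\<close>

lemma powr_mult_le_add:
  fixes X Y \<theta> :: real
  assumes "0 \<le> X" "0 \<le> Y" "0 \<le> \<theta>" "\<theta> \<le> 1"
  shows "X powr \<theta> * Y powr (1 - \<theta>) \<le> X + Y"
proof -
  let ?m = "max X Y"
  have "X powr \<theta> * Y powr (1 - \<theta>) \<le> ?m powr \<theta> * ?m powr (1 - \<theta>)"
    using assms by (intro mult_mono powr_mono2) auto
  also have "\<dots> = ?m" using assms by (simp add: powr_add[symmetric])
  also have "\<dots> \<le> X + Y" using assms by simp
  finally show ?thesis .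
qed

text \<open>A crude form of Young's inequality, obtained by replacing the smaller of the two numbers
  by the larger. It suffices for integrability; \<open>weighted_young\<close> gains a small constant
  from it by scaling.\<close>

lemma powr_minus_one_mult_le:
  fixes a b q :: real
  assumes "0 \<le> a" "0 \<le> b" "1 \<le> q"
  shows "a powr (q - 1) * b \<le> a powr q + b powr q"
proof -
  have *: "x powr (q - 1) * x = x powr q" if "x \<ge> 0" for x
    using that powr_mult_base[of x "q - 1"] by (simp add: mult.commute)
  consider "a \<le> b" | "b \<le> a" by linarith
  then show ?thesis
  proof cases
    case 1
    then have "a powr (q - 1) * b \<le> b powr (q - 1) * b" using assms by (intro mult_right_mono powr_mono2) auto
    then show ?thesis using *[OF assms(2)] powr_ge_zero[of a q] by linarith
  next
    case 2
    then have "a powr (q - 1) * b \<le> a powr (q - 1) * a" by (intro mult_left_mono) auto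
    then show ?thesis using *[OF assms(1)] powr_ge_zero[of b q] by linarith
  qed
qed

lemma powr_le_one_add:
  fixes a q s :: real
  assumes "0 \<le> a" "0 \<le> q" "q \<le> s"
  shows "a powr q \<le> 1 + a powr s"
proof (cases "a \<le> 1")
  case True
  then have "a powr q \<le> 1" using assms by (simp add: powr_le1)
  then show ?thesis using powr_ge_zero[of a s] by linarith
next
  case False
  then have "a powr q \<le> a powr s" using assms by (intro powr_mono) auto
  then show ?thesis by linarith
qed

lemma abs_powr_mult_self:
  fixes t p :: real
  shows "\<bar>\<bar>t\<bar> powr (p - 2) * t\<bar> = \<bar>t\<bar> powr (p - 1)"
proof (cases "t = 0")
  case False
  then have "\<bar>t\<bar> powr (p - 2) * \<bar>t\<bar> powr 1 = \<bar>t\<bar> powr (p - 1)"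
    by (subst powr_add[symmetric]) (simp add: algebra_simps)
  with False show ?thesis by (simp add: abs_mult)
qed simp

lemma norm_powr_scaleR_self:
  fixes a :: "'a::real_inner"
  shows "norm (norm a powr (p - 2) *\<^sub>R a) = norm a powr (p - 1)"
  using abs_powr_mult_self[of "norm a" p] by (simp add: abs_mult)

text \<open>Convexity of |.|^q: its graph lies above the tangent at \<open>c\<close>. It yields
  Jensen's inequality, the monotonicity of the flux and the convexity part of Picone's
  inequality.\<close>

lemma powr_tangent_inequality:
  fixes a c :: "'a::real_inner" and q :: real
  assumes "1 < q"
  shows "q * (norm c powr (q - 2) * (c \<bullet> a)) \<le> norm a powr q + (q - 1) * norm c powr q"
proof -
  have "norm c powr (q - 2) * (c \<bullet> a) \<le> norm c powr (q - 2) * (norm c * norm a)"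
    by (intro mult_left_mono norm_cauchy_schwarz) simp
  also have "\<dots> = norm a * norm c powr (q - 1)"
    using abs_powr_mult_self[of "norm c" q] by (simp add: abs_mult mult.assoc)
  also have "\<dots> \<le> norm a powr q / q + (norm c powr (q - 1)) powr (q / (q - 1)) / (q / (q - 1))"
    using assms by (intro Youngs_inequality) (auto simp: field_simps)
  also have "(norm c powr (q - 1)) powr (q / (q - 1)) = norm c powr q"
    using assms by (simp add: powr_powr)
  finally have "norm c powr (q - 2) * (c \<bullet> a) \<le> (norm a powr q + (q - 1) * norm c powr q) / q"
    using assms by (simp add: field_simps)
  then show ?thesis using assms by (simp add: pos_le_divide_eq mult.commute)
qed

lemma norm_powr_inner_self:
  fixes x :: "'a::real_inner"
  shows "norm x powr (q - 2) * (x \<bullet> x) = norm x powr q"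
proof -
  have "norm x powr (q - 2) * (x \<bullet> x) = norm x * (norm x * norm x powr (q - 2))"
    by (simp add: dot_square_norm power2_eq_square algebra_simps)
  also have "norm x * norm x powr (q - 2) = norm x powr (q - 1)" by (subst powr_mult_base) auto
  also have "norm x * norm x powr (q - 1) = norm x powr q" by (subst powr_mult_base) auto
  finally show ?thesis .
qed

text \<open>Sum of the tangent inequalities at \<open>a\<close> and at \<open>c\<close>, each
  evaluated at the other point.\<close>

lemma powr_flux_monotone:
  fixes a c :: "'a::real_inner" and q :: real
  assumes "1 < q"
  shows "0 \<le> (norm a powr (q - 2) *\<^sub>R a - norm c powr (q - 2) *\<^sub>R c) \<bullet> (a - c)"
proof -
  have e: "(k *\<^sub>R a - l *\<^sub>R c) \<bullet> (a - c) = k * (a \<bullet> a) + l * (c \<bullet> c) - l * (c \<bullet> a) - k * (a \<bullet> c)"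
    for k l :: real
    by (simp add: inner_diff_left inner_diff_right inner_commute algebra_simps)
  have "0 \<le> q * ((norm a powr (q - 2) *\<^sub>R a - norm c powr (q - 2) *\<^sub>R c) \<bullet> (a - c))"
    using powr_tangent_inequality[OF assms, of c a] powr_tangent_inequality[OF assms, of a c]
    unfolding e norm_powr_inner_self by (simp add: left_diff_distrib right_diff_distrib distrib_left)
  then show ?thesis using assms by (simp add: zero_le_mult_iff)
qed

text \<open>Integrate the tangent inequality at the mean value \<open>c\<close> against the kernel,
  a probability density; the terms involving the tangent then collapse to multiples of
  |c|^q.\<close>

lemma jensen_convol_mollifier:
  fixes g :: "real^'n \<Rightarrow> 'b::euclidean_space"
  assumes "r > 0" "q > 1" and g: "integrable lborel g" and gq: "integrable lborel (\<lambda>x. norm (g x) powr q)"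
  shows "norm (convol (mollifier r) g x) powr q \<le> convol (mollifier r) (\<lambda>x. norm (g x) powr q) x"
proof -
  define c where "c = convol (mollifier r) g x"
  let ?k = "norm c powr (q - 2)"
  note ig = convol_mollifier_integrand[OF \<open>r > 0\<close> g, of x]
  note iq = convol_mollifier_integrand[OF \<open>r > 0\<close> gq, of x]
  have cc: "?k * (c \<bullet> c) = norm c powr q" by (rule norm_powr_inner_self)
  have i1: "integrable lborel (\<lambda>y. c \<bullet> (mollifier r y *\<^sub>R g (x - y)))"
    by (rule integrable_inner_right[OF ig])
  have i2: "integrable lborel (\<lambda>y::real^'n. norm c powr q * mollifier r y)"
    by (simp add: integrable_mollifier[OF \<open>r > 0\<close>])
  have "q * norm c powr q - (q - 1) * norm c powr q
      = q * ?k * (LINT y|lborel. c \<bullet> (mollifier r y *\<^sub>R g (x - y))) - (q - 1) * norm c powr q"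
    using integral_inner_right[OF ig, of c] cc by (simp add: c_def convol_def mult.assoc)
  also have "\<dots> = (LINT y|lborel. q * ?k * (c \<bullet> (mollifier r y *\<^sub>R g (x - y)))
      - (q - 1) * (norm c powr q * mollifier r (y :: real^'n)))"
    using i1 i2 by (subst Bochner_Integration.integral_diff)
      (simp_all add: integral_mollifier[OF \<open>r > 0\<close>])
  also have "\<dots> \<le> (LINT y|lborel. mollifier r y *\<^sub>R (norm (g (x - y)) powr q))"
  proof (rule integral_mono)
    fix y
    have "mollifier r y * (q * (?k * (c \<bullet> g (x - y)))) \<le>
        mollifier r y * (norm (g (x - y)) powr q + (q - 1) * norm c powr q)"
      using mollifier_nonneg[OF \<open>r > 0\<close>] by (intro mult_left_mono powr_tangent_inequality \<open>q > 1\<close>)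
    then show "q * ?k * (c \<bullet> (mollifier r y *\<^sub>R g (x - y))) - (q - 1) * (norm c powr q * mollifier r y)
      \<le> mollifier r y *\<^sub>R norm (g (x - y)) powr q"
      by (simp add: algebra_simps)
  qed (intro Bochner_Integration.integrable_diff integrable_mult_right i1 i2 iq)+
  finally show ?thesis unfolding c_def[symmetric] by (simp add: convol_def algebra_simps)
qed

text \<open>Truncating \<open>k n\<close> at the limiting majorant \<open>m'\<close> reduces this to the usual theorem, at the cost of an
  \<open>L\<^sup>1\<close> error of at most \<open>\<bar>m n - m'\<bar>\<close>.\<close>

lemma integral_dominated_convergence_moving:
  fixes k :: "nat \<Rightarrow> 'a \<Rightarrow> real"
  assumes k[measurable]: "\<And>n. k n \<in> borel_measurable M" "l \<in> borel_measurable M"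
    and m: "\<And>n. integrable M (m n)" "integrable M m'"
    and lim: "AE x in M. (\<lambda>n. k n x) \<longlonglongrightarrow> l x"
    and bound: "\<And>n. AE x in M. \<bar>k n x\<bar> \<le> m n x"
    and mlim: "AE x in M. (\<lambda>n. m n x) \<longlonglongrightarrow> m' x"
    and mL1: "(\<lambda>n. LINT x|M. \<bar>m n x - m' x\<bar>) \<longlonglongrightarrow> 0"
  shows "integrable M l" and "\<And>n. integrable M (k n)" and "(\<lambda>n. LINT x|M. k n x) \<longlonglongrightarrow> (LINT x|M. l x)"
proof -
  have m'[measurable]: "m' \<in> borel_measurable M" "m n \<in> borel_measurable M" for n
    using m borel_measurable_integrable by auto
  show ik: "integrable M (k n)" for n
    by (rule Bochner_Integration.integrable_bound[OF m(1)[of n]]) (use bound[of n] in auto)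
  define c where "c n x = max (- m' x) (min (m' x) (k n x))" for n x
  have c[measurable]: "c n \<in> borel_measurable M" for n unfolding c_def by measurable
  have bounds: "AE x in M. \<forall>n. \<bar>k n x\<bar> \<le> m n x" using bound by (simp add: AE_all_countable)
  have l_le: "AE x in M. \<bar>l x\<bar> \<le> m' x"
    using lim mlim bounds
  proof eventually_elim
    case (elim x)
    show ?case by (rule LIMSEQ_le[OF tendsto_rabs[OF elim(1)] elim(2)]) (use elim(3) in auto)
  qed
  show il: "integrable M l"
    by (rule Bochner_Integration.integrable_bound[OF m(2)]) (use l_le in auto)
  have clim: "(\<lambda>n. LINT x|M. c n x) \<longlonglongrightarrow> (LINT x|M. l x)"
  proof (rule integral_dominated_convergence[where w = m'])
    show "AE x in M. (\<lambda>n. c n x) \<longlonglongrightarrow> l x"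
      using lim l_le
    proof eventually_elim
      case (elim x)
      have "(\<lambda>n. c n x) \<longlonglongrightarrow> max (- m' x) (min (m' x) (l x))"
        unfolding c_def using elim(1) by (intro tendsto_intros)
      moreover have "max (- m' x) (min (m' x) (l x)) = l x" using elim(2) by auto
      ultimately show ?case by simp
    qed
    show "AE x in M. norm (c n x) \<le> m' x" for n
      using l_le by eventually_elim (auto simp: c_def)
  qed (use m in auto)
  have ic: "integrable M (c n)" for n
    by (rule Bochner_Integration.integrable_bound[OF m(2)]) (use l_le in \<open>auto simp: c_def\<close>)
  have "(\<lambda>n. LINT x|M. \<bar>k n x - c n x\<bar>) \<longlonglongrightarrow> 0"
  proof (rule tendsto_sandwich[OF _ _ tendsto_const mL1])
    show "\<forall>\<^sub>F n in sequentially. (LINT x|M. \<bar>k n x - c n x\<bar>) \<le> (LINT x|M. \<bar>m n x - m' x\<bar>)"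
    proof (rule always_eventually, rule allI, rule integral_mono_AE)
      show "AE x in M. \<bar>k n x - c n x\<bar> \<le> \<bar>m n x - m' x\<bar>" for n
        using bound[of n] l_le by eventually_elim (auto simp: c_def max_def min_def abs_if split: if_splits)
    qed (use ik ic m in auto)
  qed auto
  then have "(\<lambda>n. LINT x|M. k n x - c n x) \<longlonglongrightarrow> 0"
    by (rule Lim_null_comparison[rotated]) (use integral_abs_bound in \<open>auto intro!: always_eventually\<close>)
  then have "(\<lambda>n. (LINT x|M. k n x - c n x) + (LINT x|M. c n x)) \<longlonglongrightarrow> 0 + (LINT x|M. l x)"
    using clim by (rule tendsto_add)
  then show "(\<lambda>n. LINT x|M. k n x) \<longlonglongrightarrow> (LINT x|M. l x)" using ik ic by simp
qed

section \<open>Almost everywhere convergence of mollifications along a sequence of radii\<close>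

lemma convol_mollifier_L1_tendsto:
  fixes g :: "real^'n \<Rightarrow> 'b::euclidean_space"
  assumes g: "integrable lborel g" and R: "\<And>n. 0 < R n" "R \<longlonglongrightarrow> 0"
  shows "(\<lambda>n. LINT x|lborel. norm (convol (mollifier (R n)) g x - g x)) \<longlonglongrightarrow> 0"
    and "eventually (\<lambda>n. integrable lborel (convol (mollifier (R n)) g)) sequentially"
proof -
  show "(\<lambda>n. LINT x|lborel. norm (convol (mollifier (R n)) g x - g x)) \<longlonglongrightarrow> 0"
  proof (rule tendstoI)
    fix e :: real assume "e > 0"
    obtain d where d: "d > 0" "\<And>r. 0 < r \<Longrightarrow> r < d \<Longrightarrow> (LINT x|lborel. norm (convol (mollifier r) g x - g x)) < e"
      using convol_mollifier_L1[OF g \<open>e > 0\<close>] by metis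
    have "eventually (\<lambda>n. R n < d) sequentially" using R(2) d(1) by (rule order_tendstoD)
    then show "eventually (\<lambda>n. dist (LINT x|lborel. norm (convol (mollifier (R n)) g x - g x)) 0 < e)
        sequentially"
      by eventually_elim (use d(2) R(1) in auto)
  qed
  obtain d where d: "d > 0" "\<And>r. 0 < r \<Longrightarrow> r < d \<Longrightarrow> integrable lborel (convol (mollifier r) g)"
    using convol_mollifier_L1[OF g zero_less_one] by metis
  have "eventually (\<lambda>n. R n < d) sequentially" using R(2) d(1) by (rule order_tendstoD)
  then show "eventually (\<lambda>n. integrable lborel (convol (mollifier (R n)) g)) sequentially"
    by eventually_elim (use d(2) R(1) in auto)
qed

lemma tendsto_of_norm_diff_le:
  fixes a :: "nat \<Rightarrow> 'b::real_normed_vector"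
  assumes "s \<longlonglongrightarrow> (0::real)" and "\<And>n. norm (a n - l) \<le> s n"
  shows "a \<longlonglongrightarrow> l"
  using Lim_null_comparison[of "\<lambda>n. a n - l" s sequentially] assms by (simp add: LIM_zero_iff)

text \<open>Almost everywhere convergence is extracted once, from the sum \<open>S\<close> of three
  L^1 errors, so that one subsequence serves \<open>u\<close>, \<open>G\<close> and the majorant
  \<open>\<Theta>\<close> simultaneously.\<close>

lemma mollifier_sequence:
  fixes u \<Theta> :: "real^'n \<Rightarrow> real" and G :: "real^'n \<Rightarrow> 'b::euclidean_space"
  assumes u: "integrable lborel u" and \<Theta>: "integrable lborel \<Theta>" and G: "integrable lborel G" and "d > 0"
  obtains R where "\<And>n. 0 < R n" "\<And>n. R n < d" "R \<longlonglongrightarrow> (0::real)"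
    "AE x in lborel. (\<lambda>n. convol (mollifier (R n)) u x) \<longlonglongrightarrow> u x"
    "AE x in lborel. (\<lambda>n. convol (mollifier (R n)) G x) \<longlonglongrightarrow> G x"
    "AE x in lborel. (\<lambda>n. convol (mollifier (R n)) \<Theta> x) \<longlonglongrightarrow> \<Theta> x"
    "\<And>n. integrable lborel (convol (mollifier (R n)) \<Theta>)"
    "(\<lambda>n. LINT x|lborel. \<bar>convol (mollifier (R n)) \<Theta> x - \<Theta> x\<bar>) \<longlonglongrightarrow> 0"
proof -
  define R0 where "R0 n = 1 / real (Suc n)" for n
  have R0: "\<And>n. 0 < R0 n" "R0 \<longlonglongrightarrow> 0"
    using LIMSEQ_inverse_real_of_nat by (auto simp: R0_def[abs_def] inverse_eq_divide)
  have "eventually (\<lambda>n. R0 n < d) sequentially" using R0(2) \<open>d > 0\<close> by (rule order_tendstoD)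
  then have "eventually (\<lambda>n. R0 n < d \<and> integrable lborel (convol (mollifier (R0 n)) u)
      \<and> integrable lborel (convol (mollifier (R0 n)) G) \<and> integrable lborel (convol (mollifier (R0 n))
          \<Theta>)) sequentially"
    using convol_mollifier_L1_tendsto(2)[OF u R0] convol_mollifier_L1_tendsto(2)[OF G R0]
      convol_mollifier_L1_tendsto(2)[OF \<Theta> R0] by eventually_elim auto
  then obtain N where N: "\<And>n. n \<ge> N \<Longrightarrow> R0 n < d \<and> integrable lborel (convol (mollifier (R0 n)) u)
      \<and> integrable lborel (convol (mollifier (R0 n)) G) \<and> integrable lborel (convol (mollifier (R0 n)) \<Theta>)"
    unfolding eventually_sequentially by blast
  define R1 where "R1 n = R0 (n + N)" for n
  have R1: "\<And>n. 0 < R1 n" "R1 \<longlonglongrightarrow> 0"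
    using R0 LIMSEQ_ignore_initial_segment[OF R0(2), of N] by (auto simp: R1_def[abs_def])
  have i1: "R1 n < d" "integrable lborel (convol (mollifier (R1 n)) u)"
      "integrable lborel (convol (mollifier (R1 n)) G)" "integrable lborel (convol (mollifier (R1 n)) \<Theta>)" for n
    using N[of "n + N"] by (auto simp: R1_def)
  define S where "S n x = norm (convol (mollifier (R1 n)) u x - u x) + norm (convol (mollifier (R1 n)) G
      x - G x)
      + norm (convol (mollifier (R1 n)) \<Theta> x - \<Theta> x)" for n x
  have iS: "integrable lborel (S n)" for n
    unfolding S_def using i1[of n] u G \<Theta> by auto
  have "(\<lambda>n. LINT x|lborel. norm (S n x)) \<longlonglongrightarrow> 0 + 0 + 0"
  proof -
    have "(LINT x|lborel. norm (S n x)) = (LINT x|lborel. norm (convol (mollifier (R1 n)) u x - u x))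
      + (LINT x|lborel. norm (convol (mollifier (R1 n)) G x - G x))
      + (LINT x|lborel. norm (convol (mollifier (R1 n)) \<Theta> x - \<Theta> x))" for n
    proof -
      have "norm (S n x) = S n x" for x by (simp add: S_def)
      then show ?thesis unfolding S_def using i1[of n] u G \<Theta> by simp
    qed
    then show ?thesis
      using convol_mollifier_L1_tendsto(1)[OF u R1] convol_mollifier_L1_tendsto(1)[OF G R1]
        convol_mollifier_L1_tendsto(1)[OF \<Theta> R1] by (simp only:) (intro tendsto_add)
  qed
  then obtain \<sigma> where \<sigma>: "strict_mono \<sigma>" "AE x in lborel. (\<lambda>n. S (\<sigma> n) x) \<longlonglongrightarrow> 0"
    using tendsto_L1_AE_subseq[where u = S, OF iS] by auto
  show ?thesis
  proof (rule that[of "\<lambda>n. R1 (\<sigma> n)"])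
    show "(\<lambda>n. R1 (\<sigma> n)) \<longlonglongrightarrow> 0" using LIMSEQ_subseq_LIMSEQ[OF R1(2) \<sigma>(1)] by (simp add: o_def)
    show "(\<lambda>n. LINT x|lborel. \<bar>convol (mollifier (R1 (\<sigma> n))) \<Theta> x - \<Theta> x\<bar>) \<longlonglongrightarrow> 0"
      using LIMSEQ_subseq_LIMSEQ[OF convol_mollifier_L1_tendsto(1)[OF \<Theta> R1] \<sigma>(1)] by (simp add: o_def)
    show "AE x in lborel. (\<lambda>n. convol (mollifier (R1 (\<sigma> n))) u x) \<longlonglongrightarrow> u x"
      using \<sigma>(2) by eventually_elim (erule tendsto_of_norm_diff_le, simp add: S_def)
    show "AE x in lborel. (\<lambda>n. convol (mollifier (R1 (\<sigma> n))) G x) \<longlonglongrightarrow> G x"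
      using \<sigma>(2) by eventually_elim (erule tendsto_of_norm_diff_le, simp add: S_def)
    show "AE x in lborel. (\<lambda>n. convol (mollifier (R1 (\<sigma> n))) \<Theta> x) \<longlonglongrightarrow> \<Theta> x"
      using \<sigma>(2) by eventually_elim (erule tendsto_of_norm_diff_le, simp add: S_def)
  qed (use R1 i1 in auto)
qed

section \<open>Weak subsolutions\<close>

lemma compact_subset_open_neighbourhood:
  fixes K U :: "'a::euclidean_space set"
  assumes "compact K" "open U" "K \<subseteq> U"
  obtains S d where "d > 0" "compact S" "K \<subseteq> S" "S \<subseteq> U" "\<And>x y. x \<in> K \<Longrightarrow> norm (x - y) \<le> d \<Longrightarrow> y \<in> S"
proof -
  obtain e where e: "e > 0" "(\<Union>x\<in>K. ball x e) \<subseteq> U"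
    using compact_subset_open_imp_ball_epsilon_subset[OF assms] .
  let ?S = "{x + y | x y. x \<in> K \<and> y \<in> cball 0 (e / 2)}"
  have 1: "compact ?S" using assms(1) by (intro compact_sums) auto
  have 2: "?S \<subseteq> U"
  proof
    fix z assume "z \<in> ?S"
    then obtain x y where "z = x + y" "x \<in> K" "norm y \<le> e / 2" by auto
    then have "z \<in> ball x e" "x \<in> K" using e(1) by (auto simp: dist_norm)
    then show "z \<in> U" using e(2) by blast
  qed
  have 3: "y \<in> ?S" if "x \<in> K" "norm (x - y) \<le> e / 2" for x y
  proof -
    have "y = x + (y - x)" "y - x \<in> cball 0 (e / 2)" using that by (auto simp: norm_minus_commute)
    then show ?thesis using that(1) by blast
  qed
  have "K \<subseteq> ?S" using 3[of x x for x] e(1) by auto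
  with 1 2 3 e(1) show ?thesis by (intro that[of "e / 2" ?S]) auto
qed

lemma convol_nonzero_imp:
  fixes f :: "'a::euclidean_space \<Rightarrow> real" and g :: "'a \<Rightarrow> 'b::euclidean_space"
  assumes "convol f g x \<noteq> 0"
  obtains y where "f y \<noteq> 0" "g (x - y) \<noteq> 0"
proof (rule ccontr)
  assume "\<not> thesis"
  then have "(\<lambda>y. f y *\<^sub>R g (x - y)) = (\<lambda>y. 0)" using that by fastforce
  then have "convol f g x = 0" unfolding convol_def by simp
  with assms show False by simp
qed

text \<open>Borel versions extended by zero, so that all integrals run over the whole space with
  \<open>lborel\<close> and limits need no restricted measures. \<open>G\<close> stands for a
  version of the weak gradient of \<open>u\<close>.\<close>

locale borel_subsolution =
  fixes \<Omega> :: "(real^'n) set" and p pstar \<mu> :: real and f u :: "real^'n \<Rightarrow> real" and G :: "real^'n \<Rightarrow> real^'n"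
  assumes p: "1 < p" "p < real CARD('n)"
    and pstar_eq: "pstar = real CARD('n) * p / (real CARD('n) - p)"
    and \<Omega>: "open \<Omega>" "bounded \<Omega>"
    and meas[measurable]: "u \<in> borel_measurable borel" "f \<in> borel_measurable borel" "G \<in> borel_measurable borel"
    and zero: "\<And>x. x \<notin> \<Omega> \<Longrightarrow> u x = 0" "\<And>x. x \<notin> \<Omega> \<Longrightarrow> f x = 0" "\<And>x. x \<notin> \<Omega> \<Longrightarrow> G x = 0"
    and int_u: "integrable lborel (\<lambda>x. \<bar>u x\<bar> powr pstar)"
    and int_f: "integrable lborel (\<lambda>x. \<bar>f x\<bar> powr (real CARD('n) / p))"
    and int_G: "integrable lborel (\<lambda>x. norm (G x) powr p)"
    and weak: "\<And>\<phi>. \<phi> \<in> test_functions \<Omega> \<Longrightarrow>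
      (LINT x|lborel. u x *\<^sub>R gradient \<phi> x) = - (LINT x|lborel. \<phi> x *\<^sub>R G x)"
    and sub: "\<And>\<phi>. \<phi> \<in> test_functions \<Omega> \<Longrightarrow> (\<And>x. 0 \<le> \<phi> x) \<Longrightarrow>
      (LINT x|lborel. norm (G x) powr (p - 2) * (G x \<bullet> gradient \<phi> x)
         - \<mu> / norm x powr p * \<bar>u x\<bar> powr (p - 2) * u x * \<phi> x)
      \<le> (LINT x|lborel. f x * \<bar>u x\<bar> powr (p - 2) * u x * \<phi> x)"
begin

lemma pstar: "p < pstar" "1 < pstar"
proof -
  have "p * (real CARD('n) - p) < real CARD('n) * p" using p by (simp add: algebra_simps)
  then show "p < pstar" using p by (simp add: pstar_eq pos_less_divide_eq)
  then show "1 < pstar" using p by simp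
qed

lemma integrable_indicator_domain: "integrable lborel (\<lambda>x. indicator \<Omega> x :: real)"
  using emeasure_bounded_finite[OF \<Omega>(2)] \<Omega>(1) by (simp add: integrable_indicator_iff)

lemma domain_sets[measurable]: "\<Omega> \<in> sets borel" using \<Omega>(1) by simp

text \<open>Apply \<open>powr_mult_le_add\<close> with \<theta> = p/N, for which pstar (1 -
  \<theta>) = p: the pointwise counterpart of pairing L^(N/p) with L^(pstar/p).\<close>

lemma f_mult_powr_le:
  assumes "c \<ge> 0"
  shows "\<bar>f x\<bar> * c powr p \<le> \<bar>f x\<bar> powr (real CARD('n) / p) + c powr pstar"
proof -
  let ?N = "real CARD('n)"
  have "(\<bar>f x\<bar> powr (?N / p)) powr (p / ?N) * (c powr pstar) powr (1 - p / ?N)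
     \<le> \<bar>f x\<bar> powr (?N / p) + c powr pstar"
    using p by (intro powr_mult_le_add) auto
  moreover have "pstar * (1 - p / ?N) = p" using p by (simp add: pstar_eq field_simps)
  ultimately show ?thesis using p by (simp add: powr_powr)
qed

lemma integrable_u_powr:
  assumes "0 < q" "q \<le> pstar"
  shows "integrable lborel (\<lambda>x. \<bar>u x\<bar> powr q)"
proof (rule Bochner_Integration.integrable_bound[OF Bochner_Integration.integrable_add[OF
    integrable_indicator_domain int_u]])
  have "\<bar>u x\<bar> powr q \<le> indicator \<Omega> x + \<bar>u x\<bar> powr pstar" for x
    using powr_le_one_add[of "\<bar>u x\<bar>" q pstar] zero(1)[of x] assms by (cases "x \<in> \<Omega>") auto
  then show "AE x in lborel. norm (\<bar>u x\<bar> powr q) \<le> norm (indicator \<Omega> x + \<bar>u x\<bar> powr pstar)" by simp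
qed simp

lemma integrable_G_powr:
  assumes "0 < q" "q \<le> p"
  shows "integrable lborel (\<lambda>x. norm (G x) powr q)"
proof (rule Bochner_Integration.integrable_bound[OF Bochner_Integration.integrable_add[OF
    integrable_indicator_domain int_G]])
  have "norm (G x) powr q \<le> indicator \<Omega> x + norm (G x) powr p" for x
    using powr_le_one_add[of "norm (G x)" q p] zero(3)[of x] assms by (cases "x \<in> \<Omega>") auto
  then show "AE x in lborel. norm (norm (G x) powr q) \<le> norm (indicator \<Omega> x + norm (G x) powr p)" by simp
qed simp

lemma integrable_u: "integrable lborel u"
  using integrable_u_powr[of 1] pstar by (simp add: integrable_abs_iff)

lemma integrable_G: "integrable lborel G"
  using integrable_G_powr[of 1] p by (simp add: integrable_norm_iff)

abbreviation flux :: "real^'n \<Rightarrow> real^'n" where "flux x \<equiv> norm (G x) powr (p - 2) *\<^sub>R G x"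

lemma integrable_flux: "integrable lborel flux"
proof -
  have "integrable lborel (\<lambda>x. norm (flux x))"
    unfolding norm_powr_scaleR_self using integrable_G_powr[of "p - 1"] p by simp
  then show ?thesis by (subst (asm) integrable_norm_iff) auto
qed

lemma integrable_f_u: "integrable lborel (\<lambda>x. f x * \<bar>u x\<bar> powr (p - 2) * u x)"
proof (rule Bochner_Integration.integrable_bound)
  show "integrable lborel (\<lambda>x. \<bar>f x\<bar> powr (real CARD('n) / p) + (indicator \<Omega> x + \<bar>u x\<bar> powr pstar))"
    using int_f integrable_indicator_domain int_u by auto
  have "norm (f x * \<bar>u x\<bar> powr (p - 2) * u x) \<le> \<bar>f x\<bar> powr (real CARD('n) / p) + (indicator \<Omega> x + \<bar>u x\<bar>
      powr pstar)" for x
  proof (cases "x \<in> \<Omega>")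
    case True
    \<comment> \<open>For a base of at least 1 the exponent p - 1 may be raised to p, for which
      \<open>f_mult_powr_le\<close> is available; the price is the indicator of the bounded
      domain.\<close>
    let ?c = "max 1 \<bar>u x\<bar>"
    have "norm (f x * \<bar>u x\<bar> powr (p - 2) * u x) = \<bar>f x\<bar> * \<bar>u x\<bar> powr (p - 1)"
      using abs_powr_mult_self[of "u x" p] by (simp add: abs_mult)
    also have "\<dots> \<le> \<bar>f x\<bar> * ?c powr p"
    proof (rule mult_left_mono)
      have "\<bar>u x\<bar> powr (p - 1) \<le> ?c powr (p - 1)" using p by (intro powr_mono2) auto
      also have "\<dots> \<le> ?c powr p" by (intro powr_mono) auto
      finally show "\<bar>u x\<bar> powr (p - 1) \<le> ?c powr p" .
    qed simp
    also have "\<dots> \<le> \<bar>f x\<bar> powr (real CARD('n) / p) + ?c powr pstar" by (rule f_mult_powr_le) simp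
    also have "?c powr pstar \<le> 1 + \<bar>u x\<bar> powr pstar" by (simp add: max_def)
    finally show ?thesis using True by simp
  qed (simp add: zero)
  then show "AE x in lborel. norm (f x * \<bar>u x\<bar> powr (p - 2) * u x) \<le>
      norm (\<bar>f x\<bar> powr (real CARD('n) / p) + (indicator \<Omega> x + \<bar>u x\<bar> powr pstar))" by simp
qed simp

text \<open>On a compact set that misses the origin the weight is bounded, which leaves the
  integrability of |u|^(p-1).\<close>

lemma integrable_hardy_term:
  assumes S: "compact S" "0 \<notin> S"
  shows "integrable lborel (\<lambda>x. indicator S x * (\<mu> / norm x powr p * \<bar>u x\<bar> powr (p - 2) * u x))"
proof -
  have [measurable]: "S \<in> sets borel" using S(1) by (simp add: borel_compact)
  obtain d where d: "d > 0" "\<And>x. x \<in> S \<Longrightarrow> d \<le> norm x"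
    using separate_point_closed[of S 0] S compact_imp_closed by auto
  show ?thesis
  proof (rule Bochner_Integration.integrable_bound)
    show "integrable lborel (\<lambda>x. \<bar>\<mu>\<bar> / d powr p * \<bar>u x\<bar> powr (p - 1))"
      using integrable_u_powr[of "p - 1"] p pstar by simp
    have "norm (indicator S x * (\<mu> / norm x powr p * \<bar>u x\<bar> powr (p - 2) * u x)) \<le> \<bar>\<mu>\<bar> / d powr p * \<bar>u x\<bar>
        powr (p - 1)" for x
    proof (cases "x \<in> S")
      case True
      have "norm (indicator S x * (\<mu> / norm x powr p * \<bar>u x\<bar> powr (p - 2) * u x)) = \<bar>\<mu>\<bar> / norm x powr p
          * \<bar>u x\<bar> powr (p - 1)"
        using True abs_powr_mult_self[of "u x" p] by (simp add: abs_mult)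
      also have "\<dots> \<le> \<bar>\<mu>\<bar> / d powr p * \<bar>u x\<bar> powr (p - 1)"
        using d(1) d(2)[OF True] p by (intro mult_right_mono divide_left_mono powr_mono2 mult_pos_pos) auto
      finally show ?thesis .
    qed simp
    then show "AE x in lborel. norm (indicator S x * (\<mu> / norm x powr p * \<bar>u x\<bar> powr (p - 2) * u x))
        \<le> norm (\<bar>\<mu>\<bar> / d powr p * \<bar>u x\<bar> powr (p - 1))" by simp
  qed simp
qed

text \<open>The comparison uses test functions that are only C^1. Mollifying \<phi> makes the
  function and its gradient converge uniformly, with supports in a fixed compact \<open>S\<close>
  inside \<Omega> - {0}, so the error is at most \<open>e\<close> times the L^1 norms of the flux
  and of the lower-order coefficient. Staying away from 0 makes all terms integrable, which permits
  a single integral.\<close>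

lemma subsolution_C1:
  assumes \<phi>: "\<And>x. GDERIV \<phi> x :> D x" "continuous_on UNIV D" "\<And>x. 0 \<le> \<phi> x"
    and K: "compact K" "K \<subseteq> \<Omega> - {0}" "\<And>x. x \<notin> K \<Longrightarrow> \<phi> x = 0"
  shows "integrable lborel (\<lambda>x. flux x \<bullet> D x - (\<mu> / norm x powr p + f x) * \<bar>u x\<bar> powr (p - 2) * u x * \<phi> x)"
    and "(LINT x|lborel. flux x \<bullet> D x - (\<mu> / norm x powr p + f x) * \<bar>u x\<bar> powr (p - 2) * u x * \<phi> x) \<le> 0"
proof -
  have "open (\<Omega> - {0})" using \<Omega>(1) by auto
  then obtain S d where S: "d > 0" "compact S" "K \<subseteq> S" "S \<subseteq> \<Omega> - {0}"
      "\<And>x y. x \<in> K \<Longrightarrow> norm (x - y) \<le> d \<Longrightarrow> y \<in> S"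
    using compact_subset_open_neighbourhood[OF K(1) _ K(2)] by metis
  obtain R where R: "\<And>x. x \<in> K \<Longrightarrow> norm x \<le> R" using compact_imp_bounded[OF K(1)] unfolding bounded_iff by blast
  have \<phi>R: "\<phi> x = 0" if "norm x > R" for x using R[of x] K(3)[of x] that by fastforce
  have DR: "D x = 0" if "norm x > R" for x using gderiv_zero_outside[OF \<phi>(1) \<phi>R that] .
  have c\<phi>: "continuous_on UNIV \<phi>" by (intro continuous_at_imp_continuous_on ballI gderiv_isCont[OF \<phi>(1)])
  have [measurable]: "\<phi> \<in> borel_measurable borel" "D \<in> borel_measurable borel"
    using c\<phi> \<phi>(2) borel_measurable_continuous_onI by auto
  have Sm[measurable]: "S \<in> sets borel" using S(2) by (simp add: borel_compact)
  \<comment> \<open>Restriction to \<open>S\<close> makes the lower-order coefficient integrable;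
    \<phi> and its mollifications vanish outside \<open>S\<close>, so nothing is lost.\<close>
  define W where "W x = indicator S x * (\<mu> / norm x powr p * \<bar>u x\<bar> powr (p - 2) * u x)
      + indicator S x * (f x * \<bar>u x\<bar> powr (p - 2) * u x)" for x
  have iV: "integrable lborel (\<lambda>x. indicator S x * (\<mu> / norm x powr p * \<bar>u x\<bar> powr (p - 2) * u x))"
    using S(2,4) by (intro integrable_hardy_term) auto
  have iF: "integrable lborel (\<lambda>x. indicator S x * (f x * \<bar>u x\<bar> powr (p - 2) * u x))"
    using integrable_mult_indicator[OF _ integrable_f_u, of S] by simp
  have iW: "integrable lborel W" unfolding W_def using iV iF by (rule Bochner_Integration.integrable_add)
  have bnd: "\<exists>B. \<forall>x. norm (g x) \<le> B" if "continuous_on UNIV g" "\<And>x. norm x > R' \<Longrightarrow> g x = 0"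
    for g :: "real^'n \<Rightarrow> 'c::euclidean_space" and R'
    using compact_support_bounded[OF that] by metis
  have ibound: "integrable lborel (\<lambda>x. h x * g x)"
    if h: "integrable lborel h" and g: "continuous_on UNIV g" "\<And>x. norm x > R' \<Longrightarrow> g x = 0" for h g ::
        "real^'n \<Rightarrow> real" and R'
  proof -
    obtain B where "\<And>x. norm (g x) \<le> B" using bnd[OF g] by blast
    then show ?thesis
      using integrable_scaleR_bounded[OF h borel_measurable_continuous_onI[OF g(1)], of B] by simp
  qed
  have iflux: "integrable lborel (\<lambda>x. flux x \<bullet> E x)"
    if E: "continuous_on UNIV E" "\<And>x. norm x > R' \<Longrightarrow> E x = 0" for E :: "real^'n \<Rightarrow> real^'n" and R'
  proof -
    obtain B where B: "\<And>x. norm (E x) \<le> B" using bnd[OF E] by blast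
    have [measurable]: "E \<in> borel_measurable borel" using borel_measurable_continuous_onI[OF E(1)] .
    show ?thesis
    proof (rule Bochner_Integration.integrable_bound[OF integrable_mult_right[OF integrable_norm[OF
        integrable_flux], of B]])
      have "B \<ge> 0" using B[of 0] norm_ge_zero order_trans by blast
      then have "norm (flux x \<bullet> E x) \<le> norm (B * norm (flux x))" for x
        using Cauchy_Schwarz_ineq2[of "flux x" "E x"] mult_left_mono[OF B[of x] norm_ge_zero[of "flux x"]]
        by (simp only: real_norm_def abs_mult abs_norm_cancel abs_of_nonneg mult.commute)
      then show "AE x in lborel. norm (flux x \<bullet> E x) \<le> norm (B * norm (flux x))" by simp
    qed simp
  qed
  have eq: "(\<mu> / norm x powr p + f x) * \<bar>u x\<bar> powr (p - 2) * u x * \<phi> x = W x * \<phi> x" for x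
  proof (cases "x \<in> S")
    case False
    then have "\<phi> x = 0" using S(3) K(3)[of x] by blast
    then show ?thesis by simp
  qed (simp add: W_def algebra_simps)
  have iA: "integrable lborel (\<lambda>x. flux x \<bullet> D x)" by (rule iflux[OF \<phi>(2) DR])
  have iB: "integrable lborel (\<lambda>x. W x * \<phi> x)" by (rule ibound[OF iW c\<phi> \<phi>R])
  show "integrable lborel (\<lambda>x. flux x \<bullet> D x - (\<mu> / norm x powr p + f x) * \<bar>u x\<bar> powr (p - 2) * u x * \<phi> x)"
    unfolding eq using iA iB by simp
  define I where "I = (LINT x|lborel. norm (flux x)) + (LINT x|lborel. \<bar>W x\<bar>)"
  have I0: "I \<ge> 0" unfolding I_def by simp
  have i\<phi>: "integrable lborel \<phi>" "integrable lborel D"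
    by (rule integrable_compact_support[OF c\<phi> \<phi>R] integrable_compact_support[OF \<phi>(2) DR]; assumption)+
  have key: "(LINT x|lborel. flux x \<bullet> D x - W x * \<phi> x) \<le> e * I" if "e > 0" for e
  proof -
    obtain d1 where d1: "d1 > 0" "\<And>r x. 0 < r \<Longrightarrow> r < d1 \<Longrightarrow> norm (convol (mollifier r) \<phi> x - \<phi> x) \<le> e"
      using convol_mollifier_uniform[OF c\<phi> \<phi>R i\<phi>(1) \<open>e > 0\<close>] by metis
    obtain d2 where d2: "d2 > 0" "\<And>r x. 0 < r \<Longrightarrow> r < d2 \<Longrightarrow> norm (convol (mollifier r) D x - D x) \<le> e"
      using convol_mollifier_uniform[OF \<phi>(2) DR i\<phi>(2) \<open>e > 0\<close>] by metis
    define r where "r = min d (min d1 d2) / 2"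
    have r: "0 < r" "r < d" "r < d1" "r < d2" using S(1) d1(1) d2(1) by (auto simp: r_def)
    let ?\<psi> = "convol (mollifier r) \<phi>" and ?E = "convol (mollifier r) D"
    \<comment> \<open>The convolution is differentiated in two ways: here with the derivative on
      \<phi>, to identify the gradient as the mollified \<open>D\<close>, and next with all
      derivatives on the kernel, to get smoothness.\<close>
    have \<psi>D: "GDERIV ?\<psi> x :> ?E x" for x
      by (rule convol_gderiv[OF integrable_mollifier[OF r(1)] \<phi>(1,2) \<phi>R])
    have \<psi>c: "Ck k ?\<psi>" for k
    proof -
      have "?\<psi> = convol \<phi> (mollifier r)" by (rule convol_commute) auto
      moreover have "Ck k (convol \<phi> (mollifier r))"
        using Ck_mollifier[of k r 0] by (intro Ck_convol[OF i\<phi>(1), of _ _ r]) (auto simp: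
            mollifier_eq_0[OF r(1)])
      ultimately show ?thesis by simp
    qed
    have \<psi>S: "?\<psi> x = 0" if "x \<notin> S" for x
    proof (rule ccontr)
      assume "?\<psi> x \<noteq> 0"
      then obtain y where y: "mollifier r y \<noteq> 0" "\<phi> (x - y) \<noteq> 0" by (rule convol_nonzero_imp)
      then have "norm y < r" "x - y \<in> K" using mollifier_eq_0[OF r(1), of y] K(3)[of "x - y"] by force+
      then have "x \<in> S" using S(5)[of "x - y" x] r(2) by simp
      with that show False by simp
    qed
    have ES: "?E x = 0" if "x \<notin> S" for x
    proof (rule ccontr)
      assume "?E x \<noteq> 0"
      then obtain y where y: "mollifier r y \<noteq> 0" "D (x - y) \<noteq> 0" by (rule convol_nonzero_imp)
      have "x - y \<in> K"
      proof (rule ccontr)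
        assume n: "x - y \<notin> K"
        have "open (- K)" using K(1) compact_imp_closed by blast
        then have "D (x - y) = 0" by (rule gderiv_eq_0_on_open[OF \<phi>(1)]) (use n K(3) in auto)
        then show False using y(2) by simp
      qed
      then have "x \<in> S" using S(5)[of "x - y" x] r(2) mollifier_eq_0[OF r(1), of y] y(1) by force
      with that show False by simp
    qed
    have \<psi>0: "?\<psi> x \<ge> 0" for x
      unfolding convol_def by (rule integral_nonneg_AE) (simp add: mollifier_nonneg[OF r(1)] \<phi>(3))
    have "closure {x. ?\<psi> x \<noteq> 0} \<subseteq> S"
      using \<psi>S by (intro closure_minimal compact_imp_closed S(2)) auto
    then have test: "?\<psi> \<in> test_functions \<Omega>"
      unfolding test_functions_def
      using \<psi>c S(4) bounded_subset[OF compact_imp_bounded[OF S(2)] subset_trans[OF closure_subset]]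
      by auto
    obtain RS where RS: "\<And>x. x \<in> S \<Longrightarrow> norm x \<le> RS" using compact_imp_bounded[OF S(2)] unfolding
        bounded_iff by blast
    have \<psi>R: "?\<psi> x = 0" "?E x = 0" if "norm x > RS" for x using RS[of x] \<psi>S[of x] ES[of x] that by fastforce+
    have \<psi>cont: "continuous_on UNIV ?\<psi>" using Ck_imp_continuous[OF \<psi>c[of 0]] .
    have Econt: "continuous_on UNIV ?E"
      by (rule continuous_on_convol[OF integrable_mollifier[OF r(1)] \<phi>(2) DR])
    have iE: "integrable lborel (\<lambda>x. flux x \<bullet> ?E x)" by (rule iflux[OF Econt \<psi>R(2)])
    have iV\<psi>: "integrable lborel (\<lambda>x. indicator S x * (\<mu> / norm x powr p * \<bar>u x\<bar> powr (p - 2) * u x) * ?\<psi> x)"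
      by (rule ibound[OF iV \<psi>cont \<psi>R(1)])
    have iF\<psi>: "integrable lborel (\<lambda>x. indicator S x * (f x * \<bar>u x\<bar> powr (p - 2) * u x) * ?\<psi> x)"
      by (rule ibound[OF iF \<psi>cont \<psi>R(1)])
    have g: "gradient ?\<psi> x = ?E x" for x by (rule gderiv_gradient[OF \<psi>D])
    have "(LINT x|lborel. flux x \<bullet> ?E x - indicator S x * (\<mu> / norm x powr p * \<bar>u x\<bar> powr (p - 2) * u x) * ?\<psi> x)
      = (LINT x|lborel. norm (G x) powr (p - 2) * (G x \<bullet> gradient ?\<psi> x)
         - \<mu> / norm x powr p * \<bar>u x\<bar> powr (p - 2) * u x * ?\<psi> x)"
      by (rule Bochner_Integration.integral_cong[OF refl]) (use \<psi>S in \<open>auto simp: g indicator_def\<close>)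
    also have "\<dots> \<le> (LINT x|lborel. f x * \<bar>u x\<bar> powr (p - 2) * u x * ?\<psi> x)"
      by (rule sub[OF test \<psi>0])
    also have "\<dots> = (LINT x|lborel. indicator S x * (f x * \<bar>u x\<bar> powr (p - 2) * u x) * ?\<psi> x)"
      by (rule Bochner_Integration.integral_cong[OF refl]) (use \<psi>S in \<open>auto simp: indicator_def\<close>)
    finally have le0: "(LINT x|lborel. flux x \<bullet> ?E x) \<le> (LINT x|lborel. W x * ?\<psi> x)"
      using iE iV\<psi> iF\<psi> by (simp add: W_def distrib_right)
    have iW\<psi>: "integrable lborel (\<lambda>x. W x * ?\<psi> x)" by (rule ibound[OF iW \<psi>cont \<psi>R(1)])
    have "(LINT x|lborel. flux x \<bullet> D x - W x * \<phi> x)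
       = (LINT x|lborel. flux x \<bullet> D x - flux x \<bullet> ?E x) + (LINT x|lborel. W x * ?\<psi> x - W x * \<phi> x)
         + ((LINT x|lborel. flux x \<bullet> ?E x) - (LINT x|lborel. W x * ?\<psi> x))"
      using iA iB iE iW\<psi> by (simp del: inner_scaleR_left)
    also have "\<dots> \<le> (LINT x|lborel. e * norm (flux x)) + (LINT x|lborel. e * \<bar>W x\<bar>) + 0"
    proof (intro add_mono integral_mono)
      fix x
      have "flux x \<bullet> D x - flux x \<bullet> ?E x = flux x \<bullet> (D x - ?E x)" by (rule inner_diff_right[symmetric])
      also have "\<dots> \<le> norm (flux x) * norm (D x - ?E x)" by (rule norm_cauchy_schwarz)
      also have "\<dots> \<le> norm (flux x) * e"
        using d2(2)[OF r(1,4), of x] by (intro mult_left_mono) (auto simp: norm_minus_commute)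
      finally show "flux x \<bullet> D x - flux x \<bullet> ?E x \<le> e * norm (flux x)" by (simp only: mult.commute)
      have "W x * ?\<psi> x - W x * \<phi> x \<le> \<bar>W x\<bar> * \<bar>?\<psi> x - \<phi> x\<bar>"
        by (metis abs_ge_self abs_mult right_diff_distrib)
      also have "\<dots> \<le> \<bar>W x\<bar> * e" using d1(2)[OF r(1,3), of x] by (intro mult_left_mono) auto
      finally show "W x * ?\<psi> x - W x * \<phi> x \<le> e * \<bar>W x\<bar>" by (simp only: mult.commute)
    qed (use le0 iA iB iE iW\<psi> iW integrable_flux in \<open>auto simp del: inner_scaleR_left norm_scaleR\<close>)
    also have "\<dots> = e * I" unfolding I_def by (simp add: distrib_left)
    finally show ?thesis .
  qed
  have "(LINT x|lborel. flux x \<bullet> D x - W x * \<phi> x) \<le> 0"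
  proof (rule field_le_epsilon)
    fix e :: real assume "e > 0"
    have "(LINT x|lborel. flux x \<bullet> D x - W x * \<phi> x) \<le> e / (I + 1) * I"
      using \<open>e > 0\<close> I0 by (intro key) simp
    also have "\<dots> \<le> e" using \<open>e > 0\<close> I0 by (simp add: field_simps)
    finally show "(LINT x|lborel. flux x \<bullet> D x - W x * \<phi> x) \<le> 0 + e" by simp
  qed
  then show "(LINT x|lborel. flux x \<bullet> D x - (\<mu> / norm x powr p + f x) * \<bar>u x\<bar> powr (p - 2) * u x * \<phi> x) \<le> 0"
    unfolding eq .
qed

end

section \<open>Mollifying the subsolution\<close>

lemma gderiv_mollifier: "GDERIV (mollifier r :: real^'n \<Rightarrow> real) z :> gradient (mollifier r) z"
  using Ck_SucD(1)[of 0 "mollifier r"] Ck_mollifier[of "Suc 0" r 0] by simp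

lemma continuous_gradient_mollifier: "continuous_on UNIV (gradient (mollifier r :: real^'n \<Rightarrow> real))"
  using Ck_mollifier[of "Suc 0" r 0] by (intro Ck_Suc_gradient_continuous[of 0]) simp

context borel_subsolution
begin

lemma mollified_gderiv:
  assumes "r > 0"
  shows "GDERIV (convol (mollifier r) u) x :> convol u (gradient (mollifier r)) x"
proof -
  have "GDERIV (convol u (mollifier r)) x :> convol u (gradient (mollifier r)) x"
    by (rule convol_gderiv[OF integrable_u gderiv_mollifier continuous_gradient_mollifier, of r])
      (simp add: mollifier_eq_0[OF assms])
  moreover have "convol u (mollifier r) = convol (mollifier r) u" by (rule convol_commute) auto
  ultimately show ?thesis by simp
qed

lemma continuous_mollified_gradient:
  assumes "r > 0"
  shows "continuous_on UNIV (convol u (gradient (mollifier r)))"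
proof (rule continuous_on_convol[OF integrable_u continuous_gradient_mollifier])
  show "gradient (mollifier r) x = 0" if "norm x > r" for x :: "real^'n"
    by (rule gderiv_zero_outside[OF gderiv_mollifier _ that]) (simp add: mollifier_eq_0[OF assms])
qed

text \<open>Translates of the kernel are test functions for the weak gradient as long as the ball
  stays in \<Omega>. The gradient of the even kernel is odd, and this sign cancels the one from
  integration by parts.\<close>

lemma mollified_gradient_eq:
  assumes "r > 0" "cball x r \<subseteq> \<Omega>"
  shows "convol u (gradient (mollifier r)) x = convol (mollifier r) G x"
proof -
  let ?\<psi> = "\<lambda>y. mollifier r (y - x)"
  have "closure {y. ?\<psi> y \<noteq> 0} \<subseteq> cball x r"
  proof (rule closure_minimal)
    show "{y. ?\<psi> y \<noteq> 0} \<subseteq> cball x r"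
      using mollifier_eq_0[OF assms(1)] by (force simp: dist_norm norm_minus_commute)
  qed simp
  then have test: "?\<psi> \<in> test_functions \<Omega>"
    unfolding test_functions_def
    using assms(2) bounded_subset[OF bounded_cball subset_trans[OF closure_subset]]
    by (auto simp: Ck_mollifier)
  have g1: "gradient ?\<psi> y = gradient (mollifier r) (y - x)" for y
  proof (rule gderiv_gradient)
    have "((\<lambda>y. y - x) has_derivative (\<lambda>h. h)) (at y)" by (auto intro!: derivative_eq_intros)
    then show "GDERIV ?\<psi> y :> gradient (mollifier r) (y - x)"
      using has_derivative_compose[of "\<lambda>y. y - x" "\<lambda>h. h" y UNIV "mollifier r"] gderiv_mollifier[of r "y
          - x"] unfolding gderiv_def by simp
  qed
  have g2: "gradient (mollifier r) (x - y) = - gradient (mollifier r) (y - x)" for y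
  proof (rule gderiv_gradient)
    have "((\<lambda>z. - z) has_derivative (\<lambda>h. - h)) (at (x - y))" by (auto intro!: derivative_eq_intros)
    then have "((\<lambda>z. mollifier r (- z)) has_derivative (\<lambda>h. - h \<bullet> gradient (mollifier r) (y - x))) (at (x - y))"
      using has_derivative_compose[of "\<lambda>z. - z" "\<lambda>h. - h" "x - y" UNIV "mollifier r"
          "\<lambda>h. h \<bullet> gradient (mollifier r) (y - x)"] gderiv_mollifier[of r "y - x"] unfolding gderiv_def by simp
    then show "GDERIV (mollifier r) (x - y) :> - gradient (mollifier r) (y - x)"
      unfolding gderiv_def mollifier_minus by simp
  qed
  have "convol u (gradient (mollifier r)) x = - (LINT y|lborel. u y *\<^sub>R gradient ?\<psi> y)"
    unfolding convol_def g1 g2 by simp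
  also have "\<dots> = (LINT y|lborel. ?\<psi> y *\<^sub>R G y)" using weak[OF test] by simp
  also have "\<dots> = (LINT y|lborel. mollifier r (x - y) *\<^sub>R G y)" by (simp add: mollifier_commute[of r x])
  also have "\<dots> = convol (mollifier r) G x" by (rule convol_swap[symmetric]) auto
  finally show ?thesis .
qed

text \<open>Averaging preserves a one-sided bound valid almost everywhere in the ball of averaging;
  this keeps the mollified functions below the barrier near the sphere.\<close>

lemma mollified_le:
  assumes "r > 0" and "AE y in lborel. norm (x - y) < r \<longrightarrow> u y \<le> m"
  shows "convol (mollifier r) u x \<le> m"
proof -
  have m[measurable]: "mollifier r \<in> borel_measurable (borel :: (real^'n) measure)" by simp
  have "convol (mollifier r) u x = (LINT y|lborel. mollifier r (x - y) * u y)"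
    using convol_swap[of "mollifier r" u x] by simp
  also have "\<dots> \<le> (LINT y|lborel. mollifier r (x - y) * m)"
  proof (rule integral_mono_AE)
    show "integrable lborel (\<lambda>y. mollifier r (x - y) * u y)"
      using convol_mollifier_integrand[OF assms(1) integrable_u, of x]
        lborel_integrable_reflect(1)[of "\<lambda>y. mollifier r y * u (x - y)" x] by simp
    show "integrable lborel (\<lambda>y. mollifier r (x - y) * m)"
      using lborel_integrable_reflect(1)[OF m, of x] by (simp add: integrable_mollifier[OF assms(1)])
    show "AE y in lborel. mollifier r (x - y) * u y \<le> mollifier r (x - y) * m"
      using assms(2)
    proof eventually_elim
      case (elim y)
      show ?case
      proof (cases "norm (x - y) < r")
        case True
        then show ?thesis using elim by (intro mult_left_mono mollifier_nonneg[OF assms(1)]) auto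
      qed (simp add: mollifier_eq_0[OF assms(1)])
    qed
  qed
  also have "\<dots> = (LINT y|lborel. mollifier r (x - y)) * m" by simp
  also have "\<dots> = m" by (subst lborel_integrable_reflect(2)[OF m]) (simp add: integral_mollifier[OF assms(1)])
  finally show ?thesis .
qed

end

section \<open>Testing with the barrier\<close>

text \<open>Translation invariance in differentiated form: the convolution with the indicator of a
  large ball is constant near 0, equal to the integral of \<xi>, while its gradient at 0 is the
  integral of \<open>g\<close>.\<close>

lemma integral_gradient_eq_0:
  fixes \<xi> :: "'a::euclidean_space \<Rightarrow> real"
  assumes \<xi>: "\<And>x. GDERIV \<xi> x :> g x" "continuous_on UNIV g" "\<And>x. norm x > R \<Longrightarrow> \<xi> x = 0"
  shows "(LINT x|lborel. g x) = 0"
proof -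
  \<comment> \<open>The margin 1 keeps the support of y \<mapsto> \<xi> (x - y) inside the ball
    whenever |x| < 1.\<close>
  let ?B = "cball (0::'a) (R + 1)"
  have c: "continuous_on UNIV \<xi>" by (intro continuous_at_imp_continuous_on ballI gderiv_isCont[OF \<xi>(1)])
  have [measurable]: "\<xi> \<in> borel_measurable borel" "g \<in> borel_measurable borel"
    using c \<xi>(2) borel_measurable_continuous_onI by auto
  have g0: "g x = 0" if "norm x > R" for x using gderiv_zero_outside[OF \<xi>(1,3) that] .
  have iB: "integrable lborel (\<lambda>y::'a. indicator ?B y :: real)"
    using emeasure_bounded_finite[of ?B] by (simp add: integrable_indicator_iff)
  have n: "norm (x - y) > R" if "norm x < 1" "y \<notin> ?B" for x y :: 'a
    using that norm_triangle_ineq2[of y x] by (simp add: norm_minus_commute)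
  have "GDERIV (convol (indicator ?B) \<xi>) 0 :> convol (indicator ?B) g 0"
    by (rule convol_gderiv[OF iB \<xi>])
  moreover have "GDERIV (convol (indicator ?B) \<xi>) 0 :> 0"
  proof -
    have "convol (indicator ?B) \<xi> x = (LINT y|lborel. \<xi> y)" if "norm x < 1" for x
    proof -
      have "indicator ?B y *\<^sub>R \<xi> (x - y) = \<xi> (x - y)" for y
        using n[OF that, of y] \<xi>(3)[of "x - y"] by (cases "y \<in> ?B") auto
      then have "convol (indicator ?B) \<xi> x = (LINT y|lborel. \<xi> (x - y))" unfolding convol_def by presburger
      then show ?thesis by (simp add: lborel_integrable_reflect(2))
    qed
    then show ?thesis
      unfolding gderiv_def inner_zero_right
      by (intro has_derivative_transform_within_open[OF has_derivative_const, where s = "ball 0 1"]) auto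
  qed
  ultimately have "(\<lambda>h. h \<bullet> convol (indicator ?B) g 0) = (\<lambda>h. h \<bullet> 0)"
    unfolding gderiv_def by (rule has_derivative_unique)
  then have "convol (indicator ?B) g 0 = 0" by (metis inner_eq_zero_iff inner_zero_right)
  moreover have "convol (indicator ?B) g 0 = (LINT y|lborel. g (0 - y))"
  proof -
    have "indicator ?B y *\<^sub>R g (0 - y) = g (0 - y)" for y
      using n[of 0 y] g0[of "0 - y"] by (cases "y \<in> ?B") auto
    then show ?thesis unfolding convol_def by presburger
  qed
  ultimately show ?thesis using lborel_integrable_reflect(2)[of g 0] by simp
qed

text \<open>The integrand is the divergence of the field \<open>x \<mapsto> \<xi> x *\<^sub>R x\<close>.\<close>

lemma integral_radial_divergence_eq_0:
  fixes \<xi> :: "real^'n \<Rightarrow> real"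
  assumes \<xi>: "\<And>x. GDERIV \<xi> x :> g x" "continuous_on UNIV g" "\<And>x. norm x > R \<Longrightarrow> \<xi> x = 0"
  shows "integrable lborel (\<lambda>x. real CARD('n) * \<xi> x + x \<bullet> g x)"
    and "(LINT x|lborel. real CARD('n) * \<xi> x + x \<bullet> g x) = 0"
proof -
  have c: "continuous_on UNIV \<xi>" by (intro continuous_at_imp_continuous_on ballI gderiv_isCont[OF \<xi>(1)])
  have g0: "g x = 0" if "norm x > R" for x using gderiv_zero_outside[OF \<xi>(1,3) that] .
  \<comment> \<open>\<open>gi i\<close> is the gradient of x_i \<xi>; the i-th components add up to
    the divergence.\<close>
  define gi where "gi i x = (x $ i) *\<^sub>R g x + \<xi> x *\<^sub>R axis i 1" for i x
  have gi: "GDERIV (\<lambda>x. x $ i * \<xi> x) x :> gi i x" for i x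
  proof -
    have "GDERIV (\<lambda>x::real^'n. x $ i) x :> axis i 1"
      unfolding gderiv_def inner_axis by (simp add: bounded_linear_imp_has_derivative[OF
          bounded_linear_vec_nth])
    then show ?thesis unfolding gi_def by (rule GDERIV_mult) (rule \<xi>(1))
  qed
  have gic: "continuous_on UNIV (gi i)" for i
    unfolding gi_def using c \<xi>(2) by (intro continuous_intros)
  have gi0: "gi i x = 0" if "norm x > R" for i x using g0[OF that] \<xi>(3)[OF that] by (simp add: gi_def)
  have int: "integrable lborel (gi i)" for i by (rule integrable_compact_support[OF gic gi0])
  then have inti: "integrable lborel (\<lambda>x. gi i x $ i)" for i
    by (rule integrable_bounded_linear[OF bounded_linear_vec_nth])
  have z: "(LINT x|lborel. gi i x $ i) = 0" for i
  proof -
    have "(LINT x|lborel. gi i x) = 0"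
      by (rule integral_gradient_eq_0[OF gi gic, of R]) (simp add: \<xi>(3))
    then show ?thesis using integral_bounded_linear[OF bounded_linear_vec_nth int, of i i] by simp
  qed
  have e: "real CARD('n) * \<xi> x + x \<bullet> g x = (\<Sum>i\<in>UNIV. gi i x $ i)" for x
    by (simp add: gi_def sum.distrib inner_vec_def axis_def)
  show "integrable lborel (\<lambda>x. real CARD('n) * \<xi> x + x \<bullet> g x)"
    unfolding e using inti by simp
  show "(LINT x|lborel. real CARD('n) * \<xi> x + x \<bullet> g x) = 0"
    unfolding e using inti z by simp
qed

text \<open>Two open sets cover the space: \<open>U\<close>, where the formula holds, and the
  complement of \<open>K\<close>, where the function is zero. This turns formulas that break down at
  the origin into global C^1 functions.\<close>

lemma gderiv_extend_by_zero:
  fixes \<phi> :: "'a::euclidean_space \<Rightarrow> real"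
  assumes U: "open U" "closed K" "K \<subseteq> U"
    and \<phi>: "\<And>x. x \<in> U \<Longrightarrow> GDERIV \<phi> x :> D x" "continuous_on U D"
    and zero: "\<And>x. x \<in> U \<Longrightarrow> x \<notin> K \<Longrightarrow> \<phi> x = 0" "\<And>x. x \<in> U \<Longrightarrow> x \<notin> K \<Longrightarrow> D x = 0"
  shows "GDERIV (\<lambda>x. if x \<in> K then \<phi> x else 0) x :> (if x \<in> K then D x else 0)"
    and "continuous_on UNIV (\<lambda>x. if x \<in> K then D x else 0)"
proof -
  show "GDERIV (\<lambda>x. if x \<in> K then \<phi> x else 0) x :> (if x \<in> K then D x else 0)"
  proof (cases "x \<in> U")
    case True
    have "((\<lambda>x. if x \<in> K then \<phi> x else 0) has_derivative (\<lambda>h. h \<bullet> D x)) (at x)"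
      by (rule has_derivative_transform_within_open[OF \<phi>(1)[OF True, unfolded gderiv_def] U(1) True])
        (use zero(1) in auto)
    then show ?thesis using zero(2)[OF True] unfolding gderiv_def by (cases "x \<in> K") auto
  next
    case False
    then have x: "x \<in> - K" using U(3) by auto
    have "((\<lambda>x. if x \<in> K then \<phi> x else 0) has_derivative (\<lambda>h. 0)) (at x)"
      by (rule has_derivative_transform_within_open[OF has_derivative_const _ x]) (use U(2) in auto)
    then show ?thesis using x unfolding gderiv_def by simp
  qed
  have 1: "continuous_on U (\<lambda>x. if x \<in> K then D x else 0)"
    using \<phi>(2) by (rule continuous_on_eq) (use zero(2) in auto)
  have 2: "continuous_on (- K) (\<lambda>x. if x \<in> K then D x else 0)"
    by (rule continuous_on_eq[where f = "\<lambda>_. 0"]) auto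
  have "U \<union> - K = UNIV" using U(3) by auto
  then show "continuous_on UNIV (\<lambda>x. if x \<in> K then D x else 0)"
    using continuous_on_open_Un[OF U(1) open_Compl[OF U(2)] 1 2] by simp
qed

text \<open>The corner of max at s = 1 is harmless since \<open>J'\<close> vanishes there: the
  increment of \<open>J\<close> is o(max 1 s - 1), hence o(s - 1).\<close>

lemma DERIV_max_one:
  fixes J :: "real \<Rightarrow> real"
  assumes J: "\<And>t. t > 0 \<Longrightarrow> (J has_real_derivative J' t) (at t)" and "J' 1 = 0"
  shows "((\<lambda>s. J (max 1 s)) has_real_derivative J' (max 1 s)) (at s)"
proof -
  consider "s > 1" | "s < 1" | "s = 1" by linarith
  then show ?thesis
  proof cases
    case 1
    then have "(J has_real_derivative J' (max 1 s)) (at s)" using J[of s] by simp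
    then show ?thesis
      by (rule has_field_derivative_transform_within_open[where S = "{1<..}"]) (use 1 in auto)
  next
    case 2
    have "((\<lambda>s. J 1) has_real_derivative J' (max 1 s)) (at s)" using 2 \<open>J' 1 = 0\<close> by auto
    then show ?thesis
      by (rule has_field_derivative_transform_within_open[where S = "{..<1}"]) (use 2 in auto)
  next
    case 3
    have d1: "(J has_derivative (\<lambda>h. 0)) (at 1)"
      using J[of 1] \<open>J' 1 = 0\<close> by (simp add: has_field_derivative_def lambda_zero)
    have "((\<lambda>s. J (max 1 s)) has_derivative (\<lambda>h. 0)) (at 1)"
      unfolding has_derivative_at_alt
    proof (intro conjI allI impI)
      fix e :: real assume "e > 0"
      obtain d where d: "d > 0" "\<And>y. norm (y - 1) < d \<Longrightarrow> norm (J y - J 1 - 0) \<le> e * norm (y - 1)"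
        using d1 \<open>e > 0\<close> unfolding has_derivative_at_alt by blast
      have "norm (J (max 1 y) - J (max 1 1) - 0) \<le> e * norm (y - 1)" if "norm (y - 1) < d" for y
      proof -
        have "norm (J (max 1 y) - J 1 - 0) \<le> e * norm (max 1 y - 1)"
          using that by (intro d(2)) (auto simp: max_def)
        also have "\<dots> \<le> e * norm (y - 1)" using \<open>e > 0\<close> by (intro mult_left_mono) (auto simp: max_def)
        finally show ?thesis by simp
      qed
      then show "\<exists>d>0. \<forall>y. norm (y - 1) < d \<longrightarrow> norm (J (max 1 y) - J (max 1 1) - 0) \<le> e * norm (y - 1)"
        using d(1) by blast
    qed simp
    then show ?thesis using 3 \<open>J' 1 = 0\<close> by (simp add: has_field_derivative_def lambda_zero)
  qed
qed

text \<open>The test functions are \<open>w h\<close> for the subsolution and \<open>w\<^sup>p h / v\<^sup>p\<^sup>-\<^sup>1\<close> for the barrier, where \<open>h\<close> is \<open>profile\<close>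
  evaluated at \<open>max 1 (w / v)\<close>; \<open>profile' s\<close> is \<open>s\<close> times the derivative of \<open>profile\<close>.\<close>

definition profile :: "real \<Rightarrow> real" where "profile s = (1 - 1 / s)\<^sup>2"
definition profile' :: "real \<Rightarrow> real" where "profile' s = 2 * (1 - 1 / s) / s"

text \<open>Bounds on h and s h'(s) keep the test functions and their gradients within the growth
  that p-th powers of \<open>w\<close> and its gradient control, even where w/v is large.\<close>

lemma profile_bounds:
  assumes "1 \<le> s"
  shows "0 \<le> profile s" "profile s \<le> 1" "0 \<le> profile' s" "profile' s \<le> 2"
proof -
  have t: "0 \<le> 1 - 1 / s" "1 - 1 / s \<le> 1" "0 \<le> 1 / s" "1 / s \<le> 1" using assms by auto
  show "0 \<le> profile s" "profile s \<le> 1" using t by (auto simp: profile_def abs_square_le_1)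
  have e: "profile' s = 2 * ((1 - 1 / s) * (1 / s))" by (simp add: profile'_def)
  show "0 \<le> profile' s" unfolding e using t by (intro mult_nonneg_nonneg) auto
  have "(1 - 1 / s) * (1 / s) \<le> 1 * 1" using t by (intro mult_mono) auto
  then show "profile' s \<le> 2" unfolding e by linarith
qed

lemma profile_one[simp]: "profile 1 = 0" "profile' 1 = 0" by (simp_all add: profile_def profile'_def)

lemma profile_pos: "1 < s \<Longrightarrow> 0 < profile s" by (simp add: profile_def)

lemma profile_deriv: "s > 0 \<Longrightarrow> (profile has_real_derivative profile' s / s) (at s)"
  unfolding profile_def[abs_def] profile'_def
  by (auto intro!: derivative_eq_intros simp: power2_eq_square)

lemma mult_profile_deriv:
  assumes "s > 0"
  shows "((\<lambda>s. s * profile s) has_real_derivative (profile s + profile' s)) (at s)"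
  using DERIV_mult[OF DERIV_ident profile_deriv[OF assms]] assms by (simp add: add.commute)

lemma powr_profile_deriv:
  assumes "s > 0"
  shows "((\<lambda>s. s powr p * profile s) has_real_derivative s powr (p - 1) * (p * profile s + profile' s)) (at s)"
proof -
  have "((\<lambda>s. s powr p) has_real_derivative p * s powr (p - 1)) (at s)"
    using assms by (rule has_real_derivative_powr)
  from DERIV_mult[OF this profile_deriv[OF assms]] show ?thesis
  proof (rule DERIV_cong)
    have "profile' s / s * s powr p = s powr (p - 1) * profile' s" using assms by (simp add: powr_diff)
    then show "p * s powr (p - 1) * profile s + profile' s / s * s powr p
        = s powr (p - 1) * (p * profile s + profile' s)"
      by (simp only: distrib_left mult_ac)
  qed
qed

lemma continuous_profile: "continuous_on {0<..} profile" "continuous_on {0<..} profile'"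
  unfolding profile_def[abs_def] profile'_def[abs_def] by (auto intro!: continuous_intros)

lemma profile_measurable[measurable]: "profile \<in> borel_measurable borel" "profile' \<in> borel_measurable borel"
  unfolding profile_def[abs_def] profile'_def[abs_def] by measurable

text \<open>Tidies the chain rule for v J(w/v) with J(s) = s h(s), whose derivative is h + s h'.
  \<open>V\<close>, \<open>k\<close>, \<open>B\<close> stand for v, w, b, and \<open>h\<close>,
  \<open>q\<close> for h and s h' at s = w/v.\<close>

lemma test_gradient_algebra:
  fixes Y B :: "'a::real_vector"
  assumes "V \<noteq> 0"
  shows "V *\<^sub>R ((h + q) *\<^sub>R (inverse V *\<^sub>R (Y - k *\<^sub>R B))) + (k / V * h) *\<^sub>R (V *\<^sub>R B)
    = h *\<^sub>R Y + q *\<^sub>R (Y - k *\<^sub>R B)"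
proof -
  have "V *\<^sub>R ((h + q) *\<^sub>R (inverse V *\<^sub>R Z)) = (V * (h + q) * inverse V) *\<^sub>R Z" for Z :: 'a by simp
  also have "V * (h + q) * inverse V = h + q" using assms by simp
  finally have 1: "V *\<^sub>R ((h + q) *\<^sub>R (inverse V *\<^sub>R Z)) = (h + q) *\<^sub>R Z" for Z :: 'a .
  have 2: "(k / V * h) *\<^sub>R (V *\<^sub>R B) = (k * h) *\<^sub>R B" using assms by simp
  show ?thesis unfolding 1 2 by (simp add: algebra_simps)
qed

text \<open>The analogue for v^p J(w/v) with J(s) = s^p h(s): \<open>A\<close> is v^p,
  \<open>V'\<close> is v^(p-1), \<open>k'\<close> is w^(p-1), and \<open>r\<close>, \<open>s\<close>
  are the powers p - 1 and p of w/v.\<close>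

lemma powr_test_gradient_algebra:
  fixes Y B :: "'a::real_vector"
  assumes "A * r * inverse V = k'" and "s * (V' * V) = k' * k"
  shows "A *\<^sub>R ((r * (p * h + q)) *\<^sub>R (inverse V *\<^sub>R (Y - k *\<^sub>R B))) + (s * h) *\<^sub>R ((p * V') *\<^sub>R (V *\<^sub>R B))
    = k' *\<^sub>R ((p * h) *\<^sub>R Y + q *\<^sub>R (Y - k *\<^sub>R B))"
proof -
  have "A *\<^sub>R ((r * (p * h + q)) *\<^sub>R (inverse V *\<^sub>R Z)) = (A * r * inverse V * (p * h + q)) *\<^sub>R Z" for Z :: 'a
    by (simp add: mult_ac)
  then have 1: "A *\<^sub>R ((r * (p * h + q)) *\<^sub>R (inverse V *\<^sub>R Z)) = (k' * (p * h + q)) *\<^sub>R Z" for Z :: 'a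
    unfolding assms(1) .
  have "(s * h) *\<^sub>R ((p * V') *\<^sub>R (V *\<^sub>R B)) = (s * (V' * V) * (p * h)) *\<^sub>R B" by (simp add: mult_ac)
  then have 2: "(s * h) *\<^sub>R ((p * V') *\<^sub>R (V *\<^sub>R B)) = (k' * k * (p * h)) *\<^sub>R B" unfolding assms(2) .
  show ?thesis unfolding 1 2 by (simp add: algebra_simps)
qed

text \<open>Here \<open>b\<close> is the logarithmic gradient of the barrier \<open>v\<close>, whose flux \<open>|b|\<^sup>p\<^sup>-\<^sup>2 b\<close> is the radial field
  \<open>\<zeta> x *\<^sub>R x\<close>. Since \<open>\<Delta>\<^sub>p v / v\<^sup>p\<^sup>-\<^sup>1 = div (|b|\<^sup>p\<^sup>-\<^sup>2 b) + (p - 1) |b|\<^sup>p\<close>, the assumption \<open>super\<close> says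
      that \<open>v\<close> is a
  strict supersolution in the punctured ball.\<close>

locale comparison = borel_subsolution \<Omega> p pstar \<mu> f u G
  for \<Omega> :: "(real^'n) set" and p pstar \<mu> :: real and f u :: "real^'n \<Rightarrow> real" and G :: "real^'n \<Rightarrow> real^'n" +
  fixes R\<^sub>0 \<tau> m \<delta> :: real and v \<zeta> \<eta> :: "real^'n \<Rightarrow> real" and b grad_\<zeta> grad_\<eta> :: "real^'n \<Rightarrow> real^'n"
  assumes \<tau>: "0 < \<tau>" and ball_subset: "cball 0 R\<^sub>0 \<subseteq> \<Omega>" and \<delta>: "0 < \<delta>"
    and v: "\<And>x. x \<noteq> 0 \<Longrightarrow> 0 < v x" "\<And>x. x \<noteq> 0 \<Longrightarrow> GDERIV v x :> v x *\<^sub>R b x" "continuous_on (- {0}) b"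
    and \<zeta>: "\<And>x. x \<noteq> 0 \<Longrightarrow> GDERIV \<zeta> x :> grad_\<zeta> x" "continuous_on (- {0}) grad_\<zeta>"
    and barrier_meas[measurable]: "v \<in> borel_measurable borel" "b \<in> borel_measurable borel"
      "\<zeta> \<in> borel_measurable borel" "grad_\<zeta> \<in> borel_measurable borel"
    and barrier_flux: "\<And>x. x \<noteq> 0 \<Longrightarrow> norm (b x) powr (p - 2) *\<^sub>R b x = \<zeta> x *\<^sub>R x"
    and \<zeta>_nonpos: "\<And>x. x \<noteq> 0 \<Longrightarrow> \<zeta> x \<le> 0"
    and v_ge: "\<And>x. x \<noteq> 0 \<Longrightarrow> norm x < R\<^sub>0 \<Longrightarrow> m \<le> v x"
    and super: "AE x in lborel. 0 < norm x \<and> norm x < R\<^sub>0 \<longrightarrow>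
      real CARD('n) * \<zeta> x + x \<bullet> grad_\<zeta> x + (p - 1) * norm (b x) powr p + \<mu> / norm x powr p + f x < 0"
    and annulus: "AE x in lborel. R\<^sub>0 - \<tau> < norm x \<and> norm x < R\<^sub>0 \<longrightarrow> u x \<le> m"
    and \<eta>: "\<And>x. GDERIV \<eta> x :> grad_\<eta> x" "continuous_on UNIV grad_\<eta>" "\<And>x. 0 \<le> \<eta> x" "\<And>x. \<eta> x \<le> 1"
      "\<And>x. norm x \<le> \<delta> \<Longrightarrow> \<eta> x = 0" "\<And>x. norm x \<le> \<delta> \<Longrightarrow> grad_\<eta> x = 0" "\<And>x. 0 \<le> x \<bullet> grad_\<eta> x"
begin

text \<open>\<open>region\<close> carries the test functions, and \<open>nbhd\<close> is an open
  shell around it in which they are differentiated. Mollification radii stay below \<tau>/4, so that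
  for |x| between R_0 - \<tau>/2 and R_0 - \<tau>/4 an average only sees the annulus on which u
  \<le> m.\<close>

definition region :: "(real^'n) set" where "region = {x. \<delta> \<le> norm x \<and> norm x \<le> R\<^sub>0 - \<tau> / 2}"
definition nbhd :: "(real^'n) set" where "nbhd = {x. \<delta> / 2 < norm x \<and> norm x < R\<^sub>0 - \<tau> / 4}"

lemma open_nbhd: "open nbhd"
  unfolding nbhd_def by (intro open_Collect_conj open_Collect_less continuous_intros)

lemma compact_region: "compact region"
proof -
  have "closed region" unfolding region_def by (intro closed_Collect_conj closed_Collect_le continuous_intros)
  moreover have "bounded region" unfolding region_def by (auto intro!: boundedI)
  ultimately show ?thesis by (simp add: compact_eq_bounded_closed)
qed

lemma region_sets[measurable]: "region \<in> sets borel" using compact_region by (simp add: borel_compact)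

lemma region_subset: "region \<subseteq> nbhd" "region \<subseteq> \<Omega> - {0}"
  using \<tau> \<delta> ball_subset by (auto simp: region_def nbhd_def)

lemma nbhdD: "x \<in> nbhd \<Longrightarrow> x \<noteq> 0 \<and> norm x < R\<^sub>0" using \<delta> \<tau> by (auto simp: nbhd_def)

text \<open>Away from 0, the maximum with v makes the base of all powers positive without changing
  any product that contains \<open>H\<close> or \<open>Q\<close>, since both vanish where w \<le>
  v.\<close>

definition upper :: "real \<Rightarrow> real^'n \<Rightarrow> real" where "upper w x = max (v x) w"
definition H :: "real \<Rightarrow> real^'n \<Rightarrow> real" where "H w x = profile (upper w x / v x)"
definition Q :: "real \<Rightarrow> real^'n \<Rightarrow> real" where "Q w x = profile' (upper w x / v x)"

text \<open>Up to the cutoff these are w h and w^p h; the factor v^(1-p) of the barrier's test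
  function is absorbed into the field \<zeta> x, the flux of the logarithmic gradient. In
  \<open>dtest1\<close> and \<open>dtest2\<close> the gradient is a free argument \<open>W\<close>,
  so that limits can be taken pointwise in (w, W).\<close>

definition test1 :: "real \<Rightarrow> real^'n \<Rightarrow> real" where "test1 w x = \<eta> x * (upper w x * H w x)"
definition dtest1 :: "real \<Rightarrow> real^'n \<Rightarrow> real^'n \<Rightarrow> real^'n" where
  "dtest1 w W x = \<eta> x *\<^sub>R (H w x *\<^sub>R W + Q w x *\<^sub>R (W - upper w x *\<^sub>R b x)) + (upper w x * H w x) *\<^sub>R grad_\<eta> x"
definition test2 :: "real \<Rightarrow> real^'n \<Rightarrow> real" where "test2 w x = \<eta> x * (upper w x powr p * H w x)"
definition dtest2 :: "real \<Rightarrow> real^'n \<Rightarrow> real^'n \<Rightarrow> real^'n" where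
  "dtest2 w W x = (\<eta> x * upper w x powr (p - 1)) *\<^sub>R ((p * H w x) *\<^sub>R W + Q w x *\<^sub>R (W - upper w x *\<^sub>R b x))
     + (upper w x powr p * H w x) *\<^sub>R grad_\<eta> x"

lemma upper_cases:
  assumes "x \<noteq> 0"
  obtains "w \<le> v x" "upper w x = v x" "upper w x / v x = 1" "H w x = 0" "Q w x = 0"
    | "v x < w" "upper w x = w" "upper w x / v x = w / v x" "1 < w / v x" "0 < w"
proof (cases "w \<le> v x")
  case True
  then show ?thesis using v(1)[OF assms] that(1) by (simp add: upper_def H_def Q_def)
next
  case False
  then show ?thesis using v(1)[OF assms] that(2) by (simp add: upper_def)
qed

lemma HQ_bounds:
  assumes "x \<noteq> 0"
  shows "0 \<le> H w x" "H w x \<le> 1" "0 \<le> Q w x" "Q w x \<le> 2"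
proof -
  have "1 \<le> upper w x / v x" using v(1)[OF assms] by (simp add: upper_def)
  then show "0 \<le> H w x" "H w x \<le> 1" "0 \<le> Q w x" "Q w x \<le> 2"
    unfolding H_def Q_def by (rule profile_bounds)+
qed

lemma max_ratio: "x \<noteq> 0 \<Longrightarrow> max 1 (w / v x) = upper w x / v x"
  using v(1)[of x] by (auto simp: upper_def max_def field_simps)

text \<open>The flux, \<open>u\<close> and \<open>f\<close> are those of the subsolution; only (w,
  W) will be mollified. The last two terms are minus the divergence of the field \<zeta>
  \<open>test2\<close> x, so they integrate to zero when \<open>W\<close> is the gradient of
  \<open>w\<close>.\<close>

definition integrand :: "real \<Rightarrow> real^'n \<Rightarrow> real^'n \<Rightarrow> real" where
  "integrand w W x = flux x \<bullet> dtest1 w W x - (\<mu> / norm x powr p + f x) * \<bar>u x\<bar> powr (p - 2) * u x * test1 w x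
     - test2 w x * (real CARD('n) * \<zeta> x + x \<bullet> grad_\<zeta> x) - \<zeta> x * (x \<bullet> dtest2 w W x)"

section \<open>The tested inequality for a differentiable competitor w\<close>

context
  fixes w :: "real^'n \<Rightarrow> real" and W :: "real^'n \<Rightarrow> real^'n"
  assumes w: "\<And>x. x \<in> nbhd \<Longrightarrow> GDERIV w x :> W x" "continuous_on nbhd W"
    and w_le: "\<And>x. x \<in> nbhd \<Longrightarrow> x \<notin> region \<Longrightarrow> \<delta> \<le> norm x \<Longrightarrow> w x \<le> v x"
begin

lemma ratio_gderiv:
  assumes "x \<in> nbhd"
  shows "GDERIV (\<lambda>x. w x / v x) x :> inverse (v x) *\<^sub>R (W x - w x *\<^sub>R b x)"
proof -
  have x: "x \<noteq> 0" "v x > 0" using nbhdD[OF assms] v(1)[of x] by auto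
  have "GDERIV (\<lambda>x. w x * inverse (v x)) x :>
      w x *\<^sub>R (- (inverse (v x))\<^sup>2 *\<^sub>R (v x *\<^sub>R b x)) + inverse (v x) *\<^sub>R W x"
    using x by (intro GDERIV_mult w(1)[OF assms] GDERIV_inverse v(2)) auto
  moreover have "w x *\<^sub>R (- (inverse (v x))\<^sup>2 *\<^sub>R (v x *\<^sub>R b x)) + inverse (v x) *\<^sub>R W x
      = inverse (v x) *\<^sub>R (W x - w x *\<^sub>R b x)"
    using x by (simp add: power2_eq_square scaleR_right_diff_distrib mult.commute)
  ultimately show ?thesis by (simp add: divide_inverse)
qed

lemma test1_gderiv:
  assumes "x \<in> nbhd"
  shows "GDERIV (\<lambda>x. test1 (w x) x) x :> dtest1 (w x) (W x) x"
proof -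
  have x: "x \<noteq> 0" "v x > 0" using nbhdD[OF assms] v(1)[of x] by auto
  \<comment> \<open>Near x the test function is \<eta> v J(w/v) with \<open>J\<close> a function of
    one variable, so the corner at w = v is dealt with by \<open>DERIV_max_one\<close>.\<close>
  let ?J = "\<lambda>s. max 1 s * profile (max 1 s)"
  let ?s = "upper (w x) x / v x"
  have "(?J has_real_derivative (profile (max 1 (w x / v x)) + profile' (max 1 (w x / v x)))) (at (w x / v x))"
    by (rule DERIV_max_one[where J = "\<lambda>s. s * profile s" and J' = "\<lambda>s. profile s + profile' s"])
      (auto intro: mult_profile_deriv)
  then have J: "(?J has_real_derivative (H (w x) x + Q (w x) x)) (at (w x / v x))"
    unfolding max_ratio[OF x(1)] H_def Q_def .
  have "GDERIV (\<lambda>x. \<eta> x * (v x * ?J (w x / v x))) x :>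
     \<eta> x *\<^sub>R (v x *\<^sub>R ((H (w x) x + Q (w x) x) *\<^sub>R (inverse (v x) *\<^sub>R (W x - w x *\<^sub>R b x)))
        + ?J (w x / v x) *\<^sub>R (v x *\<^sub>R b x)) + (v x * ?J (w x / v x)) *\<^sub>R grad_\<eta> x"
    by (intro GDERIV_mult \<eta>(1) v(2) x(1) GDERIV_DERIV_compose[OF ratio_gderiv[OF assms] J])
  moreover have "?J (w x / v x) = ?s * H (w x) x" unfolding max_ratio[OF x(1)] H_def ..
  moreover have "\<eta> x *\<^sub>R (v x *\<^sub>R ((H (w x) x + Q (w x) x) *\<^sub>R (inverse (v x) *\<^sub>R (W x - w x *\<^sub>R b x)))
        + (?s * H (w x) x) *\<^sub>R (v x *\<^sub>R b x)) + (v x * (?s * H (w x) x)) *\<^sub>R grad_\<eta> x = dtest1 (w x) (W x) x"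
  proof (cases rule: upper_cases[OF x(1), of "w x"])
    case 1
    then show ?thesis by (simp add: dtest1_def)
  next
    case 2
    have e: "v x * (w x / v x * H (w x) x) = w x * H (w x) x" using x(2) by simp
    show ?thesis unfolding dtest1_def 2(2) e using x(2) by (subst test_gradient_algebra) auto
  qed
  ultimately have "GDERIV (\<lambda>x. \<eta> x * (v x * ?J (w x / v x))) x :> dtest1 (w x) (W x) x" by simp
  then show ?thesis
    unfolding gderiv_def
  proof (rule has_derivative_transform_within_open[OF _ open_nbhd assms])
    fix y assume "y \<in> nbhd"
    then have y: "y \<noteq> 0" "v y > 0" using nbhdD v(1) by auto
    show "\<eta> y * (v y * ?J (w y / v y)) = test1 (w y) y"
      unfolding max_ratio[OF y(1)] test1_def H_def using y(2) by simp
  qed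
qed

lemma test2_gderiv:
  assumes "x \<in> nbhd"
  shows "GDERIV (\<lambda>x. test2 (w x) x) x :> dtest2 (w x) (W x) x"
proof -
  have x: "x \<noteq> 0" "v x > 0" using nbhdD[OF assms] v(1)[of x] by auto
  let ?J = "\<lambda>s. max 1 s powr p * profile (max 1 s)"
  let ?s = "upper (w x) x / v x"
  have "(?J has_real_derivative (max 1 (w x / v x) powr (p - 1) * (p * profile (max 1 (w x / v x)) +
      profile' (max 1 (w x / v x))))) (at (w x / v x))"
    by (rule DERIV_max_one[where J = "\<lambda>s. s powr p * profile s" and J' = "\<lambda>s. s powr (p - 1) * (p *
        profile s + profile' s)"])
      (auto intro: powr_profile_deriv)
  then have J: "(?J has_real_derivative (?s powr (p - 1) * (p * H (w x) x + Q (w x) x))) (at (w x / v x))"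
    unfolding max_ratio[OF x(1)] H_def Q_def .
  have vp: "GDERIV (\<lambda>x. v x powr p) x :> (p * v x powr (p - 1)) *\<^sub>R (v x *\<^sub>R b x)"
    by (rule GDERIV_DERIV_compose[OF v(2)[OF x(1)]]) (rule has_real_derivative_powr[OF x(2)])
  have "GDERIV (\<lambda>x. \<eta> x * (v x powr p * ?J (w x / v x))) x :>
     \<eta> x *\<^sub>R (v x powr p *\<^sub>R ((?s powr (p - 1) * (p * H (w x) x + Q (w x) x)) *\<^sub>R (inverse (v x) *\<^sub>R (W
         x - w x *\<^sub>R b x)))
        + ?J (w x / v x) *\<^sub>R ((p * v x powr (p - 1)) *\<^sub>R (v x *\<^sub>R b x))) + (v x powr p * ?J (w x / v x))
            *\<^sub>R grad_\<eta> x"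
    by (intro GDERIV_mult \<eta>(1) vp GDERIV_DERIV_compose[OF ratio_gderiv[OF assms] J])
  moreover have "?J (w x / v x) = ?s powr p * H (w x) x" unfolding max_ratio[OF x(1)] H_def ..
  moreover have "\<eta> x *\<^sub>R (v x powr p *\<^sub>R ((?s powr (p - 1) * (p * H (w x) x + Q (w x) x)) *\<^sub>R (inverse
      (v x) *\<^sub>R (W x - w x *\<^sub>R b x)))
        + (?s powr p * H (w x) x) *\<^sub>R ((p * v x powr (p - 1)) *\<^sub>R (v x *\<^sub>R b x))) + (v x powr p * (?s
            powr p * H (w x) x)) *\<^sub>R grad_\<eta> x
      = dtest2 (w x) (W x) x"
  proof (cases rule: upper_cases[OF x(1), of "w x"])
    case 1
    then show ?thesis by (simp add: dtest2_def)
  next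
    case 2
    have p1: "v x powr p * (w x / v x) powr (p - 1) * inverse (v x) = w x powr (p - 1)"
      using 2(5) x(2) by (simp add: powr_divide powr_diff field_simps)
    have p2: "(w x / v x) powr p * (v x powr (p - 1) * v x) = w x powr p"
      using 2(5) x(2) by (simp add: powr_divide powr_diff field_simps)
    have p3: "v x powr p * (w x / v x) powr p = w x powr p"
      using 2(5) x(2) by (simp add: powr_divide)
    have p4: "w x powr p = w x powr (p - 1) * w x" using 2(5) by (simp add: powr_diff)
    have e: "v x powr p * ((w x / v x) powr p * H (w x) x) = w x powr p * H (w x) x"
      using p3 by (simp add: mult.assoc[symmetric])
    show ?thesis
      unfolding dtest2_def 2(2) e powr_test_gradient_algebra[OF p1 p2[unfolded p4]] by simp
  qed
  ultimately have "GDERIV (\<lambda>x. \<eta> x * (v x powr p * ?J (w x / v x))) x :> dtest2 (w x) (W x) x" by simp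
  then show ?thesis
    unfolding gderiv_def
  proof (rule has_derivative_transform_within_open[OF _ open_nbhd assms])
    fix y assume "y \<in> nbhd"
    then have y: "y \<noteq> 0" "v y > 0" using nbhdD v(1) by auto
    have "v y powr p * (upper (w y) y / v y) powr p = upper (w y) y powr p"
      using y by (simp add: powr_divide upper_def max_def)
    then show "\<eta> y * (v y powr p * ?J (w y / v y)) = test2 (w y) y"
      unfolding max_ratio[OF y(1)] test2_def H_def by (simp add: mult.assoc[symmetric])
  qed
qed

lemma continuous_ingredients:
  shows "continuous_on nbhd (\<lambda>x. upper (w x) x)" "continuous_on nbhd (\<lambda>x. H (w x) x)" "continuous_on
      nbhd (\<lambda>x. Q (w x) x)"
    "continuous_on nbhd b" "continuous_on nbhd grad_\<zeta>" "continuous_on nbhd \<zeta>"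
    "continuous_on nbhd \<eta>" "continuous_on nbhd grad_\<eta>"
    "\<And>q. continuous_on nbhd (\<lambda>x. upper (w x) x powr q)"
proof -
  have cw: "continuous_on nbhd w" by (intro continuous_at_imp_continuous_on ballI gderiv_isCont[OF w(1)])
  have cv: "continuous_on nbhd v"
    using nbhdD by (intro continuous_at_imp_continuous_on ballI gderiv_isCont[OF v(2)]) auto
  show "continuous_on nbhd \<eta>" by (intro continuous_at_imp_continuous_on ballI gderiv_isCont[OF \<eta>(1)])
  show "continuous_on nbhd grad_\<eta>" using \<eta>(2) by (rule continuous_on_subset) simp
  show "continuous_on nbhd \<zeta>"
    using nbhdD by (intro continuous_at_imp_continuous_on ballI gderiv_isCont[OF \<zeta>(1)]) auto
  show ct: "continuous_on nbhd (\<lambda>x. upper (w x) x)" unfolding upper_def using cw cv by (intro continuous_intros)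
  have pos: "upper (w x) x > 0" "v x > 0" if "x \<in> nbhd" for x
    using v(1)[of x] nbhdD[OF that] by (auto simp: upper_def less_max_iff_disj)
  have cr: "continuous_on nbhd (\<lambda>x. upper (w x) x / v x)"
    using pos by (intro continuous_intros ct cv) (metis less_irrefl)
  show "continuous_on nbhd (\<lambda>x. H (w x) x)" unfolding H_def
    by (rule continuous_on_compose2[OF continuous_profile(1) cr]) (use pos in auto)
  show "continuous_on nbhd (\<lambda>x. Q (w x) x)" unfolding Q_def
    by (rule continuous_on_compose2[OF continuous_profile(2) cr]) (use pos in auto)
  show "continuous_on nbhd b" "continuous_on nbhd grad_\<zeta>"
    using nbhdD by (auto intro!: continuous_on_subset[OF v(3)] continuous_on_subset[OF \<zeta>(2)])
  show "continuous_on nbhd (\<lambda>x. upper (w x) x powr q)" for q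
    using pos by (intro continuous_intros ct) (metis less_irrefl)
qed

text \<open>Inside radius \<delta> the cutoff and its gradient vanish, beyond the outer radius
  \<open>H\<close> and \<open>Q\<close> do, and each term contains a factor from either
  pair.\<close>

lemma vanish:
  assumes "x \<in> nbhd" "x \<notin> region"
  shows "test1 (w x) x = 0" "dtest1 (w x) Y x = 0" "test2 (w x) x = 0" "dtest2 (w x) Y x = 0"
proof -
  have "\<eta> x = 0 \<and> grad_\<eta> x = 0 \<or> H (w x) x = 0 \<and> Q (w x) x = 0"
  proof (cases "norm x \<le> \<delta>")
    case False
    then have "w x \<le> v x" using w_le assms by simp
    then show ?thesis using upper_cases[of x "w x"] nbhdD[OF assms(1)] by force
  qed (use \<eta>(5,6) in auto)
  then show "test1 (w x) x = 0" "dtest1 (w x) Y x = 0" "test2 (w x) x = 0" "dtest2 (w x) Y x = 0"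
    by (auto simp: test1_def dtest1_def test2_def dtest2_def)
qed

text \<open>The weak inequality tested with \<open>test1\<close>, minus the vanishing integral of
  the divergence of \<zeta> \<open>test2\<close> x.\<close>

lemma integrand_le:
  "(LINT x|lborel. indicator region x * integrand (w x) (W x) x) \<le> 0"
proof -
  have cl: "closed region" using compact_region compact_imp_closed by blast
  obtain R where R: "\<And>x. x \<in> region \<Longrightarrow> norm x \<le> R"
    using compact_imp_bounded[OF compact_region] unfolding bounded_iff by blast
  let ?\<phi> = "\<lambda>x. if x \<in> region then test1 (w x) x else 0"
  let ?D = "\<lambda>x. if x \<in> region then dtest1 (w x) (W x) x else 0"
  have c1: "continuous_on nbhd (\<lambda>x. dtest1 (w x) (W x) x)"
    unfolding dtest1_def
    by (intro continuous_on_add continuous_on_mult continuous_on_scaleR continuous_on_diff continuous_on_const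
        continuous_ingredients w(2))
  have g1: "GDERIV ?\<phi> x :> ?D x" "continuous_on UNIV ?D" for x
    by (rule gderiv_extend_by_zero[OF open_nbhd cl region_subset(1) test1_gderiv c1 vanish(1,2)], assumption+)+
  have \<phi>0: "0 \<le> ?\<phi> x" for x
  proof (cases "x \<in> region")
    case True
    then have "x \<noteq> 0" using region_subset(2) by blast
    then have "0 \<le> test1 (w x) x"
      unfolding test1_def using \<eta>(3) HQ_bounds(1) v(1) by (intro mult_nonneg_nonneg) (auto simp:
          upper_def le_max_iff_disj less_imp_le)
    then show ?thesis by simp
  qed simp
  have \<phi>K: "?\<phi> x = 0" if "x \<notin> region" for x using that by simp
  have i1: "integrable lborel (\<lambda>x. flux x \<bullet> ?D x - (\<mu> / norm x powr p + f x) * \<bar>u x\<bar> powr (p - 2) * u x * ?\<phi> x)"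
      "(LINT x|lborel. flux x \<bullet> ?D x - (\<mu> / norm x powr p + f x) * \<bar>u x\<bar> powr (p - 2) * u x * ?\<phi> x) \<le> 0"
    by (rule subsolution_C1[OF g1 \<phi>0 compact_region region_subset(2) \<phi>K], assumption)+
  let ?\<xi> = "\<lambda>x. \<zeta> x * test2 (w x) x" and ?g = "\<lambda>x. \<zeta> x *\<^sub>R dtest2 (w x) (W x) x + test2 (w x) x *\<^sub>R grad_\<zeta> x"
  have c2: "continuous_on nbhd ?g"
    unfolding dtest2_def test2_def
    by (intro continuous_on_add continuous_on_mult continuous_on_scaleR continuous_on_diff continuous_on_const
        continuous_ingredients w(2))
  have gd: "GDERIV ?\<xi> x :> ?g x" if "x \<in> nbhd" for x
    using nbhdD[OF that] by (intro GDERIV_mult \<zeta>(1) test2_gderiv[OF that]) auto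
  have \<xi>0: "?\<xi> x = 0" "?g x = 0" if "x \<in> nbhd" "x \<notin> region" for x using vanish[OF that] by auto
  have g2: "GDERIV (\<lambda>x. if x \<in> region then ?\<xi> x else 0) x :> (if x \<in> region then ?g x else 0)"
      "continuous_on UNIV (\<lambda>x. if x \<in> region then ?g x else 0)" for x
    by (rule gderiv_extend_by_zero[OF open_nbhd cl region_subset(1) gd c2 \<xi>0], assumption+)+
  have \<xi>R: "(if x \<in> region then ?\<xi> x else 0) = 0" if "norm x > R" for x using R[of x] that by auto
  have i2: "integrable lborel (\<lambda>x. real CARD('n) * (if x \<in> region then ?\<xi> x else 0) + x \<bullet> (if x \<in> region
      then ?g x else 0))"
      "(LINT x|lborel. real CARD('n) * (if x \<in> region then ?\<xi> x else 0) + x \<bullet> (if x \<in> region then ?g x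
          else 0)) = 0"
    by (rule integral_radial_divergence_eq_0[OF g2 \<xi>R], assumption)+
  have "(LINT x|lborel. indicator region x * integrand (w x) (W x) x)
    = (LINT x|lborel. (flux x \<bullet> ?D x - (\<mu> / norm x powr p + f x) * \<bar>u x\<bar> powr (p - 2) * u x * ?\<phi> x)
      - (real CARD('n) * (if x \<in> region then ?\<xi> x else 0) + x \<bullet> (if x \<in> region then ?g x else 0)))"
    by (rule Bochner_Integration.integral_cong[OF refl]) (simp add: integrand_def inner_add_right
        distrib_left mult_ac)
  also have "\<dots> = (LINT x|lborel. flux x \<bullet> ?D x - (\<mu> / norm x powr p + f x) * \<bar>u x\<bar> powr (p - 2) * u x * ?\<phi> x)"
    using Bochner_Integration.integral_diff[OF i1(1) i2(1)] i2(2) by linarith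
  also have "\<dots> \<le> 0" by (rule i1(2))
  finally show ?thesis .
qed

end

end

section \<open>The Picone inequality and the limit of the mollifications\<close>

context comparison
begin

lemma integrand_eq_0:
  assumes "x \<noteq> 0" "w \<le> v x"
  shows "integrand w W x = 0"
proof (cases rule: upper_cases[OF assms(1), of w])
  case 1
  then show ?thesis by (simp add: integrand_def test1_def dtest1_def test2_def dtest2_def)
qed (use assms(2) in simp)

lemma region_bounds:
  obtains C where "C \<ge> 0" "\<And>x. x \<in> region \<Longrightarrow> norm (b x) \<le> C" "\<And>x. x \<in> region \<Longrightarrow> \<bar>\<zeta> x\<bar> * norm x \<le> C"
    "\<And>x. x \<in> region \<Longrightarrow> \<bar>real CARD('n) * \<zeta> x + x \<bullet> grad_\<zeta> x\<bar> \<le> C"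
    "\<And>x. x \<in> region \<Longrightarrow> norm (grad_\<eta> x) \<le> C" "\<And>x. x \<in> region \<Longrightarrow> \<bar>\<mu>\<bar> / norm x powr p \<le> C"
proof -
  have z: "x \<noteq> 0" if "x \<in> region" for x using that region_subset(2) by blast
  have c\<zeta>: "continuous_on region \<zeta>"
    using z by (intro continuous_at_imp_continuous_on ballI gderiv_isCont[OF \<zeta>(1)])
  have cb: "continuous_on region b" and cg: "continuous_on region grad_\<zeta>"
    using z by (auto intro!: continuous_on_subset[OF v(3)] continuous_on_subset[OF \<zeta>(2)])
  have bd: "\<exists>C. \<forall>x\<in>region. norm (g x) \<le> C" if "continuous_on region g" for g :: "real^'n \<Rightarrow> real"
    using compact_imp_bounded[OF compact_continuous_image[OF that compact_region]] unfolding bounded_iff by auto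
  obtain C1 where C1: "\<And>x. x \<in> region \<Longrightarrow> norm (norm (b x)) \<le> C1"
    using bd[of "\<lambda>x. norm (b x)"] cb by (auto intro: continuous_intros)
  obtain C2 where C2: "\<And>x. x \<in> region \<Longrightarrow> norm (\<bar>\<zeta> x\<bar> * norm x) \<le> C2"
    using bd[OF continuous_on_mult[OF continuous_on_rabs[OF c\<zeta>] continuous_on_norm[OF
        continuous_on_id]]] by blast
  obtain C3 where C3: "\<And>x. x \<in> region \<Longrightarrow> norm (real CARD('n) * \<zeta> x + x \<bullet> grad_\<zeta> x) \<le> C3"
    using bd[OF continuous_on_add[OF continuous_on_mult[OF continuous_on_const c\<zeta>]
        continuous_on_inner[OF continuous_on_id cg]]] by blast
  obtain C4 where C4: "\<And>x. x \<in> region \<Longrightarrow> norm (norm (grad_\<eta> x)) \<le> C4"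
    using bd[of "\<lambda>x. norm (grad_\<eta> x)"] continuous_on_subset[OF \<eta>(2), of region] by (auto intro:
        continuous_intros)
  have "continuous_on region (\<lambda>x. \<bar>\<mu>\<bar> / norm x powr p)"
    using z by (intro continuous_intros) auto
  then obtain C5 where C5: "\<And>x. x \<in> region \<Longrightarrow> norm (\<bar>\<mu>\<bar> / norm x powr p) \<le> C5"
    using bd by blast
  show ?thesis
  proof (rule that[of "\<bar>C1\<bar> + \<bar>C2\<bar> + \<bar>C3\<bar> + \<bar>C4\<bar> + \<bar>C5\<bar>"])
    fix x assume x: "x \<in> region"
    show "norm (b x) \<le> \<bar>C1\<bar> + \<bar>C2\<bar> + \<bar>C3\<bar> + \<bar>C4\<bar> + \<bar>C5\<bar>" using C1[OF x] by simp
    show "\<bar>\<zeta> x\<bar> * norm x \<le> \<bar>C1\<bar> + \<bar>C2\<bar> + \<bar>C3\<bar> + \<bar>C4\<bar> + \<bar>C5\<bar>" using C2[OF x] by (simp add: abs_mult)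
    show "\<bar>real CARD('n) * \<zeta> x + x \<bullet> grad_\<zeta> x\<bar> \<le> \<bar>C1\<bar> + \<bar>C2\<bar> + \<bar>C3\<bar> + \<bar>C4\<bar> + \<bar>C5\<bar>" using C3[OF x] by simp
    show "norm (grad_\<eta> x) \<le> \<bar>C1\<bar> + \<bar>C2\<bar> + \<bar>C3\<bar> + \<bar>C4\<bar> + \<bar>C5\<bar>" using C4[OF x] by simp
    show "\<bar>\<mu>\<bar> / norm x powr p \<le> \<bar>C1\<bar> + \<bar>C2\<bar> + \<bar>C3\<bar> + \<bar>C4\<bar> + \<bar>C5\<bar>" using C5[OF x] by (simp add: abs_mult)
  qed simp
qed

definition majorant :: "real \<Rightarrow> real^'n \<Rightarrow> real^'n \<Rightarrow> real" where
  "majorant w W x = norm (G x) powr p + norm W powr p + \<bar>w\<bar> powr p + \<bar>u x\<bar> powr p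
     + \<bar>f x\<bar> powr (real CARD('n) / p) + \<bar>u x\<bar> powr pstar + \<bar>w\<bar> powr pstar"

text \<open>Reduces the dependence on (w, W) to |W|^p + |w|^pstar, the quantity that Jensen's
  inequality controls; |w|^p is absorbed by 1 + |w|^pstar.\<close>

lemma majorant_le:
  "majorant w W x \<le> 2 * (1 + \<bar>f x\<bar> powr (real CARD('n) / p) + (norm (G x) powr p + \<bar>u x\<bar> powr pstar)
     + (norm W powr p + \<bar>w\<bar> powr pstar))"
proof -
  have pw: "\<bar>t\<bar> powr p \<le> 1 + \<bar>t\<bar> powr pstar" for t using pstar p by (intro powr_le_one_add) auto
  have sum_le: "g + W' + w' + u' + f' + u'' + w'' \<le> 2 * (1 + f' + (g + u'') + (W' + w''))"
    if "u' \<le> 1 + u''" "w' \<le> 1 + w''" "0 \<le> g" "0 \<le> W'" "0 \<le> f'" for g W' w' u' f' u'' w'' :: real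
    using that by (simp add: algebra_simps)
  show ?thesis unfolding majorant_def by (rule sum_le) (auto intro: pw)
qed

text \<open>The constant depends on neither \<open>w\<close> nor \<open>W\<close>, so that one
  estimate dominates all mollifications. On the compact \<open>region\<close> every coefficient
  coming from the barrier and the cutoff is bounded.\<close>

lemma integrand_bound:
  obtains C where "C \<ge> 0" "\<And>w W x. x \<in> region \<Longrightarrow> \<bar>integrand w W x\<bar> \<le> C * majorant w W x"
proof -
  obtain C where C: "C \<ge> 0" "\<And>x. x \<in> region \<Longrightarrow> norm (b x) \<le> C" "\<And>x. x \<in> region \<Longrightarrow> \<bar>\<zeta> x\<bar> * norm x \<le> C"
    "\<And>x. x \<in> region \<Longrightarrow> \<bar>real CARD('n) * \<zeta> x + x \<bullet> grad_\<zeta> x\<bar> \<le> C"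
    "\<And>x. x \<in> region \<Longrightarrow> norm (grad_\<eta> x) \<le> C" "\<And>x. x \<in> region \<Longrightarrow> \<bar>\<mu>\<bar> / norm x powr p \<le> C"
    using region_bounds by blast
  \<comment> \<open>The four summands are the constants of the estimates \<open>A1\<close> to
    \<open>A4\<close>, one for each term of \<open>integrand\<close>.\<close>
  define C' where "C' = (6 + 6 * C) + (C + 1) + C + C * (p + 2 + 3 * C)"
  have "\<bar>integrand w W x\<bar> \<le> C' * majorant w W x" if x: "x \<in> region" for w W x
  proof -
    have x0: "x \<noteq> 0" using x region_subset(2) by blast
    define S where "S = majorant w W x"
    have S0: "S \<ge> 0" unfolding S_def majorant_def by simp
    show ?thesis
    proof (cases rule: upper_cases[OF x0, of w])
      case 1
      then show ?thesis using integrand_eq_0[OF x0, of w W] S0 C(1) p by (simp add: S_def[symmetric] C'_def)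
    next
      case 2
      note w0 = \<open>0 < w\<close>
      note HQ = HQ_bounds[OF x0, of w]
      have \<eta>01: "0 \<le> \<eta> x" "\<eta> x \<le> 1" using \<eta>(3,4) by auto
      let ?Y = "W - w *\<^sub>R b x"
      have Y: "norm ?Y \<le> norm W + C * w"
      proof -
        have "norm (w *\<^sub>R b x) \<le> C * w" using C(2)[OF x] w0 by (simp add: mult.commute[of w])
        then show ?thesis using norm_triangle_ineq4[of W "w *\<^sub>R b x"] by linarith
      qed
      have mix: "norm (k *\<^sub>R W + Q w x *\<^sub>R ?Y) \<le> \<bar>k\<bar> * norm W + 2 * (norm W + C * w)" for k
      proof -
        have "norm (Q w x *\<^sub>R ?Y) \<le> 2 * (norm W + C * w)"
          unfolding norm_scaleR by (intro mult_mono) (use HQ Y in auto)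
        then show ?thesis using norm_triangle_ineq[of "k *\<^sub>R W" "Q w x *\<^sub>R ?Y"] by simp
      qed
      have pw: "w powr (p - 1) * w = w powr p" using w0 by (simp add: powr_diff)
      have d1: "norm (dtest1 w W x) \<le> 3 * norm W + 3 * C * w"
      proof -
        have "norm (\<eta> x *\<^sub>R (H w x *\<^sub>R W + Q w x *\<^sub>R ?Y)) \<le> 1 * (1 * norm W + 2 * (norm W + C * w))"
          unfolding norm_scaleR using \<eta>01 HQ(1,2) mix[of "H w x"] mult_right_mono[OF HQ(2), of "norm W"]
          by (intro mult_mono) auto
        moreover have "norm ((w * H w x) *\<^sub>R grad_\<eta> x) \<le> w * 1 * C"
          unfolding norm_scaleR using w0 HQ(1,2) C(1) C(5)[OF x] by (intro mult_mono) (auto simp: abs_mult)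
        ultimately show ?thesis
          using norm_triangle_ineq[of "\<eta> x *\<^sub>R (H w x *\<^sub>R W + Q w x *\<^sub>R ?Y)" "(w * H w x) *\<^sub>R grad_\<eta> x"]
          unfolding dtest1_def 2(2) by (simp add: algebra_simps)
      qed
      have t1: "0 \<le> test1 w x" "test1 w x \<le> w"
      proof -
        show "0 \<le> test1 w x" unfolding test1_def 2(2) using w0 \<eta>01 HQ by simp
        have "\<eta> x * (w * H w x) \<le> 1 * (w * 1)" using w0 \<eta>01 HQ by (intro mult_mono) auto
        then show "test1 w x \<le> w" unfolding test1_def 2(2) by simp
      qed
      have t2: "0 \<le> test2 w x" "test2 w x \<le> w powr p"
      proof -
        show "0 \<le> test2 w x" unfolding test2_def 2(2) using w0 \<eta>01 HQ by simp
        have "\<eta> x * (w powr p * H w x) \<le> 1 * (w powr p * 1)" using w0 \<eta>01 HQ by (intro mult_mono) auto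
        then show "test2 w x \<le> w powr p" unfolding test2_def 2(2) by simp
      qed
      have gW: "norm (G x) powr (p - 1) * norm W \<le> norm (G x) powr p + norm W powr p"
        using p by (intro powr_minus_one_mult_le) auto
      have gw: "norm (G x) powr (p - 1) * w \<le> norm (G x) powr p + w powr p"
        using p w0 by (intro powr_minus_one_mult_le) auto
      have ww: "w powr (p - 1) * norm W \<le> w powr p + norm W powr p"
        using p w0 by (intro powr_minus_one_mult_le) auto
      have uw: "\<bar>u x\<bar> powr (p - 1) * w \<le> \<bar>u x\<bar> powr p + w powr p"
        using p w0 by (intro powr_minus_one_mult_le) auto
      have parts: "norm (G x) powr p + norm W powr p \<le> S" "norm (G x) powr p + w powr p \<le> S" "w powr p +
          norm W powr p \<le> S"
          "\<bar>u x\<bar> powr p + w powr p \<le> S" "w powr p \<le> S"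
          "\<bar>f x\<bar> powr (real CARD('n) / p) + (\<bar>u x\<bar> powr pstar + w powr pstar) \<le> S"
        unfolding S_def majorant_def using w0 by auto
      have A1: "\<bar>flux x \<bullet> dtest1 w W x\<bar> \<le> (6 + 6 * C) * S"
      proof -
        have "\<bar>flux x \<bullet> dtest1 w W x\<bar> \<le> norm (flux x) * norm (dtest1 w W x)" by (rule Cauchy_Schwarz_ineq2)
        also have "\<dots> \<le> norm (G x) powr (p - 1) * (3 * norm W + 3 * C * w)"
          unfolding norm_powr_scaleR_self using d1 by (rule mult_left_mono) simp
        also have "\<dots> = 3 * (norm (G x) powr (p - 1) * norm W) + 3 * C * (norm (G x) powr (p - 1) * w)"
          by (simp add: algebra_simps)
        also have "\<dots> \<le> 3 * S + 3 * C * S"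
          using gW gw parts(1,2) C(1) by (intro add_mono mult_left_mono) auto
        also have "\<dots> \<le> (6 + 6 * C) * S" using S0 C(1) by (simp add: algebra_simps)
        finally show ?thesis .
      qed
      have A2: "\<bar>(\<mu> / norm x powr p + f x) * \<bar>u x\<bar> powr (p - 2) * u x * test1 w x\<bar> \<le> (C + 1) * S"
      proof -
        have "\<bar>(\<mu> / norm x powr p + f x) * \<bar>u x\<bar> powr (p - 2) * u x * test1 w x\<bar>
          = \<bar>\<mu> / norm x powr p + f x\<bar> * (\<bar>u x\<bar> powr (p - 1) * test1 w x)"
          using abs_powr_mult_self[of "u x" p] t1(1) by (simp add: abs_mult)
        also have "\<dots> \<le> (C + \<bar>f x\<bar>) * (\<bar>u x\<bar> powr (p - 1) * w)"
        proof (intro mult_mono)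
          have "\<bar>\<mu> / norm x powr p\<bar> \<le> C" using C(6)[OF x] by simp
          then show "\<bar>\<mu> / norm x powr p + f x\<bar> \<le> C + \<bar>f x\<bar>" by linarith
        qed (use t1 C(1) in auto)
        also have "\<dots> = C * (\<bar>u x\<bar> powr (p - 1) * w) + \<bar>f x\<bar> * (\<bar>u x\<bar> powr (p - 1) * w)"
          by (simp add: distrib_right)
        also have "C * (\<bar>u x\<bar> powr (p - 1) * w) \<le> C * S" using uw parts(4) C(1) by (intro mult_left_mono) auto
        also have "\<bar>f x\<bar> * (\<bar>u x\<bar> powr (p - 1) * w) \<le> S"
        proof -
          \<comment> \<open>Passing to the maximum turns the mixed product into a p-th power, to
            which \<open>f_mult_powr_le\<close> applies.\<close>
          let ?c = "max \<bar>u x\<bar> w"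
          have c0: "?c > 0" using w0 by auto
          have "\<bar>u x\<bar> powr (p - 1) * w \<le> ?c powr (p - 1) * ?c" using p w0 by (intro mult_mono powr_mono2) auto
          also have "\<dots> = ?c powr p" using c0 by (simp add: powr_diff)
          finally have "\<bar>f x\<bar> * (\<bar>u x\<bar> powr (p - 1) * w) \<le> \<bar>f x\<bar> * ?c powr p" by (rule mult_left_mono) simp
          also have "\<dots> \<le> \<bar>f x\<bar> powr (real CARD('n) / p) + ?c powr pstar" using c0 by (intro f_mult_powr_le) simp
          also have "?c powr pstar \<le> \<bar>u x\<bar> powr pstar + w powr pstar" by (simp add: max_def)
          finally show ?thesis using parts(6) by linarith
        qed
        finally show ?thesis by (simp add: distrib_right)
      qed
      have A3: "\<bar>test2 w x * (real CARD('n) * \<zeta> x + x \<bullet> grad_\<zeta> x)\<bar> \<le> C * S"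
      proof -
        have "\<bar>test2 w x * (real CARD('n) * \<zeta> x + x \<bullet> grad_\<zeta> x)\<bar> \<le> S * C"
          unfolding abs_mult using t2 parts(5) C(4)[OF x] S0 by (intro mult_mono) auto
        then show ?thesis by (simp add: mult.commute)
      qed
      have A4: "\<bar>\<zeta> x * (x \<bullet> dtest2 w W x)\<bar> \<le> C * (p + 2 + 3 * C) * S"
      proof -
        have "norm ((\<eta> x * w powr (p - 1)) *\<^sub>R ((p * H w x) *\<^sub>R W + Q w x *\<^sub>R ?Y))
            \<le> (1 * w powr (p - 1)) * (p * norm W + 2 * (norm W + C * w))"
        proof -
          have "\<bar>p * H w x\<bar> * norm W \<le> p * norm W" using p HQ(1,2) by (intro mult_right_mono) (auto
              simp: abs_mult)
          then have "norm ((p * H w x) *\<^sub>R W + Q w x *\<^sub>R ?Y) \<le> p * norm W + 2 * (norm W + C * w)"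
            using mix[of "p * H w x"] by linarith
          moreover have "\<bar>\<eta> x * w powr (p - 1)\<bar> \<le> 1 * w powr (p - 1)"
            unfolding abs_mult by (intro mult_mono) (use \<eta>01 in auto)
          ultimately show ?thesis unfolding norm_scaleR by (intro mult_mono) auto
        qed
        also have "\<dots> = (p + 2) * (w powr (p - 1) * norm W) + 2 * C * (w powr (p - 1) * w)" by (simp add:
            algebra_simps)
        also have "\<dots> \<le> (p + 2) * S + 2 * C * S"
          using ww pw parts(3,5) C(1) p by (intro add_mono mult_left_mono) auto
        finally have B1: "norm ((\<eta> x * w powr (p - 1)) *\<^sub>R ((p * H w x) *\<^sub>R W + Q w x *\<^sub>R ?Y)) \<le> (p + 2)
            * S + 2 * C * S" .
        have B2: "norm ((w powr p * H w x) *\<^sub>R grad_\<eta> x) \<le> (S * 1) * C"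
          unfolding norm_scaleR abs_mult using parts(5) HQ(1,2) C(1) C(5)[OF x] S0 by (intro mult_mono) auto
        have B3: "norm (dtest2 w W x) \<le> (p + 2 + 3 * C) * S"
          using norm_triangle_ineq[of "(\<eta> x * w powr (p - 1)) *\<^sub>R ((p * H w x) *\<^sub>R W + Q w x *\<^sub>R ?Y)"
              "(w powr p * H w x) *\<^sub>R grad_\<eta> x"] B1 B2
          unfolding dtest2_def 2(2) by (simp add: algebra_simps)
        have "\<bar>\<zeta> x * (x \<bullet> dtest2 w W x)\<bar> \<le> \<bar>\<zeta> x\<bar> * (norm x * norm (dtest2 w W x))"
          unfolding abs_mult by (intro mult_left_mono Cauchy_Schwarz_ineq2) simp
        also have "\<dots> = (\<bar>\<zeta> x\<bar> * norm x) * norm (dtest2 w W x)" by simp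
        also have "\<dots> \<le> C * ((p + 2 + 3 * C) * S)" using C(1) C(3)[OF x] B3 by (intro mult_mono) auto
        finally show ?thesis by (simp add: mult.assoc)
      qed
      have "\<bar>integrand w W x\<bar> \<le> (6 + 6 * C) * S + (C + 1) * S + C * S + C * (p + 2 + 3 * C) * S"
        unfolding integrand_def using A1 A2 A3 A4 by linarith
      also have "\<dots> = C' * S" unfolding C'_def by (simp only: distrib_right)
      finally show ?thesis unfolding S_def .
    qed
  qed
  moreover have "C' \<ge> 0" unfolding C'_def using C(1) p by simp
  ultimately show ?thesis using that by blast
qed

text \<open>For fixed x the integrand is continuous in (w, W), because \<open>upper\<close> stays
  positive and the profile is continuous for positive arguments; \<open>f\<close> and the flux enter
  only through their values at x.\<close>

lemma integrand_tendsto: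
  assumes x: "x \<in> region" and "w \<longlonglongrightarrow> u x" "W \<longlonglongrightarrow> G x"
  shows "(\<lambda>n. integrand (w n) (W n) x) \<longlonglongrightarrow> integrand (u x) (G x) x"
proof -
  have x0: "x \<noteq> 0" using x region_subset(2) by blast
  note vx = v(1)[OF x0]
  have t: "(\<lambda>n. upper (w n) x) \<longlonglongrightarrow> upper (u x) x" unfolding upper_def using assms(2) by (intro tendsto_intros)
  have pos: "upper w' x > 0" for w' using vx by (simp add: upper_def less_max_iff_disj)
  have r: "(\<lambda>n. upper (w n) x / v x) \<longlonglongrightarrow> upper (u x) x / v x" using vx by (intro tendsto_intros t) simp
  have r0: "upper (w n) x / v x \<in> {0<..}" "upper (u x) x / v x \<in> {0<..}" for n using vx pos by auto
  have h: "(\<lambda>n. H (w n) x) \<longlonglongrightarrow> H (u x) x" "(\<lambda>n. Q (w n) x) \<longlonglongrightarrow> Q (u x) x"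
    unfolding H_def Q_def
    by (rule continuous_on_tendsto_compose[OF continuous_profile(1) r], use r0 in auto)
      (rule continuous_on_tendsto_compose[OF continuous_profile(2) r], use r0 in auto)
  have pw: "(\<lambda>n. upper (w n) x powr q) \<longlonglongrightarrow> upper (u x) x powr q" for q
    using pos[of "u x"] by (intro tendsto_intros t) simp
  show ?thesis
    unfolding integrand_def test1_def dtest1_def test2_def dtest2_def
    by (intro tendsto_intros t h pw assms(3))
qed

text \<open>The amount by which the supersolution inequality is strict; by \<open>super\<close> it
  is positive almost everywhere in the punctured ball.\<close>

definition gap :: "real^'n \<Rightarrow> real" where
  "gap x = - (real CARD('n) * \<zeta> x + x \<bullet> grad_\<zeta> x + (p - 1) * norm (b x) powr p + \<mu> / norm x powr p + f x)"

text \<open>Where \<open>gap\<close> is positive, this is positive exactly when v < u; showing that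
  its integral vanishes therefore proves the comparison.\<close>

definition excess :: "real^'n \<Rightarrow> real" where
  "excess x = upper (u x) x powr p * H (u x) x * gap x"

text \<open>A Picone-type inequality: the first two brackets of the computation are the convexity defect of
  \<open>|\<cdot>|\<^sup>p\<close> and the monotonicity defect of its gradient at the points \<open>G x\<close> and \<open>u x *\<^sub>R b x\<close>.\<close>

lemma integrand_ge:
  assumes x: "x \<noteq> 0"
  shows "\<eta> x * excess x - \<bar>u x\<bar> * norm (G x) powr (p - 1) * norm (grad_\<eta> x) \<le> integrand (u x) (G x) x"
proof (cases rule: upper_cases[OF x, of "u x"])
  case 1
  then show ?thesis using integrand_eq_0[OF x, of "u x" "G x"] by (simp add: excess_def)
next
  case 2
  define U where "U = u x"
  \<comment> \<open>The gradient that \<open>u\<close> would have if u/v were locally constant; both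
    defects \<open>P1\<close> and \<open>P2\<close> vanish when G x = c.\<close>
  define c where "c = U *\<^sub>R b x"
  define Fc where "Fc = norm c powr (p - 2) *\<^sub>R c"
  define g where "g = norm (G x) powr p"
  define h where "h = H U x"
  define q where "q = Q U x"
  have U0: "U > 0" using 2 by (simp add: U_def)
  note HQ = HQ_bounds[OF x, of U, folded h_def q_def]
  have nc: "norm c = U * norm (b x)" using U0 by (simp add: c_def)
  have ncp: "norm c powr p = U powr p * norm (b x) powr p" unfolding nc using U0 by (simp add: powr_mult)
  \<comment> \<open>The flux is homogeneous of degree p - 1, so at u b it is u^(p-1) times the
    radial field of the barrier.\<close>
  have Fc: "Fc = (U powr (p - 1) * \<zeta> x) *\<^sub>R x"
  proof -
    have "U powr (p - 2) * U = U powr (p - 1)" using U0 by (simp add: powr_diff power2_eq_square)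
    moreover have "Fc = (U powr (p - 2) * U) *\<^sub>R (norm (b x) powr (p - 2) *\<^sub>R b x)"
      unfolding Fc_def nc using U0 by (simp add: c_def powr_mult mult_ac)
    ultimately show ?thesis by (simp add: barrier_flux[OF x])
  qed
  have Fz: "\<zeta> x * (U powr (p - 1) * (x \<bullet> z)) = Fc \<bullet> z" for z unfolding Fc by (simp add: mult_ac)
  have Up: "U powr (p - 2) * U * U = U powr p" using U0 by (simp add: powr_diff power2_eq_square)
  have GG: "flux x \<bullet> G x = g" unfolding g_def using norm_powr_inner_self[of "G x" p] by simp
  have d1: "flux x \<bullet> dtest1 U (G x) x = \<eta> x * (h * g + q * (flux x \<bullet> (G x - c))) + U * h * (flux x \<bullet> grad_\<eta> x)"
    unfolding dtest1_def using 2 GG by (simp add: U_def[symmetric] c_def h_def q_def inner_add_right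
        del: inner_scaleR_left)
  have d2: "\<zeta> x * (x \<bullet> dtest2 U (G x) x) = \<eta> x * (p * h * (Fc \<bullet> G x) + q * (Fc \<bullet> (G x - c))) + U powr p
      * h * (\<zeta> x * (x \<bullet> grad_\<eta> x))"
  proof -
    have "\<zeta> x * (x \<bullet> dtest2 U (G x) x) = \<eta> x * (p * h * (\<zeta> x * (U powr (p - 1) * (x \<bullet> G x))) + q * (\<zeta> x
        * (U powr (p - 1) * (x \<bullet> (G x - c)))))
       + U powr p * h * (\<zeta> x * (x \<bullet> grad_\<eta> x))"
      unfolding dtest2_def using 2 by (simp add: U_def[symmetric] c_def[symmetric] h_def[symmetric]
          q_def[symmetric] inner_add_right)
        (simp add: algebra_simps)
    then show ?thesis unfolding Fz .
  qed
  have t1: "(\<mu> / norm x powr p + f x) * \<bar>u x\<bar> powr (p - 2) * u x * test1 U x = \<eta> x * h * U powr p * (\<mu> /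
      norm x powr p + f x)"
  proof -
    have "(\<mu> / norm x powr p + f x) * \<bar>u x\<bar> powr (p - 2) * u x * test1 U x = \<eta> x * h * (U powr (p - 2) *
        U * U) * (\<mu> / norm x powr p + f x)"
      unfolding test1_def using 2 U0 by (simp add: U_def[symmetric] h_def)
    then show ?thesis unfolding Up .
  qed
  have t2: "test2 U x = \<eta> x * h * U powr p" unfolding test2_def using 2 by (simp add: U_def[symmetric] h_def)
  have P1: "0 \<le> g - p * (Fc \<bullet> G x) + (p - 1) * norm c powr p"
    using powr_tangent_inequality[OF p(1), of c "G x"] unfolding g_def Fc_def by simp
  have P2: "0 \<le> flux x \<bullet> (G x - c) - Fc \<bullet> (G x - c)"
    using powr_flux_monotone[OF p(1), of "G x" c] unfolding Fc_def by (simp only: inner_diff_left)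
  \<comment> \<open>The cutoff increases with |x| and \<zeta> \<le> 0, so the cutoff error of the
    barrier has the favourable sign; only that of \<open>u\<close> survives, in
    \<open>P4\<close>.\<close>
  have P3: "0 \<le> - (U powr p * h * (\<zeta> x * (x \<bullet> grad_\<eta> x)))"
    using U0 HQ(1) \<zeta>_nonpos[OF x] \<eta>(7)[of x] by (simp add: mult_nonneg_nonpos mult_nonpos_nonneg)
  have P4: "- (\<bar>u x\<bar> * norm (G x) powr (p - 1) * norm (grad_\<eta> x)) \<le> U * h * (flux x \<bullet> grad_\<eta> x)"
  proof -
    have "\<bar>U * h * (flux x \<bullet> grad_\<eta> x)\<bar> \<le> (\<bar>U\<bar> * 1) * (norm (flux x) * norm (grad_\<eta> x))"
      unfolding abs_mult using HQ(1,2) by (intro mult_mono Cauchy_Schwarz_ineq2) auto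
    then show ?thesis unfolding norm_powr_scaleR_self by (simp add: U_def mult.assoc abs_le_iff)
  qed
  have e: "\<eta> x * excess x = \<eta> x * h * U powr p * gap x" unfolding excess_def using 2 by (simp add:
      U_def[symmetric] h_def)
  have "integrand U (G x) x = \<eta> x * (h * (g - p * (Fc \<bullet> G x) + (p - 1) * norm c powr p))
     + \<eta> x * (q * (flux x \<bullet> (G x - c) - Fc \<bullet> (G x - c)))
     + \<eta> x * h * U powr p * gap x + U * h * (flux x \<bullet> grad_\<eta> x) + - (U powr p * h * (\<zeta> x * (x \<bullet> grad_\<eta> x)))"
    unfolding integrand_def d1 d2 t1 t2 gap_def ncp by (simp add: algebra_simps)
  moreover have "0 \<le> \<eta> x * (h * (g - p * (Fc \<bullet> G x) + (p - 1) * norm c powr p))"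
    using \<eta>(3) HQ(1) P1 by (intro mult_nonneg_nonneg)
  moreover have "0 \<le> \<eta> x * (q * (flux x \<bullet> (G x - c) - Fc \<bullet> (G x - c)))"
    using \<eta>(3) HQ(3) P2 by (intro mult_nonneg_nonneg)
  ultimately show ?thesis using P3 P4 unfolding e U_def[symmetric] by linarith
qed

lemma cutoff_measurable[measurable]: "\<eta> \<in> borel_measurable borel" "grad_\<eta> \<in> borel_measurable borel"
  using \<eta>(2) gderiv_isCont[OF \<eta>(1)]
  by (auto intro!: borel_measurable_continuous_onI continuous_at_imp_continuous_on)

lemma integrand_measurable:
  assumes [measurable]: "w \<in> borel_measurable borel" "W \<in> borel_measurable borel"
  shows "(\<lambda>x. indicator region x * integrand (w x) (W x) x) \<in> borel_measurable borel"
proof -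
  show ?thesis
    unfolding integrand_def test1_def dtest1_def test2_def dtest2_def H_def Q_def upper_def by measurable
qed

lemma integral_integrand_le:
  shows "integrable lborel (\<lambda>x. indicator region x * integrand (u x) (G x) x)"
    and "(LINT x|lborel. indicator region x * integrand (u x) (G x) x) \<le> 0"
proof -
  obtain C where C: "C \<ge> 0" "\<And>w W x. x \<in> region \<Longrightarrow> \<bar>integrand w W x\<bar> \<le> C * majorant w W x"
    using integrand_bound by blast
  obtain d where d: "d > 0" "(\<Union>x\<in>cball 0 R\<^sub>0. ball x d) \<subseteq> \<Omega>"
    using compact_subset_open_imp_ball_epsilon_subset[OF compact_cball \<Omega>(1) ball_subset] .
  \<comment> \<open>By Jensen's inequality the mollification of this sum bounds |W n|^p + |w
    n|^pstar.\<close>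
  define \<Theta> where "\<Theta> x = norm (G x) powr p + \<bar>u x\<bar> powr pstar" for x
  have i\<Theta>: "integrable lborel \<Theta>" unfolding \<Theta>_def using int_G int_u by simp
  \<comment> \<open>\<open>d\<close> keeps the balls of averaging inside \<Omega>, where the
    mollified gradient is the gradient of the mollification; \<tau>/4 keeps those near the outer
    boundary inside the annulus.\<close>
  have d\<tau>: "min d (\<tau> / 4) > 0" using d(1) \<tau> by simp
  obtain R where R: "\<And>n. 0 < R n" "\<And>n. R n < min d (\<tau> / 4)" "R \<longlonglongrightarrow> (0::real)"
    "AE x in lborel. (\<lambda>n. convol (mollifier (R n)) u x) \<longlonglongrightarrow> u x"
    "AE x in lborel. (\<lambda>n. convol (mollifier (R n)) G x) \<longlonglongrightarrow> G x"
    "AE x in lborel. (\<lambda>n. convol (mollifier (R n)) \<Theta> x) \<longlonglongrightarrow> \<Theta> x"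
    "\<And>n. integrable lborel (convol (mollifier (R n)) \<Theta>)"
    "(\<lambda>n. LINT x|lborel. \<bar>convol (mollifier (R n)) \<Theta> x - \<Theta> x\<bar>) \<longlonglongrightarrow> 0"
    by (rule mollifier_sequence[OF integrable_u i\<Theta> integrable_G d\<tau>]) (rule that; assumption)
  define w where "w n = convol (mollifier (R n)) u" for n
  define W where "W n = convol (mollifier (R n)) G" for n
  have [measurable]: "w n \<in> borel_measurable borel" "W n \<in> borel_measurable borel" for n
    unfolding w_def W_def by (auto intro: borel_measurable_convol_mollifier)
  have sub_\<Omega>: "cball x (R n) \<subseteq> \<Omega>" if "norm x < R\<^sub>0" for x n
  proof -
    have "cball x (R n) \<subseteq> ball x d" using R(2)[of n] by auto
    moreover have "x \<in> cball 0 R\<^sub>0" using that by simp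
    ultimately show ?thesis using d(2) by blast
  qed
  have W_eq: "convol u (gradient (mollifier (R n))) x = W n x" if "norm x < R\<^sub>0" for x n
    unfolding W_def by (rule mollified_gradient_eq[OF R(1) sub_\<Omega>[OF that]])
  have w_gd: "GDERIV (w n) x :> W n x" if "x \<in> nbhd" for n x
    using mollified_gderiv[OF R(1), of n x] W_eq[of x n] nbhdD[OF that] unfolding w_def by simp
  have W_cont: "continuous_on nbhd (W n)" for n
    using continuous_on_subset[OF continuous_mollified_gradient[OF R(1)]]
    by (rule continuous_on_eq) (use W_eq nbhdD in auto)
  have w_le: "w n x \<le> v x" if x: "x \<in> nbhd" "x \<notin> region" "\<delta> \<le> norm x" for n x
  proof -
    have "AE y in lborel. norm (x - y) < R n \<longrightarrow> u y \<le> m"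
      using annulus
    proof eventually_elim
      case (elim y)
      have "R\<^sub>0 - \<tau> < norm y \<and> norm y < R\<^sub>0" if "norm (x - y) < R n"
        using that R(2)[of n] x norm_triangle_ineq2[of x y] norm_triangle_ineq2[of y x] \<tau>
        by (auto simp: nbhd_def region_def norm_minus_commute)
      then show ?case using elim by blast
    qed
    then have "w n x \<le> m" unfolding w_def by (rule mollified_le[OF R(1)])
    also have "\<dots> \<le> v x" using v_ge nbhdD[OF x(1)] by blast
    finally show ?thesis .
  qed
  define k where "k n x = indicator region x * integrand (w n x) (W n x) x" for n x
  have k_le: "(LINT x|lborel. k n x) \<le> 0" for n
    unfolding k_def by (rule integrand_le[OF w_gd W_cont w_le])
  define M where "M T x = 2 * C * (indicator region x + \<bar>f x\<bar> powr (real CARD('n) / p) + \<Theta> x + T x)" for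
      T and x :: "real^'n"
  have ireg: "integrable lborel (\<lambda>x. indicator region x :: real)"
    using emeasure_bounded_finite[OF compact_imp_bounded[OF compact_region]] by (simp add:
        integrable_indicator_iff)
  have iM: "integrable lborel (M T)" if "integrable lborel T" for T
    unfolding M_def using ireg int_f i\<Theta> that by simp
  have bound: "\<bar>k n x\<bar> \<le> M (convol (mollifier (R n)) \<Theta>) x" for n x
  proof -
    have J: "norm (W n x) powr p + \<bar>w n x\<bar> powr pstar \<le> convol (mollifier (R n)) \<Theta> x"
    proof -
      have "norm (W n x) powr p \<le> convol (mollifier (R n)) (\<lambda>x. norm (G x) powr p) x"
        unfolding W_def by (rule jensen_convol_mollifier[OF R(1) p(1) integrable_G int_G])
      moreover have "norm (w n x) powr pstar \<le> convol (mollifier (R n)) (\<lambda>x. norm (u x) powr pstar) x"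
        unfolding w_def by (rule jensen_convol_mollifier[OF R(1) pstar(2) integrable_u]) (use int_u in simp)
      moreover have "convol (mollifier (R n)) (\<lambda>x. norm (G x) powr p) x + convol (mollifier (R n)) (\<lambda>x.
          norm (u x) powr pstar) x
          = convol (mollifier (R n)) \<Theta> x"
        using convol_mollifier_integrand[OF R(1) int_G, of n x] convol_mollifier_integrand[OF R(1)
            int_u, of n x]
        unfolding convol_def \<Theta>_def by (simp add: distrib_left)
      ultimately show ?thesis by simp
    qed
    show ?thesis
    proof (cases "x \<in> region")
      case True
      have "\<bar>k n x\<bar> \<le> C * majorant (w n x) (W n x) x" unfolding k_def using True C(2) by simp
      also have "\<dots> \<le> C * (2 * (1 + \<bar>f x\<bar> powr (real CARD('n) / p) + \<Theta> x + convol (mollifier (R n)) \<Theta> x))"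
        using majorant_le[of "w n x" "W n x" x] J C(1) unfolding \<Theta>_def by (intro mult_left_mono) auto
      finally show ?thesis using True unfolding M_def by (simp add: algebra_simps)
    next
      case False
      have "0 \<le> norm (W n x) powr p + \<bar>w n x\<bar> powr pstar" by simp
      with J have "0 \<le> convol (mollifier (R n)) \<Theta> x" by linarith
      then show ?thesis using False C(1) by (simp add: k_def M_def \<Theta>_def)
    qed
  qed
  have M_diff: "M S x - M T x = 2 * C * (S x - T x)" for S T x unfolding M_def by (simp add: algebra_simps)
  note DCT = integral_dominated_convergence_moving[where k = k and M = lborel
      and l = "\<lambda>x. indicator region x * integrand (u x) (G x) x"
      and m = "\<lambda>n. M (convol (mollifier (R n)) \<Theta>)" and m' = "M \<Theta>"]
  have meas_k: "k n \<in> borel_measurable lborel" for n unfolding k_def using integrand_measurable by simp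
  have meas_l: "(\<lambda>x. indicator region x * integrand (u x) (G x) x) \<in> borel_measurable lborel"
    using integrand_measurable[of u G] by simp
  have lim: "AE x in lborel. (\<lambda>n. k n x) \<longlonglongrightarrow> indicator region x * integrand (u x) (G x) x"
    using R(4,5)
  proof eventually_elim
    case (elim x)
    show ?case
    proof (cases "x \<in> region")
      case True
      then show ?thesis unfolding k_def using integrand_tendsto[OF True, of "\<lambda>n. w n x" "\<lambda>n. W n x"] elim
        by (simp add: w_def W_def)
    qed (simp add: k_def)
  qed
  have mlim: "AE x in lborel. (\<lambda>n. M (convol (mollifier (R n)) \<Theta>) x) \<longlonglongrightarrow> M \<Theta> x"
    using R(6) by eventually_elim (unfold M_def, intro tendsto_intros)
  have mL1: "(\<lambda>n. LINT x|lborel. \<bar>M (convol (mollifier (R n)) \<Theta>) x - M \<Theta> x\<bar>) \<longlonglongrightarrow> 0"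
  proof -
    have "(\<lambda>n. 2 * C * (LINT x|lborel. \<bar>convol (mollifier (R n)) \<Theta> x - \<Theta> x\<bar>)) \<longlonglongrightarrow> 2 * C * 0"
      by (intro tendsto_mult_left R(8))
    then show ?thesis unfolding M_diff abs_mult using C(1) by simp
  qed
  have AEb: "AE x in lborel. \<bar>k n x\<bar> \<le> M (convol (mollifier (R n)) \<Theta>) x" for n using bound by simp
  note D = DCT[OF meas_k meas_l iM[OF R(7)] iM[OF i\<Theta>] lim AEb mlim mL1]
  show "integrable lborel (\<lambda>x. indicator region x * integrand (u x) (G x) x)" by (rule D(1))
  show "(LINT x|lborel. indicator region x * integrand (u x) (G x) x) \<le> 0"
    by (rule LIMSEQ_le_const2[OF D(3)]) (use k_le in auto)
qed

text \<open>Integrates the pointwise Picone estimate. Integrability of the excess comes out of that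
  estimate: up to the cutoff it is nonnegative almost everywhere and bounded by a sum of two
  integrable functions.\<close>

lemma cutoff_inequality:
  shows "integrable lborel (\<lambda>x. indicator region x * (\<eta> x * excess x))"
    and "integrable lborel (\<lambda>x. indicator region x * (\<bar>u x\<bar> * norm (G x) powr (p - 1) * norm (grad_\<eta> x)))"
    and "(LINT x|lborel. indicator region x * (\<eta> x * excess x))
      \<le> (LINT x|lborel. indicator region x * (\<bar>u x\<bar> * norm (G x) powr (p - 1) * norm (grad_\<eta> x)))"
proof -
  let ?a = "\<lambda>x. indicator region x * (\<eta> x * excess x)"
  let ?e = "\<lambda>x. indicator region x * (\<bar>u x\<bar> * norm (G x) powr (p - 1) * norm (grad_\<eta> x))"
  let ?k = "\<lambda>x. indicator region x * integrand (u x) (G x) x"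
  have ma: "?a \<in> borel_measurable borel"
    unfolding excess_def gap_def H_def upper_def by measurable
  obtain C where C: "C \<ge> 0" "\<And>x. x \<in> region \<Longrightarrow> norm (grad_\<eta> x) \<le> C" using region_bounds by metis
  show ie: "integrable lborel ?e"
  proof (rule Bochner_Integration.integrable_bound)
    show "integrable lborel (\<lambda>x. C * (norm (G x) powr p + \<bar>u x\<bar> powr p))"
      using int_G integrable_u_powr[of p] pstar p by simp
    have "norm (?e x) \<le> norm (C * (norm (G x) powr p + \<bar>u x\<bar> powr p))" for x
    proof (cases "x \<in> region")
      case True
      have "norm (G x) powr (p - 1) * \<bar>u x\<bar> * norm (grad_\<eta> x) \<le> (norm (G x) powr p + \<bar>u x\<bar> powr p) * C"
        using p C(2)[OF True] by (intro mult_mono powr_minus_one_mult_le) auto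
      then show ?thesis using True C(1) by (simp add: abs_mult mult_ac)
    qed simp
    then show "AE x in lborel. norm (?e x) \<le> norm (C * (norm (G x) powr p + \<bar>u x\<bar> powr p))" by simp
  qed simp
  have ge: "?a x \<le> ?k x + ?e x" for x
  proof (cases "x \<in> region")
    case True
    then have "x \<noteq> 0" using region_subset(2) by blast
    then show ?thesis using integrand_ge[of x] True by simp
  qed simp
  have pos: "AE x in lborel. 0 \<le> ?a x"
    using super
  proof eventually_elim
    case (elim x)
    show ?case
    proof (cases "x \<in> region")
      case True
      then have x: "x \<noteq> 0" "norm x < R\<^sub>0" using region_subset \<tau> by (auto simp: region_def)
      then have "0 < gap x" using elim unfolding gap_def by auto
      then have "0 \<le> excess x" unfolding excess_def using HQ_bounds(1)[OF x(1)] by simp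
      then show ?thesis using \<eta>(3) by simp
    qed simp
  qed
  note ik = integral_integrand_le
  show ia: "integrable lborel ?a"
  proof (rule Bochner_Integration.integrable_bound[OF Bochner_Integration.integrable_add[OF ik(1) ie]])
    show "?a \<in> borel_measurable lborel" using ma by simp
    show "AE x in lborel. norm (?a x) \<le> norm (?k x + ?e x)"
      using pos
    proof eventually_elim
      case (elim x)
      show ?case unfolding real_norm_def abs_of_nonneg[OF elim] using ge[of x] abs_ge_self order_trans by blast
    qed
  qed
  have "(LINT x|lborel. ?a x) \<le> (LINT x|lborel. ?k x + ?e x)"
    by (rule integral_mono[OF ia Bochner_Integration.integrable_add[OF ik(1) ie] ge])
  also have "\<dots> = (LINT x|lborel. ?k x) + (LINT x|lborel. ?e x)" using ik(1) ie by simp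
  finally show "(LINT x|lborel. ?a x) \<le> (LINT x|lborel. ?e x)" using ik(2) by linarith
qed

end

section \<open>Removing the origin\<close>

text \<open>With s = |x|^2/d^2 - 1, squares of positive parts make this C^1, equal to 0 for s \<le>
  0 and to 1 for s \<ge> 1; the transition thus takes place between |x| = d and |x| = 2 d.\<close>

definition cutoff :: "real \<Rightarrow> 'a::real_inner \<Rightarrow> real" where
  "cutoff d x = 1 - (max 0 (1 - (max 0 (x \<bullet> x / d\<^sup>2 - 1))\<^sup>2))\<^sup>2"

definition grad_cutoff :: "real \<Rightarrow> 'a::real_inner \<Rightarrow> 'a" where
  "grad_cutoff d x = (8 / d\<^sup>2 * (max 0 (1 - (max 0 (x \<bullet> x / d\<^sup>2 - 1))\<^sup>2) * max 0 (x \<bullet> x / d\<^sup>2 - 1))) *\<^sub>R x"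

lemma DERIV_max_0_square: "((\<lambda>t::real. (max 0 t)\<^sup>2) has_real_derivative 2 * max 0 t) (at t)"
proof -
  have "((\<lambda>s. (max 1 s - 1)\<^sup>2) has_real_derivative 2 * (max 1 (t + 1) - 1)) (at (t + 1))"
    by (rule DERIV_max_one[where J = "\<lambda>s. (s - 1)\<^sup>2" and J' = "\<lambda>s. 2 * (s - 1)"])
      (auto intro!: derivative_eq_intros)
  then have "((\<lambda>t. (max 1 (t + 1) - 1)\<^sup>2) has_real_derivative 2 * (max 1 (t + 1) - 1)) (at t)"
    by (simp add: DERIV_shift)
  moreover have "max 1 (s + 1) - 1 = max 0 s" for s :: real by simp
  ultimately show ?thesis by simp
qed

lemma cutoff_gderiv: "GDERIV (cutoff d) x :> grad_cutoff d x"
proof -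
  have 1: "GDERIV (\<lambda>x. x \<bullet> x / d\<^sup>2 - 1) x :> (2 / d\<^sup>2) *\<^sub>R x"
    unfolding gderiv_def divide_inverse by (auto intro!: derivative_eq_intros simp: inner_commute algebra_simps)
  have 2: "GDERIV (\<lambda>x. (max 0 (x \<bullet> x / d\<^sup>2 - 1))\<^sup>2) x :> (2 * max 0 (x \<bullet> x / d\<^sup>2 - 1)) *\<^sub>R (2 / d\<^sup>2) *\<^sub>R x"
    by (rule GDERIV_DERIV_compose[OF 1 DERIV_max_0_square])
  have 3: "GDERIV (\<lambda>x. (max 0 (1 - (max 0 (x \<bullet> x / d\<^sup>2 - 1))\<^sup>2))\<^sup>2) x :>
      (2 * max 0 (1 - (max 0 (x \<bullet> x / d\<^sup>2 - 1))\<^sup>2)) *\<^sub>R (0 - (2 * max 0 (x \<bullet> x / d\<^sup>2 - 1)) *\<^sub>R (2 / d\<^sup>2) *\<^sub>R x)"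
    by (rule GDERIV_DERIV_compose[OF GDERIV_diff[OF GDERIV_const 2] DERIV_max_0_square])
  have "GDERIV (cutoff d) x :> 0 - (2 * max 0 (1 - (max 0 (x \<bullet> x / d\<^sup>2 - 1))\<^sup>2)) *\<^sub>R (0 - (2 * max 0 (x
      \<bullet> x / d\<^sup>2 - 1)) *\<^sub>R (2 / d\<^sup>2) *\<^sub>R x)"
    unfolding cutoff_def[abs_def] by (rule GDERIV_diff[OF GDERIV_const 3])
  then show ?thesis unfolding grad_cutoff_def by (simp add: mult_ac)
qed

lemma continuous_grad_cutoff: "continuous_on UNIV (grad_cutoff d)"
  unfolding grad_cutoff_def[abs_def] divide_inverse
  by (intro continuous_on_scaleR continuous_on_mult continuous_on_max continuous_on_diff continuous_on_power
      continuous_on_inner continuous_on_const continuous_on_id)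

lemma cutoff_bounds: "0 \<le> cutoff d x" "cutoff d x \<le> 1"
proof -
  have "0 \<le> max 0 (1 - (max 0 (x \<bullet> x / d\<^sup>2 - 1))\<^sup>2)" "max 0 (1 - (max 0 (x \<bullet> x / d\<^sup>2 - 1))\<^sup>2) \<le> 1" by auto
  then have "(max 0 (1 - (max 0 (x \<bullet> x / d\<^sup>2 - 1))\<^sup>2))\<^sup>2 \<le> 1" by (rule power_le_one)
  then show "0 \<le> cutoff d x" unfolding cutoff_def by simp
  show "cutoff d x \<le> 1" unfolding cutoff_def by simp
qed

lemma norm_ratio: "d > 0 \<Longrightarrow> x \<bullet> x / d\<^sup>2 = (norm x / d)\<^sup>2"
  by (simp add: dot_square_norm power_divide)

lemma cutoff_small:
  assumes "d > 0" "norm x \<le> d"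
  shows "cutoff d x = 0" "grad_cutoff d x = 0"
proof -
  have "norm x / d \<le> 1" using assms by simp
  then have "(norm x / d)\<^sup>2 \<le> 1" using assms by (intro power_le_one) auto
  then have "max 0 (x \<bullet> x / d\<^sup>2 - 1) = 0" unfolding norm_ratio[OF assms(1)] by simp
  then show "cutoff d x = 0" "grad_cutoff d x = 0" by (simp_all add: cutoff_def grad_cutoff_def)
qed

lemma cutoff_large:
  assumes "d > 0" "2 * d \<le> norm x"
  shows "cutoff d x = 1" "grad_cutoff d x = 0"
proof -
  have "2 \<le> norm x / d" using assms by (simp add: pos_le_divide_eq)
  then have "2\<^sup>2 \<le> (norm x / d)\<^sup>2" by (intro power_mono) auto
  then have 1: "1 \<le> max 0 (x \<bullet> x / d\<^sup>2 - 1)" unfolding norm_ratio[OF assms(1)] by simp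
  then have "1 \<le> (max 0 (x \<bullet> x / d\<^sup>2 - 1))\<^sup>2" by (rule one_le_power)
  then have "max 0 (1 - (max 0 (x \<bullet> x / d\<^sup>2 - 1))\<^sup>2) = 0" by simp
  then show "cutoff d x = 1" "grad_cutoff d x = 0" by (simp_all add: cutoff_def grad_cutoff_def)
qed

lemma inner_grad_cutoff: "0 \<le> x \<bullet> grad_cutoff d x"
  unfolding grad_cutoff_def by (simp add: dot_square_norm)

text \<open>A gradient of size 1/d on an annulus of width d is the scale-invariant rate on which
  \<open>cutoff_error_small\<close> relies.\<close>

lemma norm_grad_cutoff_le:
  assumes "d > 0"
  shows "norm (grad_cutoff d x) \<le> indicator {x. d \<le> norm x \<and> norm x \<le> 2 * d} x * (16 / d)"
proof (cases "d \<le> norm x \<and> norm x \<le> 2 * d")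
  case False
  then show ?thesis using cutoff_small(2)[OF assms, of x] cutoff_large(2)[OF assms, of x] by (auto simp:
      indicator_def)
next
  case True
  let ?q = "max 0 (x \<bullet> x / d\<^sup>2 - 1)"
  have q: "0 \<le> ?q" by simp
  have "max 0 (1 - ?q\<^sup>2) * ?q \<le> 1"
  proof (cases "?q \<le> 1")
    case True
    have "max 0 (1 - ?q\<^sup>2) \<le> 1" using zero_le_power2[of ?q] by (intro max.boundedI) linarith+
    then have "max 0 (1 - ?q\<^sup>2) * ?q \<le> 1 * 1" using True q by (intro mult_mono) auto
    then show ?thesis by simp
  next
    case False
    then have "1 \<le> ?q\<^sup>2" by (intro one_le_power) simp
    then have "max 0 (1 - ?q\<^sup>2) = 0" by simp
    then show ?thesis by simp
  qed
  moreover have "0 \<le> max 0 (1 - ?q\<^sup>2) * ?q" by simp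
  ultimately have "\<bar>8 / d\<^sup>2 * (max 0 (1 - ?q\<^sup>2) * ?q)\<bar> \<le> 8 / d\<^sup>2 * 1"
    unfolding abs_mult by (intro mult_mono) auto
  then have "norm (grad_cutoff d x) \<le> (8 / d\<^sup>2 * 1) * (2 * d)"
    unfolding grad_cutoff_def norm_scaleR using True by (intro mult_mono) auto
  also have "\<dots> = 16 / d" using assms by (simp add: power2_eq_square)
  finally show ?thesis using True by simp
qed

text \<open>Scale \<open>a\<close> by l and \<open>c\<close> by l^(-(p-1)), which amounts to no
  change of the product, and choose l so that the p-th power of the second factor is
  \<kappa>.\<close>

lemma weighted_young:
  fixes p \<kappa> :: real
  assumes "1 < p" "0 < \<kappa>"
  obtains L where "L \<ge> 0" "\<And>a c. 0 \<le> a \<Longrightarrow> 0 \<le> c \<Longrightarrow> a powr (p - 1) * c \<le> L * a powr p + \<kappa> * c powr p"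
proof -
  define l where "l = \<kappa> powr (- 1 / (p * (p - 1)))"
  have l: "l > 0" using assms by (simp add: l_def)
  have e: "(l powr (- (p - 1))) powr p = \<kappa>"
  proof -
    have "(- 1 / (p * (p - 1))) * (- (p - 1)) * p = 1" using assms by (simp add: field_simps)
    then show ?thesis unfolding l_def powr_powr using assms by simp
  qed
  have "a powr (p - 1) * c \<le> l powr p * a powr p + \<kappa> * c powr p" if "0 \<le> a" "0 \<le> c" for a c
  proof -
    have "l powr (p - 1) * l powr (- (p - 1)) = 1" using l by (simp add: powr_add[symmetric])
    then have "a powr (p - 1) * c = (l powr (p - 1) * l powr (- (p - 1))) * (a powr (p - 1) * c)" by simp
    also have "\<dots> = (l * a) powr (p - 1) * (l powr (- (p - 1)) * c)"
      using l that by (simp only: powr_mult less_imp_le mult_ac)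
    also have "\<dots> \<le> (l * a) powr p + (l powr (- (p - 1)) * c) powr p"
      using l that assms by (intro powr_minus_one_mult_le) auto
    also have "\<dots> = l powr p * a powr p + \<kappa> * c powr p" using l that e by (simp add: powr_mult)
    finally show ?thesis .
  qed
  then show ?thesis using that[of "l powr p"] by simp
qed

context borel_subsolution
begin

lemma annulus_integral_tendsto:
  fixes g :: "real^'n \<Rightarrow> real"
  assumes "integrable lborel g"
  shows "(\<lambda>n. LINT x|lborel. indicator {x. 1 / Suc n \<le> norm x \<and> norm x \<le> 2 * (1 / Suc n)} x * g x) \<longlonglongrightarrow> 0"
proof -
  have [measurable]: "g \<in> borel_measurable borel" using assms borel_measurable_integrable by auto
  let ?s = "\<lambda>n x. indicator {x. 1 / Suc n \<le> norm x \<and> norm x \<le> 2 * (1 / Suc n)} x * g x"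
  have "(\<lambda>n. LINT x|lborel. ?s n x) \<longlonglongrightarrow> (LINT x|(lborel :: (real^'n) measure). 0)"
  proof (rule integral_dominated_convergence[where w = "\<lambda>x. norm (g x)"])
    have "(\<lambda>n. ?s n x) \<longlonglongrightarrow> 0" for x
    proof (rule tendsto_eventually)
      show "\<forall>\<^sub>F n in sequentially. ?s n x = 0"
      proof (cases "x = 0")
        case False
        have "(\<lambda>n. 2 * (1 / real (Suc n))) \<longlonglongrightarrow> 2 * 0"
          using LIMSEQ_inverse_real_of_nat by (intro tendsto_mult_left) (simp add: inverse_eq_divide)
        then have "\<forall>\<^sub>F n in sequentially. 2 * (1 / real (Suc n)) < norm x"
          using False by (intro order_tendstoD) auto
        then show ?thesis by eventually_elim (auto simp: indicator_def)
      qed (auto simp: indicator_def)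
    qed
    then show "AE x in lborel. (\<lambda>n. ?s n x) \<longlonglongrightarrow> 0" by simp
    show "AE x in lborel. norm (?s n x) \<le> norm (g x)" for n by (auto simp: indicator_def)
  qed (use assms in auto)
  then show ?thesis by simp
qed

text \<open>By Young's inequality the error is bounded by energies over the annulus, which vanish in the limit,
  plus \<open>\<kappa>\<close> times \<open>\<integral> |x|\<^sup>-\<^sup>N\<close> over the annulus, which is scale invariant. This replaces Hardy's inequality.\<close>

lemma cutoff_error_small:
  assumes "e > 0"
  shows "\<forall>\<^sub>F n in sequentially.
    (LINT x|lborel. indicator {x. 1 / Suc n \<le> norm x \<and> norm x \<le> 2 * (1 / Suc n)} x *
      (\<bar>u x\<bar> * norm (G x) powr (p - 1) * (16 / (1 / Suc n)))) < e"
proof -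
  let ?N = "real CARD('n)"
  let ?A = "\<lambda>n. {x::real^'n. 1 / Suc n \<le> norm x \<and> norm x \<le> 2 * (1 / Suc n)}"
  \<comment> \<open>The ball of radius 2 d has volume d^N times \<open>c0\<close>, so
    \<open>c0\<close> bounds d^(-N) times the volume of the annulus for every d.\<close>
  define c0 where "c0 = 2 ^ CARD('n) * measure lborel (cball (0::real^'n) 1)"
  have c0: "c0 \<ge> 0" unfolding c0_def by simp
  \<comment> \<open>Only 16 \<kappa> \<open>c0\<close> survives in the limit, and this choice makes
    it less than \<open>e\<close>.\<close>
  define \<kappa> where "\<kappa> = e / (64 * (c0 + 1))"
  have \<kappa>: "\<kappa> > 0" using assms c0 by (simp add: \<kappa>_def)
  obtain L where L: "L \<ge> 0" "\<And>a c. 0 \<le> a \<Longrightarrow> 0 \<le> c \<Longrightarrow> a powr (p - 1) * c \<le> L * a powr p + \<kappa> * c powr p"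
    using weighted_young[OF p(1) \<kappa>] by metis
  have Am[measurable]: "?A n \<in> sets borel" for n by simp
  have iA: "integrable lborel (\<lambda>x. indicator (?A n) x :: real)" for n
  proof -
    have "bounded (?A n)" by (rule bounded_subset[OF bounded_cball[of 0 "2 * (1 / Suc n)"]]) auto
    then have "emeasure lborel (?A n) < \<infinity>" by (rule emeasure_bounded_finite)
    then show ?thesis by (subst integrable_indicator_iff) auto
  qed
  have iAg: "integrable lborel (\<lambda>x. indicator (?A n) x * g x)" if "integrable lborel g" for g ::
      "real^'n \<Rightarrow> real" and n
    using integrable_mult_indicator[OF _ that, of "?A n"] by simp
  let ?lhs = "\<lambda>n x. indicator (?A n) x * (\<bar>u x\<bar> * norm (G x) powr (p - 1) * (16 / (1 / Suc n)))"
  let ?rhs = "\<lambda>n x. 16 * L * (indicator (?A n) x * norm (G x) powr p)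
     + 16 * \<kappa> * (indicator (?A n) x * \<bar>u x\<bar> powr pstar) + 16 * \<kappa> * ((1 / Suc n) powr (- ?N) * indicator
         (?A n) x)"
  have pw: "?lhs n x \<le> ?rhs n x" for n x
  proof (cases "x \<in> ?A n")
    case True
    define d where "d = 1 / real (Suc n)"
    have d: "d > 0" by (simp add: d_def)
    have "\<bar>u x\<bar> powr p * d powr (- p) \<le> \<bar>u x\<bar> powr pstar + d powr (- ?N)"
    proof -
      \<comment> \<open>The exponent (N-p)/N is the one that splits |u|^p d^(-p) into |u|^pstar and
        d^(-N).\<close>
      have "(\<bar>u x\<bar> powr pstar) powr ((?N - p) / ?N) * (d powr (- ?N)) powr (1 - (?N - p) / ?N) \<le> \<bar>u x\<bar>
          powr pstar + d powr (- ?N)"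
        using p by (intro powr_mult_le_add) auto
      moreover have "pstar * ((?N - p) / ?N) = p" using p by (simp add: pstar_eq)
      moreover have "- ?N * (1 - (?N - p) / ?N) = - p" using p by (simp add: field_simps)
      ultimately show ?thesis by (simp only: powr_powr)
    qed
    moreover have "(\<bar>u x\<bar> / d) powr p = \<bar>u x\<bar> powr p * d powr (- p)" using d by (simp add: powr_divide
        powr_minus field_simps)
    moreover have "norm (G x) powr (p - 1) * (\<bar>u x\<bar> / d) \<le> L * norm (G x) powr p + \<kappa> * (\<bar>u x\<bar> / d) powr p"
      using d by (intro L(2)) auto
    ultimately have le: "norm (G x) powr (p - 1) * (\<bar>u x\<bar> / d) \<le> L * norm (G x) powr p + \<kappa> * (\<bar>u x\<bar> powr
        pstar + d powr (- ?N))"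
      using \<kappa> by (smt (verit) mult_left_mono)
    have "\<bar>u x\<bar> * norm (G x) powr (p - 1) * (16 / d) = 16 * (norm (G x) powr (p - 1) * (\<bar>u x\<bar> / d))" by simp
    also have "\<dots> \<le> 16 * (L * norm (G x) powr p + \<kappa> * (\<bar>u x\<bar> powr pstar + d powr (- ?N)))"
      using le by (rule mult_left_mono) simp
    also have "16 * (L * norm (G x) powr p + \<kappa> * (\<bar>u x\<bar> powr pstar + d powr (- ?N)))
        = 16 * L * norm (G x) powr p + 16 * \<kappa> * \<bar>u x\<bar> powr pstar + 16 * \<kappa> * d powr (- ?N)"
      by (simp add: algebra_simps)
    finally show ?thesis using True unfolding d_def[symmetric] by simp
  qed simp
  have int_rhs: "integrable lborel (?rhs n)" for n
    using iAg[OF int_G, of n] iAg[OF int_u, of n] iA[of n] by simp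
  have mA: "(1 / Suc n) powr (- ?N) * measure lborel (?A n) \<le> c0" for n
  proof -
    define d where "d = 1 / real (Suc n)"
    have d: "d > 0" by (simp add: d_def)
    have "measure lborel (?A n) \<le> measure lborel (cball (0::real^'n) (2 * d))"
      using emeasure_lborel_cball_finite[of "0::real^'n" "2 * d"]
      by (intro measure_mono_fmeasurable) (auto simp: d_def fmeasurable_def)
    also have "\<dots> = (2 * d) ^ CARD('n) * measure lborel (cball (0::real^'n) 1)"
      using content_ball_conv_unit_ball[of "2 * d" "0::real^'n"] d by (simp add: content_cball_conv_ball)
    also have "\<dots> = d ^ CARD('n) * c0" by (simp add: c0_def power_mult_distrib)
    finally have "d powr (- ?N) * measure lborel (?A n) \<le> d powr (- ?N) * (d ^ CARD('n) * c0)"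
      by (rule mult_left_mono) simp
    also have "\<dots> = c0" using d by (simp add: powr_minus powr_realpow)
    finally show ?thesis unfolding d_def .
  qed
  have le: "(LINT x|lborel. ?lhs n x) \<le> 16 * L * (LINT x|lborel. indicator (?A n) x * norm (G x) powr p)
     + 16 * \<kappa> * (LINT x|lborel. indicator (?A n) x * \<bar>u x\<bar> powr pstar) + 16 * \<kappa> * c0" for n
  proof -
    have "(LINT x|lborel. ?lhs n x) \<le> (LINT x|lborel. ?rhs n x)"
      by (rule integral_mono'[OF int_rhs pw]) (use L(1) \<kappa> in \<open>auto intro!: add_nonneg_nonneg
          mult_nonneg_nonneg\<close>)
    also have "\<dots> = 16 * L * (LINT x|lborel. indicator (?A n) x * norm (G x) powr p)
     + 16 * \<kappa> * (LINT x|lborel. indicator (?A n) x * \<bar>u x\<bar> powr pstar)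
     + 16 * \<kappa> * ((1 / Suc n) powr (- ?N) * (LINT x|lborel. indicator (?A n) x))"
      using iAg[OF int_G, of n] iAg[OF int_u, of n] iA[of n] by simp
    also have "(LINT x|lborel. indicator (?A n) x) = measure lborel (?A n)" by simp
    also have "16 * \<kappa> * ((1 / Suc n) powr (- ?N) * measure lborel (?A n)) \<le> 16 * \<kappa> * c0"
      using mA[of n] \<kappa> by (intro mult_left_mono) auto
    finally show ?thesis by simp
  qed
  have "(\<lambda>n. 16 * L * (LINT x|lborel. indicator (?A n) x * norm (G x) powr p)
     + 16 * \<kappa> * (LINT x|lborel. indicator (?A n) x * \<bar>u x\<bar> powr pstar) + 16 * \<kappa> * c0) \<longlonglongrightarrow> 16 * L * 0 + 16
         * \<kappa> * 0 + 16 * \<kappa> * c0"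
    by (intro tendsto_add tendsto_mult_left tendsto_const annulus_integral_tendsto int_G int_u)
  moreover have "16 * L * 0 + 16 * \<kappa> * 0 + 16 * \<kappa> * c0 < e"
    using assms c0 by (simp add: \<kappa>_def field_simps add_pos_nonneg)
  ultimately have "\<forall>\<^sub>F n in sequentially. 16 * L * (LINT x|lborel. indicator (?A n) x * norm (G x) powr p)
     + 16 * \<kappa> * (LINT x|lborel. indicator (?A n) x * \<bar>u x\<bar> powr pstar) + 16 * \<kappa> * c0 < e"
    by (rule order_tendstoD)
  then show ?thesis by eventually_elim (use le in \<open>rule le_less_trans\<close>)
qed

text \<open>Once 2 d \<le> d0 the cutoff equals 1 for |x| \<ge> d0, so the integral of the excess
  over that fixed shell is at most the cutoff error, which tends to 0 with d. A nonnegative function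
  with integral zero vanishes almost everywhere, and strictness then excludes v < u.\<close>

lemma comparison_principle:
  fixes R\<^sub>0 \<tau> m :: real and v \<zeta> :: "real^'n \<Rightarrow> real" and b grad_\<zeta> :: "real^'n \<Rightarrow> real^'n"
  assumes cmp: "\<And>d. d > 0 \<Longrightarrow> comparison \<Omega> p pstar \<mu> f u G R\<^sub>0 \<tau> m d v \<zeta> (cutoff d) b grad_\<zeta> (grad_cutoff d)"
  shows "AE x in lborel. norm x < R\<^sub>0 \<longrightarrow> u x \<le> v x"
proof -
  \<comment> \<open>The radius 1 is arbitrary: the excess does not depend on the cutoff, and this
    instance provides it together with the facts about the barrier.\<close>
  interpret one: comparison \<Omega> p pstar \<mu> f u G R\<^sub>0 \<tau> m 1 v \<zeta> "cutoff 1" b grad_\<zeta> "grad_cutoff 1"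
    by (rule cmp) simp
  let ?E = "one.excess"
  let ?reg = "\<lambda>d. {x::real^'n. d \<le> norm x \<and> norm x \<le> R\<^sub>0 - \<tau> / 2}"
  have Em[measurable]: "?E \<in> borel_measurable borel"
    unfolding one.excess_def[abs_def] one.gap_def one.H_def one.upper_def by measurable
  have pos: "AE x in lborel. 0 < norm x \<and> norm x < R\<^sub>0 \<longrightarrow> 0 \<le> ?E x \<and> (v x < u x \<longrightarrow> 0 < ?E x)"
    using one.super
  proof eventually_elim
    case (elim x)
    show ?case
    proof (intro impI conjI)
      assume x: "0 < norm x \<and> norm x < R\<^sub>0"
      then have x0: "x \<noteq> 0" by auto
      have g: "0 < one.gap x" using elim x unfolding one.gap_def by auto
      then show "0 \<le> ?E x" unfolding one.excess_def using one.HQ_bounds(1)[OF x0] by simp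
      show "0 < ?E x" if uv: "v x < u x"
      proof -
        have "0 < one.H (u x) x"
          using uv one.upper_cases[OF x0, of "u x"] profile_pos unfolding one.H_def by (metis not_less)
        moreover have "0 < one.upper (u x) x" using uv one.v(1)[OF x0] by (simp add: one.upper_def)
        ultimately show ?thesis unfolding one.excess_def using g by simp
      qed
    qed
  qed
  have \<tau>: "\<tau> > 0" by (rule one.\<tau>)
  have zero: "AE x in lborel. d0 \<le> norm x \<and> norm x \<le> R\<^sub>0 - \<tau> / 2 \<longrightarrow> u x \<le> v x" if d0: "d0 > 0" for d0
  proof -
    let ?a = "\<lambda>x. indicator (?reg d0) x * ?E x"
    have step: "integrable lborel ?a \<and> (LINT x|lborel. ?a x) \<le>
        (LINT x|lborel. indicator {x. d \<le> norm x \<and> norm x \<le> 2 * d} x * (\<bar>u x\<bar> * norm (G x) powr (p - 1)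
            * (16 / d)))"
      if d: "d > 0" "2 * d \<le> d0" for d
    proof -
      interpret c: comparison \<Omega> p pstar \<mu> f u G R\<^sub>0 \<tau> m d v \<zeta> "cutoff d" b grad_\<zeta> "grad_cutoff d"
        by (rule cmp[OF d(1)])
      note ci = c.cutoff_inequality[unfolded c.region_def]
      have pos': "AE x in lborel. 0 \<le> ?a x \<and> ?a x \<le> indicator (?reg d) x * (cutoff d x * ?E x)"
        using pos
      proof eventually_elim
        case (elim x)
        show ?case
        proof (cases "x \<in> ?reg d")
          case True
          then have "0 \<le> ?E x" using elim d \<tau> by auto
          then show ?thesis using True cutoff_large(1)[OF d(1), of x] cutoff_bounds(1)[of d x] d(2) by
              (auto simp: indicator_def)
        next
          case False
          then have "x \<notin> ?reg d0" using d by auto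
          then show ?thesis using False by simp
        qed
      qed
      have ia: "integrable lborel ?a"
      proof (rule Bochner_Integration.integrable_bound[OF ci(1)])
        show "AE x in lborel. norm (?a x) \<le> norm (indicator (?reg d) x * (cutoff d x * ?E x))"
          using pos'
        proof eventually_elim
          case (elim x)
          show ?case
            unfolding real_norm_def abs_of_nonneg[OF conjunct1[OF elim]]
            by (rule order_trans[OF conjunct2[OF elim] abs_ge_self])
        qed
      qed simp
      have "(LINT x|lborel. ?a x) \<le> (LINT x|lborel. indicator (?reg d) x * (cutoff d x * ?E x))"
        by (rule integral_mono_AE[OF ia ci(1)]) (rule eventually_mono[OF pos'], erule conjunct2)
      also have "\<dots> \<le> (LINT x|lborel. indicator (?reg d) x * (\<bar>u x\<bar> * norm (G x) powr (p - 1) * norm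
          (grad_cutoff d x)))"
        by (rule ci(3))
      also have "\<dots> \<le> (LINT x|lborel. indicator {x. d \<le> norm x \<and> norm x \<le> 2 * d} x * (\<bar>u x\<bar> * norm (G x)
          powr (p - 1) * (16 / d)))"
      proof (rule integral_mono')
        have "integrable lborel (\<lambda>x. \<bar>u x\<bar> * norm (G x) powr (p - 1))"
        proof (rule Bochner_Integration.integrable_bound)
          show "integrable lborel (\<lambda>x. norm (G x) powr p + \<bar>u x\<bar> powr p)"
            using int_G integrable_u_powr[of p] pstar p by simp
          have "norm (\<bar>u x\<bar> * norm (G x) powr (p - 1)) \<le> norm (norm (G x) powr p + \<bar>u x\<bar> powr p)" for x
            using powr_minus_one_mult_le[of "norm (G x)" "\<bar>u x\<bar>" p] p by (simp add: mult.commute)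
          then show "AE x in lborel. norm (\<bar>u x\<bar> * norm (G x) powr (p - 1)) \<le> norm (norm (G x) powr p +
              \<bar>u x\<bar> powr p)" by simp
        qed simp
        then have "integrable lborel (\<lambda>x. \<bar>u x\<bar> * norm (G x) powr (p - 1) * (16 / d))" by simp
        from integrable_mult_indicator[OF _ this, of "{x. d \<le> norm x \<and> norm x \<le> 2 * d}"]
        show "integrable lborel (\<lambda>x. indicator {x. d \<le> norm x \<and> norm x \<le> 2 * d} x * (\<bar>u x\<bar> * norm (G x)
            powr (p - 1) * (16 / d)))"
          by simp
        fix x :: "real^'n"
        let ?k = "\<bar>u x\<bar> * norm (G x) powr (p - 1)"
        have "indicator (?reg d) x * (?k * norm (grad_cutoff d x)) \<le> 1 * (?k * (indicator {x. d \<le> norm x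
            \<and> norm x \<le> 2 * d} x * (16 / d)))"
          using norm_grad_cutoff_le[OF d(1), of x] by (intro mult_mono) (auto simp: indicator_def)
        then show "indicator (?reg d) x * (?k * norm (grad_cutoff d x)) \<le> indicator {x. d \<le> norm x \<and>
            norm x \<le> 2 * d} x * (?k * (16 / d))"
          by (simp add: mult_ac)
        show "0 \<le> indicator {x. d \<le> norm x \<and> norm x \<le> 2 * d} x * (?k * (16 / d))" using d(1) by simp
      qed
      finally show ?thesis using ia by blast
    qed
    have "(LINT x|lborel. ?a x) \<le> 0"
    proof (rule field_le_epsilon)
      fix e :: real assume "e > 0"
      have "(\<lambda>n. 2 * (1 / real (Suc n))) \<longlonglongrightarrow> 2 * 0"
        using LIMSEQ_inverse_real_of_nat by (intro tendsto_mult_left) (simp add: inverse_eq_divide)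
      then have "\<forall>\<^sub>F n in sequentially. 2 * (1 / real (Suc n)) < d0" using d0 by (intro order_tendstoD) auto
      with cutoff_error_small[OF \<open>e > 0\<close>]
      have "\<forall>\<^sub>F n in sequentially. (LINT x|lborel. ?a x) \<le> e"
      proof eventually_elim
        case (elim n)
        have "(LINT x|lborel. ?a x) \<le> (LINT x|lborel. indicator {x. 1 / Suc n \<le> norm x \<and> norm x \<le> 2 * (1
            / Suc n)} x *
            (\<bar>u x\<bar> * norm (G x) powr (p - 1) * (16 / (1 / Suc n))))"
          using step[of "1 / Suc n"] elim(2) by simp
        with elim(1) show ?case by linarith
      qed
      then show "(LINT x|lborel. ?a x) \<le> 0 + e" by (auto simp: eventually_sequentially)
    qed
    moreover have nn: "AE x in lborel. 0 \<le> ?a x"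
      using pos
    proof eventually_elim
      case (elim x)
      then show ?case using d0 \<tau> by (auto simp: indicator_def)
    qed
    ultimately have "(LINT x|lborel. ?a x) = 0" using integral_nonneg_AE[OF nn] by linarith
    moreover have ia: "integrable lborel ?a" using step[of "d0 / 2"] d0 by simp
    ultimately have "AE x in lborel. ?a x = 0" using integral_nonneg_eq_0_iff_AE[OF ia nn] by blast
    then show ?thesis
      using pos
    proof eventually_elim
      case (elim x)
      show ?case
      proof
        assume x: "d0 \<le> norm x \<and> norm x \<le> R\<^sub>0 - \<tau> / 2"
        then have "?E x = 0" using elim(1) by simp
        then show "u x \<le> v x" using elim(2) x d0 \<tau> by force
      qed
    qed
  qed
  \<comment> \<open>Countably many shells exhaust the punctured ball up to the outer annulus, where
    u \<le> m \<le> v.\<close>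
  have "AE x in lborel. \<forall>n. 1 / real (Suc n) \<le> norm x \<and> norm x \<le> R\<^sub>0 - \<tau> / 2 \<longrightarrow> u x \<le> v x"
    unfolding AE_all_countable by (intro allI zero) simp
  moreover have "AE x in lborel. x \<noteq> (0::real^'n)" by (rule AE_lborel_singleton)
  ultimately show ?thesis
    using one.annulus
  proof eventually_elim
    case (elim x)
    show ?case
    proof
      assume x: "norm x < R\<^sub>0"
      show "u x \<le> v x"
      proof (cases "norm x \<le> R\<^sub>0 - \<tau> / 2")
        case True
        have "norm x > 0" using elim(2) by simp
        then obtain n where "inverse (real (Suc n)) < norm x" using reals_Archimedean by blast
        then show ?thesis using elim(1)[rule_format, of n] True by (simp add: inverse_eq_divide less_imp_le)
      next
        case False
        then have "u x \<le> m" using elim(3) x \<tau> by auto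
        also have "m \<le> v x" by (rule one.v_ge[OF elim(2) x])
        finally show ?thesis .
      qed
    qed
  qed
qed

end

section \<open>The barrier\<close>

text \<open>For v = r^(-t) with t > 0 one has -\<Delta>_p v = \<open>hardy_fun N p t\<close> r^(-p)
  v^(p-1), so such a power solves the equation with f = 0 when \<open>hardy_fun N p t\<close> =
  \<mu>.\<close>

definition hardy_fun :: "real \<Rightarrow> real \<Rightarrow> real \<Rightarrow> real" where
  "hardy_fun N p t = (N - p) * t powr (p - 1) - (p - 1) * t powr p"

lemma hardy_root_iff:
  assumes "1 < p"
  shows "hardy_root N p \<mu> \<gamma> \<longleftrightarrow> 0 \<le> \<gamma> \<and> hardy_fun N p \<gamma> = \<mu>"
proof -
  have "\<gamma> powr (p - 2) * ((p - 1) * \<gamma>\<^sup>2 - (N - p) * \<gamma>) = - hardy_fun N p \<gamma>" if "0 \<le> \<gamma>"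
  proof (cases "\<gamma> = 0")
    case False
    then have g: "\<gamma> > 0" using that by simp
    have "\<gamma> powr (p - 2) * \<gamma>\<^sup>2 = \<gamma> powr p" using g by (simp add: powr_diff)
    moreover have "\<gamma> powr (p - 2) * \<gamma> = \<gamma> powr (p - 1)" using g by (simp add: powr_diff power2_eq_square)
    moreover have "\<gamma> powr (p - 2) * ((p - 1) * \<gamma>\<^sup>2 - (N - p) * \<gamma>)
       = (p - 1) * (\<gamma> powr (p - 2) * \<gamma>\<^sup>2) - (N - p) * (\<gamma> powr (p - 2) * \<gamma>)" by (simp add: algebra_simps)
    ultimately show ?thesis by (simp add: hardy_fun_def)
  qed (simp add: hardy_fun_def)
  then show ?thesis unfolding hardy_root_def by auto
qed

text \<open>The last factor changes sign at t = (N-p)/p, the maximum point.\<close>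

lemma hardy_fun_deriv:
  assumes "t > 0"
  shows "(hardy_fun N p has_real_derivative (p - 1) * t powr (p - 2) * ((N - p) - p * t)) (at t)"
proof -
  have "(hardy_fun N p has_real_derivative (N - p) * ((p - 1) * t powr (p - 1 - 1)) - (p - 1) * (p * t
      powr (p - 1))) (at t)"
    unfolding hardy_fun_def[abs_def] using assms
    by (intro DERIV_diff DERIV_cmult has_real_derivative_powr)
  moreover have "t powr (p - 1) = t powr (p - 2) * t" using assms by (simp add: powr_diff power2_eq_square)
  ultimately show ?thesis by (simp add: algebra_simps)
qed

lemma hardy_fun_mono:
  assumes "1 < p" "p < N" "0 \<le> a" "a \<le> b" "b \<le> (N - p) / p"
  shows "hardy_fun N p a \<le> hardy_fun N p b"
\<comment> \<open>The derivative formula requires t > 0 (for p < 2 the slope at 0 is infinite), so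
  an interval starting at 0 is treated by comparing with the value 0 there.\<close>
proof (cases "a = 0")
  case True
  show ?thesis
  proof (cases "b = 0")
    case False
    then have b: "b > 0" using assms by simp
    have "(p - 1) * b \<le> N - p"
    proof -
      have "p * b \<le> N - p" using assms by (simp add: pos_le_divide_eq mult.commute)
      then show ?thesis using b by (simp add: algebra_simps)
    qed
    moreover have "hardy_fun N p b = b powr (p - 1) * ((N - p) - (p - 1) * b)"
      using b by (simp add: hardy_fun_def powr_diff field_simps)
    ultimately show ?thesis using True by (simp add: hardy_fun_def)
  qed (use True in simp)
next
  case False
  show ?thesis
  proof (rule DERIV_nonneg_imp_nondecreasing[OF assms(4)])
    fix t assume t: "a \<le> t" "t \<le> b"
    then have "t > 0" using False assms by simp
    moreover have "p * t \<le> N - p"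
    proof -
      have "t \<le> (N - p) / p" using assms t by linarith
      then show ?thesis using assms by (simp add: pos_le_divide_eq mult.commute)
    qed
    ultimately have "0 \<le> (p - 1) * t powr (p - 2) * ((N - p) - p * t)" using assms by simp
    then show "\<exists>y. (hardy_fun N p has_real_derivative y) (at t) \<and> 0 \<le> y"
      using hardy_fun_deriv[OF \<open>t > 0\<close>] by blast
  qed
qed

text \<open>Beyond its maximum at (N-p)/p the function \<open>hardy_fun\<close> is strictly
  decreasing, so two different roots cannot both lie there.\<close>

lemma smaller_hardy_root_less:
  assumes "1 < p" "p < N" "hardy_root N p \<mu> \<gamma>\<^sub>1" "hardy_root N p \<mu> \<gamma>\<^sub>2" "\<gamma>\<^sub>1 < \<gamma>\<^sub>2"
  shows "\<gamma>\<^sub>1 < (N - p) / p"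
proof (rule ccontr)
  assume "\<not> \<gamma>\<^sub>1 < (N - p) / p"
  then have g: "(N - p) / p \<le> \<gamma>\<^sub>1" by simp
  moreover have "(N - p) / p > 0" using assms by simp
  ultimately have g0: "\<gamma>\<^sub>1 > 0" by linarith
  have "hardy_fun N p \<gamma>\<^sub>2 < hardy_fun N p \<gamma>\<^sub>1"
  proof (rule DERIV_neg_imp_decreasing_open[OF assms(5)])
    fix t assume t: "\<gamma>\<^sub>1 < t" "t < \<gamma>\<^sub>2"
    then have t0: "t > 0" using g0 by simp
    have "N - p < p * t" using g t assms by (simp add: pos_divide_le_eq mult.commute order_le_less_trans)
    then have "(p - 1) * t powr (p - 2) * ((N - p) - p * t) < 0"
      using assms t0 by (intro mult_pos_neg mult_pos_pos) auto
    then show "\<exists>y. (hardy_fun N p has_real_derivative y) (at t) \<and> y < 0"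
      using hardy_fun_deriv[OF t0] by blast
  next
    show "continuous_on {\<gamma>\<^sub>1..\<gamma>\<^sub>2} (hardy_fun N p)"
      using g0 by (intro continuous_at_imp_continuous_on ballI DERIV_isCont[OF hardy_fun_deriv]) auto
  qed
  then show False using assms hardy_root_iff by auto
qed

text \<open>The second estimate says that the gain (p-1) \<beta>^(p-2) r \<beta>' from the varying
  exponent \<beta> = \<gamma> + K r^\<epsilon> beats the contribution of \<open>f\<close>. As
  \<gamma> may be 0, the factor \<beta>^(p-2) is bounded below differently according to the sign of
  p - 2. In both cases K is fixed first and \<rho> afterwards.\<close>

lemma barrier_parameters:
  fixes p \<gamma> A \<alpha> \<beta>\<^sub>0 :: real
  assumes "1 < p" "0 \<le> \<gamma>" "\<gamma> < \<beta>\<^sub>0" "0 < A" "\<alpha> < p"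
  obtains K \<epsilon> \<rho> where "0 < K" "0 < \<epsilon>" "0 < \<rho>"
    "\<And>r. 0 < r \<Longrightarrow> r \<le> \<rho> \<Longrightarrow> \<gamma> + K * r powr \<epsilon> \<le> \<beta>\<^sub>0"
    "\<And>r. 0 < r \<Longrightarrow> r \<le> \<rho> \<Longrightarrow> A * r powr (p - \<alpha>) < (p - 1) * (\<gamma> + K * r powr \<epsilon>) powr (p - 2) * (K * \<epsilon> * r powr \<epsilon>)"
proof -
  have rho: "\<exists>\<rho>>0. \<forall>r. 0 < r \<longrightarrow> r \<le> \<rho> \<longrightarrow> \<gamma> + K * r powr \<epsilon> \<le> \<beta>\<^sub>0" if "K > 0" "\<epsilon> > 0" for K \<epsilon> :: real
  proof (intro exI conjI allI impI)
    let ?\<rho> = "((\<beta>\<^sub>0 - \<gamma>) / K) powr (1 / \<epsilon>)"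
    show "?\<rho> > 0" using assms that by simp
    fix r :: real assume r: "0 < r" "r \<le> ?\<rho>"
    have "r powr \<epsilon> \<le> ?\<rho> powr \<epsilon>" using r that by (intro powr_mono2) auto
    also have "\<dots> = (\<beta>\<^sub>0 - \<gamma>) / K" using assms that by (simp add: powr_powr)
    finally show "\<gamma> + K * r powr \<epsilon> \<le> \<beta>\<^sub>0" using that by (simp add: pos_le_divide_eq mult.commute)
  qed
  show ?thesis
  proof (cases "2 \<le> p")
    case True
    \<comment> \<open>Here \<beta> \<ge> K r^\<epsilon> gives a gain of order (K
      r^\<epsilon>)^(p-1), and this \<epsilon> makes it a multiple of r^(p-\<alpha>).\<close>
    define \<epsilon> where "\<epsilon> = (p - \<alpha>) / (p - 1)"
    have \<epsilon>: "\<epsilon> > 0" using assms by (simp add: \<epsilon>_def)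
    define c where "c = (A + 1) / ((p - 1) * \<epsilon>)"
    have c: "c > 0" using assms \<epsilon> by (simp add: c_def add_pos_pos)
    define K where "K = c powr (1 / (p - 1))"
    have K: "K > 0" using c by (simp add: K_def)
    have Kp: "K powr (p - 1) = c" using assms c by (simp add: K_def powr_powr)
    obtain \<rho> where \<rho>: "\<rho> > 0" "\<And>r. 0 < r \<Longrightarrow> r \<le> \<rho> \<Longrightarrow> \<gamma> + K * r powr \<epsilon> \<le> \<beta>\<^sub>0" using rho[OF K \<epsilon>] by blast
    have "A * r powr (p - \<alpha>) < (p - 1) * (\<gamma> + K * r powr \<epsilon>) powr (p - 2) * (K * \<epsilon> * r powr \<epsilon>)" if r: "0
        < r" for r
    proof -
      have x: "K * r powr \<epsilon> > 0" using K r by simp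
      have "A * r powr (p - \<alpha>) < (A + 1) * r powr (p - \<alpha>)" using r by simp
      also have "\<dots> = (p - 1) * \<epsilon> * (c * r powr (p - \<alpha>))" using assms \<epsilon> by (simp add: c_def)
      also have "c * r powr (p - \<alpha>) = (K * r powr \<epsilon>) powr (p - 1)"
        using K r assms by (simp add: powr_mult Kp powr_powr \<epsilon>_def)
      also have "\<dots> = (K * r powr \<epsilon>) powr (p - 2) * (K * r powr \<epsilon>)"
        using x powr_mult_base[of "K * r powr \<epsilon>" "p - 2"] by (simp add: mult.commute)
      also have "(p - 1) * \<epsilon> * ((K * r powr \<epsilon>) powr (p - 2) * (K * r powr \<epsilon>))
          \<le> (p - 1) * \<epsilon> * ((\<gamma> + K * r powr \<epsilon>) powr (p - 2) * (K * r powr \<epsilon>))"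
        using assms True x \<epsilon> by (intro mult_left_mono mult_right_mono powr_mono2) auto
      finally show ?thesis by (simp add: mult_ac)
    qed
    with K \<epsilon> \<rho> show ?thesis by (intro that[of K \<epsilon> \<rho>]) auto
  next
    case False
    \<comment> \<open>For p < 2 the power with exponent p - 2 decreases, so the upper bound
      \<open>\<beta>\<^sub>0\<close> on \<beta> bounds \<beta>^(p-2) from below by a constant, and
      the gain is of order r^\<epsilon>.\<close>
    define \<epsilon> where "\<epsilon> = p - \<alpha>"
    have \<epsilon>: "\<epsilon> > 0" using assms by (simp add: \<epsilon>_def)
    have b0: "\<beta>\<^sub>0 > 0" using assms by simp
    define q where "q = (p - 1) * \<beta>\<^sub>0 powr (p - 2) * \<epsilon>"
    have q: "q > 0" using assms \<epsilon> b0 by (simp add: q_def)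
    define K where "K = (A + 1) / q"
    have K: "K > 0" using q assms by (simp add: K_def add_pos_pos)
    obtain \<rho> where \<rho>: "\<rho> > 0" "\<And>r. 0 < r \<Longrightarrow> r \<le> \<rho> \<Longrightarrow> \<gamma> + K * r powr \<epsilon> \<le> \<beta>\<^sub>0" using rho[OF K \<epsilon>] by blast
    have "A * r powr (p - \<alpha>) < (p - 1) * (\<gamma> + K * r powr \<epsilon>) powr (p - 2) * (K * \<epsilon> * r powr \<epsilon>)" if r: "0
        < r" "r \<le> \<rho>" for r
    proof -
      have x: "K * r powr \<epsilon> > 0" using K r by simp
      have "A * r powr (p - \<alpha>) < (A + 1) * r powr (p - \<alpha>)" using r by simp
      also have "\<dots> = q * K * r powr \<epsilon>" using q by (simp add: K_def \<epsilon>_def)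
      also have "\<dots> = (p - 1) * \<beta>\<^sub>0 powr (p - 2) * (K * \<epsilon> * r powr \<epsilon>)" by (simp add: q_def)
      also have "\<dots> \<le> (p - 1) * (\<gamma> + K * r powr \<epsilon>) powr (p - 2) * (K * \<epsilon> * r powr \<epsilon>)"
      proof -
        have "\<beta>\<^sub>0 powr (p - 2) \<le> (\<gamma> + K * r powr \<epsilon>) powr (p - 2)"
          using assms False x \<rho>(2)[OF r] by (intro powr_mono2') auto
        then show ?thesis using assms K \<epsilon> by (intro mult_left_mono mult_right_mono) auto
      qed
      finally show ?thesis .
    qed
    with K \<epsilon> \<rho> show ?thesis by (intro that[of K \<epsilon> \<rho>]) auto
  qed
qed

lemma gderiv_radial:
  fixes x :: "'a::real_inner"
  assumes "x \<noteq> 0" "(g has_real_derivative D) (at (norm x))"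
  shows "GDERIV (\<lambda>x. g (norm x)) x :> (D / norm x) *\<^sub>R x"
proof -
  have "GDERIV (\<lambda>x. g (norm x)) x :> D *\<^sub>R sgn x"
    by (rule GDERIV_DERIV_compose[OF GDERIV_norm[OF assms(1)] assms(2)])
  then show ?thesis by (simp add: sgn_div_norm divide_inverse)
qed

context borel_subsolution
begin

text \<open>The barrier is the radial solution of \<open>v' / v = - \<beta>(r) / r\<close> with \<open>\<beta>(r) = \<gamma> + K r\<^sup>\<epsilon>\<close>; the term \<open>K r\<^sup>\<epsilon>\<close> makes it
  a strict supersolution without changing the order of growth at the origin.\<close>

lemma barrier_bound:
  fixes A \<alpha> \<gamma> K \<epsilon> \<rho> R\<^sub>0 \<tau> m :: real
  assumes \<gamma>: "0 \<le> \<gamma>" "hardy_fun (real CARD('n)) p \<gamma> = \<mu>" and K: "0 < K" "0 < \<epsilon>"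
    and par1: "\<And>r. 0 < r \<Longrightarrow> r \<le> \<rho> \<Longrightarrow> \<gamma> + K * r powr \<epsilon> \<le> (real CARD('n) - p) / p"
    and par2: "\<And>r. 0 < r \<Longrightarrow> r \<le> \<rho> \<Longrightarrow>
      A * r powr (p - \<alpha>) < (p - 1) * (\<gamma> + K * r powr \<epsilon>) powr (p - 2) * (K * \<epsilon> * r powr \<epsilon>)"
    and f_le: "AE x in lborel. x \<in> \<Omega> \<longrightarrow> f x \<le> A * norm x powr (- \<alpha>)"
    and R0: "0 < R\<^sub>0" "R\<^sub>0 \<le> \<rho>" "cball 0 R\<^sub>0 \<subseteq> \<Omega>" and \<tau>: "0 < \<tau>" and m: "0 < m"
    and ann: "AE x in lborel. R\<^sub>0 - \<tau> < norm x \<and> norm x < R\<^sub>0 \<longrightarrow> u x \<le> m"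
  shows "AE x in lborel. norm x < R\<^sub>0 \<longrightarrow> u x \<le> \<rho> powr \<gamma> * exp (K * \<rho> powr \<epsilon> / \<epsilon>) * m * norm x powr (- \<gamma>)"
proof -
  let ?N = "real CARD('n)"
  define \<beta> where "\<beta> r = \<gamma> + K * r powr \<epsilon>" for r
  \<comment> \<open>Normalised so that V equals \<open>m\<close> at \<open>R\<^sub>0\<close>; since
    V decreases, v \<ge> m inside the ball.\<close>
  define c where "c = m * R\<^sub>0 powr \<gamma> * exp (K * R\<^sub>0 powr \<epsilon> / \<epsilon>)"
  define V where "V r = c * (r powr (- \<gamma>) * exp (- (K / \<epsilon>) * r powr \<epsilon>))" for r
  \<comment> \<open>The flux of b = -\<beta> x/r^2, where |b| = \<beta>/r, is Z(r) x.\<close>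
  define Z where "Z r = - (\<beta> r powr (p - 1) * r powr (- p))" for r
  define Z' where "Z' r = - ((p - 1) * \<beta> r powr (p - 2) * (K * \<epsilon> * r powr (\<epsilon> - 1)) * r powr (- p)
      - p * \<beta> r powr (p - 1) * r powr (- p - 1))" for r
  define v where "v x = V (norm x)" for x :: "real^'n"
  define b where "b x = (- (\<beta> (norm x) / (norm x)\<^sup>2)) *\<^sub>R x" for x :: "real^'n"
  define \<zeta> where "\<zeta> x = Z (norm x)" for x :: "real^'n"
  define grad_\<zeta> where "grad_\<zeta> x = (Z' (norm x) / norm x) *\<^sub>R x" for x :: "real^'n"
  have c0: "c > 0" using m R0 by (simp add: c_def)
  have \<beta>0: "\<beta> r > 0" if "r > 0" for r using that K \<gamma>(1) by (simp add: \<beta>_def add_nonneg_pos)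
  have V0: "V r > 0" if "r > 0" for r using that c0 by (simp add: V_def)
  have dpow: "((\<lambda>r. r powr a) has_real_derivative a * r powr (a - 1)) (at r)" if "r > 0" for r a :: real
    using that by (rule has_real_derivative_powr)
  have dV: "(V has_real_derivative - (V r * \<beta> r / r)) (at r)" if r: "r > 0" for r
  proof -
    have "((\<lambda>r. exp (- (K / \<epsilon>) * r powr \<epsilon>)) has_real_derivative
        exp (- (K / \<epsilon>) * r powr \<epsilon>) * (- (K / \<epsilon>) * (\<epsilon> * r powr (\<epsilon> - 1)))) (at r)"
      by (rule DERIV_chain2[OF DERIV_exp DERIV_cmult[OF dpow[OF r]]])
    from DERIV_cmult[OF DERIV_mult[OF dpow[OF r, of "- \<gamma>"] this], of c]
    have "(V has_real_derivative c * (- \<gamma> * r powr (- \<gamma> - 1) * exp (- (K / \<epsilon>) * r powr \<epsilon>)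
        + exp (- (K / \<epsilon>) * r powr \<epsilon>) * (- (K / \<epsilon>) * (\<epsilon> * r powr (\<epsilon> - 1))) * r powr (- \<gamma>))) (at r)"
      unfolding V_def[abs_def] .
    moreover have "c * (- \<gamma> * r powr (- \<gamma> - 1) * exp (- (K / \<epsilon>) * r powr \<epsilon>)
        + exp (- (K / \<epsilon>) * r powr \<epsilon>) * (- (K / \<epsilon>) * (\<epsilon> * r powr (\<epsilon> - 1))) * r powr (- \<gamma>)) = - (V r * \<beta> r / r)"
      using r K by (simp add: V_def \<beta>_def powr_diff field_simps)
    ultimately show ?thesis by simp
  qed
  have dZ: "(Z has_real_derivative Z' r) (at r)" if r: "r > 0" for r
  proof -
    have "(\<beta> has_real_derivative 0 + K * (\<epsilon> * r powr (\<epsilon> - 1))) (at r)"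
      unfolding \<beta>_def[abs_def] by (intro DERIV_add DERIV_const DERIV_cmult dpow r)
    then have "((\<lambda>r. \<beta> r powr (p - 1)) has_real_derivative (p - 1) * \<beta> r powr (p - 1 - 1) * (0 + K * (\<epsilon>
        * r powr (\<epsilon> - 1)))) (at r)"
      by (rule DERIV_chain2[where g = \<beta> and x = r, OF dpow[where a = "p - 1", OF \<beta>0[OF r]]])
    from DERIV_minus[OF DERIV_mult[OF this dpow[OF r, of "- p"]]]
    show ?thesis unfolding Z_def[abs_def] Z'_def by (rule DERIV_cong) (simp add: algebra_simps)
  qed
  have nb: "norm (b x) = \<beta> (norm x) / norm x" if "x \<noteq> 0" for x
    using \<beta>0[of "norm x"] that by (simp add: b_def power2_eq_square)
  have "AE x in lborel. norm x < R\<^sub>0 \<longrightarrow> u x \<le> v x"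
  proof (rule comparison_principle)
    fix d :: real assume d: "d > 0"
    show "comparison \<Omega> p pstar \<mu> f u G R\<^sub>0 \<tau> m d v \<zeta> (cutoff d) b grad_\<zeta> (grad_cutoff d)"
    proof (rule comparison.intro[OF borel_subsolution_axioms], rule comparison_axioms.intro)
      show "0 < v x" if "x \<noteq> 0" for x using V0[of "norm x"] that by (simp add: v_def)
      show "GDERIV v x :> v x *\<^sub>R b x" if "x \<noteq> 0" for x
      proof -
        have "GDERIV v x :> (- (V (norm x) * \<beta> (norm x) / norm x) / norm x) *\<^sub>R x"
          unfolding v_def[abs_def] using that by (intro gderiv_radial dV) auto
        then show ?thesis by (simp add: v_def b_def power2_eq_square)
      qed
      have cn: "continuous_on (- {0}) (\<lambda>x::real^'n. norm x powr a)" for a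
        by (intro continuous_on_powr continuous_on_norm continuous_on_id continuous_on_const) auto
      have c\<beta>: "continuous_on (- {0}) (\<lambda>x::real^'n. \<beta> (norm x))"
        unfolding \<beta>_def by (intro continuous_on_add continuous_on_mult continuous_on_const cn)
      have c\<beta>p: "continuous_on (- {0}) (\<lambda>x::real^'n. \<beta> (norm x) powr a)" for a
        using \<beta>0 by (intro continuous_on_powr c\<beta> continuous_on_const) (metis ComplD less_irrefl
            singletonI zero_less_norm_iff)
      show "continuous_on (- {0}) b"
        unfolding b_def[abs_def]
        by (intro continuous_on_scaleR continuous_on_minus continuous_on_divide c\<beta> continuous_on_power
            continuous_on_norm continuous_on_id) auto
      show "GDERIV \<zeta> x :> grad_\<zeta> x" if "x \<noteq> 0" for x
        unfolding \<zeta>_def[abs_def] grad_\<zeta>_def using that by (intro gderiv_radial dZ) auto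
      show "continuous_on (- {0}) grad_\<zeta>"
        unfolding grad_\<zeta>_def[abs_def] Z'_def
        by (intro continuous_on_scaleR continuous_on_minus continuous_on_divide continuous_on_diff
            continuous_on_mult c\<beta>p cn
            continuous_on_const continuous_on_norm continuous_on_id) auto
      show "v \<in> borel_measurable borel" unfolding v_def[abs_def] V_def by measurable
      show "b \<in> borel_measurable borel" unfolding b_def[abs_def] \<beta>_def by measurable
      show "\<zeta> \<in> borel_measurable borel" unfolding \<zeta>_def[abs_def] Z_def \<beta>_def by measurable
      show "grad_\<zeta> \<in> borel_measurable borel" unfolding grad_\<zeta>_def[abs_def] Z'_def \<beta>_def by measurable
      show "norm (b x) powr (p - 2) *\<^sub>R b x = \<zeta> x *\<^sub>R x" if "x \<noteq> 0" for x
      proof -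
        define r where "r = norm x"
        have r: "r > 0" using that by (simp add: r_def)
        have "(\<beta> r / r) powr (p - 2) * (\<beta> r / r\<^sup>2) = \<beta> r powr (p - 1) * r powr (- p)"
          using r \<beta>0[OF r] by (simp add: powr_divide powr_diff powr_minus field_simps power2_eq_square)
        then have "norm (b x) powr (p - 2) *\<^sub>R b x = (- (\<beta> r powr (p - 1) * r powr (- p))) *\<^sub>R x"
          unfolding nb[OF that] r_def[symmetric] by (simp add: b_def r_def)
        then show ?thesis by (simp add: \<zeta>_def Z_def r_def)
      qed
      show "\<zeta> x \<le> 0" for x by (simp add: \<zeta>_def Z_def)
      show "m \<le> v x" if "x \<noteq> 0" "norm x < R\<^sub>0" for x
      proof -
        define r where "r = norm x"
        have r: "r > 0" "r < R\<^sub>0" using that by (auto simp: r_def)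
        have 1: "1 \<le> R\<^sub>0 powr \<gamma> * r powr (- \<gamma>)"
        proof -
          have "r powr \<gamma> \<le> R\<^sub>0 powr \<gamma>" using r \<gamma>(1) by (intro powr_mono2) auto
          then show ?thesis using r by (simp add: powr_minus field_simps)
        qed
        have 2: "1 \<le> exp (K * R\<^sub>0 powr \<epsilon> / \<epsilon>) * exp (- (K / \<epsilon>) * r powr \<epsilon>)"
        proof -
          have "r powr \<epsilon> \<le> R\<^sub>0 powr \<epsilon>" using r K by (intro powr_mono2) auto
          then have "0 \<le> (K / \<epsilon>) * (R\<^sub>0 powr \<epsilon> - r powr \<epsilon>)" using K by simp
          then have "0 \<le> K * R\<^sub>0 powr \<epsilon> / \<epsilon> + - (K / \<epsilon>) * r powr \<epsilon>" by (simp add: algebra_simps)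
          then show ?thesis unfolding exp_add[symmetric] by simp
        qed
        have "m * (1 * 1) \<le> m * ((R\<^sub>0 powr \<gamma> * r powr (- \<gamma>)) * (exp (K * R\<^sub>0 powr \<epsilon> / \<epsilon>) * exp (- (K /
            \<epsilon>) * r powr \<epsilon>)))"
          using m 1 2 by (intro mult_left_mono mult_mono) auto
        also have "\<dots> = V r" by (simp add: V_def c_def mult_ac)
        finally show ?thesis by (simp add: v_def r_def)
      qed
      show "AE x in lborel. 0 < norm x \<and> norm x < R\<^sub>0 \<longrightarrow>
          ?N * \<zeta> x + x \<bullet> grad_\<zeta> x + (p - 1) * norm (b x) powr p + \<mu> / norm x powr p + f x < 0"
        using f_le
      proof eventually_elim
        case (elim x)
        show ?case
        proof
          assume x: "0 < norm x \<and> norm x < R\<^sub>0"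
          define r where "r = norm x"
          have r: "r > 0" "r \<le> \<rho>" "x \<noteq> 0" using x R0 by (auto simp: r_def)
          have "x \<in> \<Omega>" using x R0(3) by auto
          then have fx: "f x \<le> A * r powr (- \<alpha>)" using elim by (simp add: r_def)
          have b0: "\<beta> r > 0" by (rule \<beta>0[OF r(1)])
          \<comment> \<open>\<gamma> \<le> \<beta> \<le> (N-p)/p, and \<open>hardy_fun\<close>
            increases up to that point.\<close>
          have \<mu>_le: "\<mu> \<le> hardy_fun ?N p (\<beta> r)"
            unfolding \<gamma>(2)[symmetric] using p \<gamma>(1) par1[OF r(1,2)] K r
            by (intro hardy_fun_mono) (auto simp: \<beta>_def)
          have A1: "A * r powr (- \<alpha>) = r powr (- p) * (A * r powr (p - \<alpha>))"
            using r by (simp add: powr_diff powr_minus field_simps)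
          have xx: "x \<bullet> grad_\<zeta> x = r * Z' r"
            using r by (simp add: grad_\<zeta>_def r_def dot_square_norm power2_eq_square)
          have e1: "?N * \<zeta> x = r powr (- p) * (- ?N * \<beta> r powr (p - 1))" by (simp add: \<zeta>_def Z_def r_def)
          have e2: "r * Z' r = r powr (- p) * (- ((p - 1) * \<beta> r powr (p - 2) * (K * \<epsilon> * r powr \<epsilon>)) + p *
              \<beta> r powr (p - 1))"
          proof -
            have q: "r powr (\<epsilon> - 1) = r powr \<epsilon> / r" "r powr (- p - 1) = r powr (- p) / r" using r by
                (simp_all add: powr_diff)
            show ?thesis using r unfolding Z'_def q by (simp add: field_simps)
          qed
          have e3: "norm (b x) powr p = r powr (- p) * \<beta> r powr p"
            unfolding nb[OF r(3)] r_def[symmetric] using r b0 by (simp add: powr_divide powr_minus field_simps)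
          have e4: "\<mu> / norm x powr p = r powr (- p) * \<mu>"
            using r by (simp add: r_def powr_minus field_simps)
          have "?N * \<zeta> x + x \<bullet> grad_\<zeta> x + (p - 1) * norm (b x) powr p + \<mu> / norm x powr p + f x
             \<le> r powr (- p) * (- ?N * \<beta> r powr (p - 1)) + r powr (- p) * (- ((p - 1) * \<beta> r powr (p - 2)
                 * (K * \<epsilon> * r powr \<epsilon>)) + p * \<beta> r powr (p - 1))
               + (p - 1) * (r powr (- p) * \<beta> r powr p) + r powr (- p) * \<mu> + r powr (- p) * (A * r powr (p - \<alpha>))"
            unfolding xx e1 e2 e3 e4 A1[symmetric] using fx by simp
          \<comment> \<open>The first bracket is nonpositive because \<beta> lies in the increasing
            range of \<open>hardy_fun\<close>; the second is negative because the term with r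
            \<beta>' outweighs \<open>f\<close>.\<close>
          also have "\<dots> = r powr (- p) * ((\<mu> - hardy_fun ?N p (\<beta> r)) + (A * r powr (p - \<alpha>) - (p - 1) * \<beta>
              r powr (p - 2) * (K * \<epsilon> * r powr \<epsilon>)))"
            by (simp add: hardy_fun_def algebra_simps)
          also have "\<dots> < 0"
            using \<mu>_le par2[OF r(1,2)] r by (intro mult_pos_neg) (auto simp: \<beta>_def)
          finally show "?N * \<zeta> x + x \<bullet> grad_\<zeta> x + (p - 1) * norm (b x) powr p + \<mu> / norm x powr p + f x < 0" .
        qed
      qed
    qed (use \<tau> R0 d ann cutoff_gderiv continuous_grad_cutoff cutoff_bounds cutoff_small
        inner_grad_cutoff in auto)
  qed
  then show ?thesis
  proof eventually_elim
    case (elim x)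
    show ?case
    proof
      assume x: "norm x < R\<^sub>0"
      have "u x \<le> v x" using elim x by blast
      also have "v x = m * norm x powr (- \<gamma>) * (R\<^sub>0 powr \<gamma> * exp (K * R\<^sub>0 powr \<epsilon> / \<epsilon>)) * exp (- (K / \<epsilon>)
          * norm x powr \<epsilon>)"
        by (simp add: v_def V_def c_def)
      \<comment> \<open>\<open>R\<^sub>0\<close> is replaced by \<rho>, which frees the constant
        from the radius, and the decaying exponential is bounded by 1.\<close>
      also have "\<dots> \<le> m * norm x powr (- \<gamma>) * (\<rho> powr \<gamma> * exp (K * \<rho> powr \<epsilon> / \<epsilon>)) * 1"
      proof -
        have "R\<^sub>0 powr \<gamma> \<le> \<rho> powr \<gamma>" "R\<^sub>0 powr \<epsilon> \<le> \<rho> powr \<epsilon>" using R0 \<gamma>(1) K by (auto intro!: powr_mono2)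
        moreover have "exp (- (K / \<epsilon>) * norm x powr \<epsilon>) \<le> 1" using K by simp
        ultimately show ?thesis
          using m K by (intro mult_mono mult_left_mono) (auto intro!: divide_right_mono)
      qed
      finally show "u x \<le> \<rho> powr \<gamma> * exp (K * \<rho> powr \<epsilon> / \<epsilon>) * m * norm x powr (- \<gamma>)" by (simp add: mult_ac)
    qed
  qed
qed

end

section \<open>The bound for weak subsolutions\<close>

lemma AE_lebesgue_on_iff:
  assumes "\<Omega> \<in> sets borel"
  shows "(AE x in lebesgue_on \<Omega>. P x) \<longleftrightarrow> (AE x in lborel. x \<in> \<Omega> \<longrightarrow> P x)"
  using assms by (subst AE_restrict_space_iff) (auto simp: AE_completion_iff)

text \<open>Agreement with the Borel function \<open>F'\<close> outside a null set makes
  \<open>F\<close>, cut off to \<Omega>, measurable because Lebesgue measure is complete; both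
  claims are then congruence almost everywhere.\<close>

lemma lebesgue_on_eq_lborel:
  fixes F F' :: "real^'n \<Rightarrow> 'b::euclidean_space"
  assumes \<Omega>: "\<Omega> \<in> sets borel" and F': "F' \<in> borel_measurable borel" "\<And>x. x \<notin> \<Omega> \<Longrightarrow> F' x = 0"
    and eq: "AE x in lborel. x \<in> \<Omega> \<longrightarrow> F x = F' x"
  shows "integrable (lebesgue_on \<Omega>) F \<longleftrightarrow> integrable lborel F'"
    and "(LINT x|lebesgue_on \<Omega>. F x) = (LINT x|lborel. F' x)"
proof -
  have m1: "F' \<in> borel_measurable lebesgue" using F'(1) by (simp add: measurable_completion)
  have ae: "AE x in lebesgue. indicator \<Omega> x *\<^sub>R F x = F' x"
    unfolding AE_completion_iff using eq by eventually_elim (auto simp: indicator_def F'(2))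
  have ae': "AE x in lebesgue. F' x = indicator \<Omega> x *\<^sub>R F x" using ae by eventually_elim simp
  have m2: "(\<lambda>x. indicator \<Omega> x *\<^sub>R F x) \<in> borel_measurable lebesgue"
    by (rule borel_measurable_AE[OF m1 ae'])
  have s: "\<Omega> \<inter> space lebesgue \<in> sets lebesgue" using \<Omega> by simp
  have "integrable lebesgue (\<lambda>x. indicator \<Omega> x *\<^sub>R F x) \<longleftrightarrow> integrable lebesgue F'"
    by (rule integrable_cong_AE[OF m2 m1 ae])
  then show "integrable (lebesgue_on \<Omega>) F \<longleftrightarrow> integrable lborel F'"
    unfolding integrable_restrict_space[OF s] using F'(1) by (simp add: integrable_completion)
  have "(LINT x|lebesgue. indicator \<Omega> x *\<^sub>R F x) = (LINT x|lebesgue. F' x)"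
    by (rule integral_cong_AE[OF m2 m1 ae])
  then show "(LINT x|lebesgue_on \<Omega>. F x) = (LINT x|lborel. F' x)"
    unfolding integral_restrict_space[OF s] using F'(1) by (simp add: integral_completion)
qed

lemma borel_representative:
  fixes g :: "real^'n \<Rightarrow> real"
  assumes \<Omega>: "\<Omega> \<in> sets borel" and g: "g \<in> borel_measurable (lebesgue_on \<Omega>)"
  obtains g' where "g' \<in> borel_measurable borel" "\<And>x. x \<notin> \<Omega> \<Longrightarrow> g' x = 0" "AE x in lborel. x \<in> \<Omega> \<longrightarrow> g x = g' x"
proof -
  have "(\<lambda>x. indicator \<Omega> x *\<^sub>R g x) \<in> borel_measurable lebesgue"
    using g \<Omega> by (subst (asm) borel_measurable_restrict_space_iff) auto
  then obtain h where h[measurable]: "h \<in> borel_measurable lborel" and ae: "AE x in lborel. indicator \<Omega>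
      x *\<^sub>R g x = h x"
    using completion_ex_borel_measurable_real by blast
  have [measurable]: "\<Omega> \<in> sets borel" by fact
  show ?thesis
  proof (rule that[of "\<lambda>x. indicator \<Omega> x * h x"])
    show "(\<lambda>x. indicator \<Omega> x * h x) \<in> borel_measurable borel" using h by simp
    show "AE x in lborel. x \<in> \<Omega> \<longrightarrow> g x = indicator \<Omega> x * h x"
      using ae by eventually_elim (auto simp: indicator_def split: if_splits)
  qed simp
qed

lemma borel_representative_vec:
  fixes g :: "real^'n \<Rightarrow> real^'m"
  assumes \<Omega>: "\<Omega> \<in> sets borel" and g: "g \<in> borel_measurable (lebesgue_on \<Omega>)"
  obtains g' where "g' \<in> borel_measurable borel" "\<And>x. x \<notin> \<Omega> \<Longrightarrow> g' x = 0" "AE x in lborel. x \<in> \<Omega> \<longrightarrow> g x = g' x"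
proof -
  have "\<exists>h. h \<in> borel_measurable borel \<and> (\<forall>x. x \<notin> \<Omega> \<longrightarrow> h x = 0) \<and> (AE x in lborel. x \<in> \<Omega> \<longrightarrow> g x $ i = h x)" for i
  proof -
    have "(\<lambda>x. g x \<bullet> axis i 1) \<in> borel_measurable (lebesgue_on \<Omega>)" using g by measurable
    then have "(\<lambda>x. g x $ i) \<in> borel_measurable (lebesgue_on \<Omega>)" by (simp add: inner_axis)
    then obtain h where "h \<in> borel_measurable borel" "\<And>x. x \<notin> \<Omega> \<Longrightarrow> h x = 0"
        "AE x in lborel. x \<in> \<Omega> \<longrightarrow> g x $ i = h x"
      by (rule borel_representative[OF \<Omega>]) (rule that; assumption)
    then show ?thesis by blast
  qed
  then have "\<forall>i. \<exists>h. h \<in> borel_measurable borel \<and> (\<forall>x. x \<notin> \<Omega> \<longrightarrow> h x = 0) \<and> (AE x in lborel. x \<in> \<Omega> \<longrightarrow> g x $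
      i = h x)"
    by blast
  then obtain h where "\<forall>i. h i \<in> borel_measurable borel \<and> (\<forall>x. x \<notin> \<Omega> \<longrightarrow> h i x = 0)
      \<and> (AE x in lborel. x \<in> \<Omega> \<longrightarrow> g x $ i = h i x)"
    unfolding choice_iff by blast
  then have h: "\<And>i. h i \<in> borel_measurable borel" "\<And>i x. x \<notin> \<Omega> \<Longrightarrow> h i x = 0"
    "\<And>i. AE x in lborel. x \<in> \<Omega> \<longrightarrow> g x $ i = h i x" by blast+
  show ?thesis
  proof (rule that[of "\<lambda>x. \<chi> i. h i x"])
    show "(\<lambda>x. \<chi> i. h i x) \<in> borel_measurable borel"
      by (subst borel_measurable_euclidean_space) (auto simp: Basis_vec_def inner_axis h(1))
    show "(\<chi> i. h i x) = 0" if "x \<notin> \<Omega>" for x using h(2)[OF that] by (simp add: vec_eq_iff)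
    have "AE x in lborel. \<forall>i\<in>UNIV. x \<in> \<Omega> \<longrightarrow> g x $ i = h i x"
      by (rule AE_finite_allI) (use h(3) in auto)
    then show "AE x in lborel. x \<in> \<Omega> \<longrightarrow> g x = (\<chi> i. h i x)"
      by eventually_elim (simp add: vec_eq_iff)
  qed
qed

text \<open>The infimum defining \<open>usc_rep\<close> gives every point of the sphere a ball on
  which u \<le> m almost everywhere. Compactness leaves finitely many balls, so that the null sets
  can be united, and a uniform distance within which the sphere's neighbourhood is covered.\<close>

lemma le_near_sphere:
  fixes u :: "real^'n \<Rightarrow> real"
  assumes \<Omega>: "open \<Omega>" and R: "0 < R" "cball 0 R \<subseteq> \<Omega>" and m: "sphere_sup_pos \<Omega> u R < ereal m"
  obtains \<tau> where "0 < \<tau>" "AE x in lborel. R - \<tau> < norm x \<and> norm x < R \<longrightarrow> u x \<le> m"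
proof -
  have "\<exists>r>0. AE x in lborel. x \<in> \<Omega> \<inter> ball y r \<longrightarrow> u x \<le> m" if y: "y \<in> sphere 0 R" for y
  proof -
    have "usc_rep \<Omega> u y \<le> max (usc_rep \<Omega> u y) 0" by simp
    also have "\<dots> \<le> sphere_sup_pos \<Omega> u R" unfolding sphere_sup_pos_def by (rule SUP_upper[OF y])
    finally have "usc_rep \<Omega> u y < ereal m" using m by (rule le_less_trans)
    then obtain r where r: "r > 0" "esssup (lebesgue_on (\<Omega> \<inter> ball y r)) (\<lambda>x. ereal (u x)) < ereal m"
      unfolding usc_rep_def INF_less_iff by auto
    have "AE x in lebesgue_on (\<Omega> \<inter> ball y r). ereal (u x) \<le> esssup (lebesgue_on (\<Omega> \<inter> ball y r)) (\<lambda>x.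
        ereal (u x))"
      by (rule esssup_AE)
    then have "AE x in lebesgue_on (\<Omega> \<inter> ball y r). u x \<le> m"
      by eventually_elim (use r(2) in \<open>auto dest: le_less_trans\<close>)
    then show ?thesis using r(1) \<Omega> by (subst (asm) AE_lebesgue_on_iff) auto
  qed
  then obtain r where r: "\<And>y. y \<in> sphere 0 R \<Longrightarrow> r y > 0"
    "\<And>y. y \<in> sphere 0 R \<Longrightarrow> AE x in lborel. x \<in> \<Omega> \<inter> ball y (r y) \<longrightarrow> u x \<le> m" by metis
  have cover: "sphere 0 R \<subseteq> (\<Union>y\<in>sphere 0 R. ball y (r y))" using r(1) by force
  obtain D where D: "D \<subseteq> sphere 0 R" "finite D" "sphere 0 R \<subseteq> (\<Union>y\<in>D. ball y (r y))"
    by (rule compactE_image[OF compact_sphere open_ball cover]) (rule that; assumption)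
  have "open (\<Union>y\<in>D. ball y (r y))" by auto
  then obtain e where e: "e > 0" "(\<Union>y\<in>sphere 0 R. ball y e) \<subseteq> (\<Union>y\<in>D. ball y (r y))"
    using compact_subset_open_imp_ball_epsilon_subset[OF compact_sphere _ D(3)] by blast
  show ?thesis
  \<comment> \<open>The minimum with R keeps x away from 0, so that its radial projection onto the
    sphere is defined.\<close>
  proof (rule that[of "min e R"])
    show "0 < min e R" using e R by simp
    have "AE x in lborel. \<forall>y\<in>D. x \<in> \<Omega> \<inter> ball y (r y) \<longrightarrow> u x \<le> m"
      using D(1,2) r(2) by (subst AE_finite_all) auto
    then show "AE x in lborel. R - min e R < norm x \<and> norm x < R \<longrightarrow> u x \<le> m"
    proof eventually_elim
      case (elim x)
      show ?case
      proof
        assume x: "R - min e R < norm x \<and> norm x < R"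
        then have n: "norm x > 0" by auto
        let ?z = "(R / norm x) *\<^sub>R x"
        have z: "?z \<in> sphere 0 R" using n R by simp
        have "dist ?z x = norm ((R / norm x - 1) *\<^sub>R x)" by (simp add: dist_norm scaleR_left_diff_distrib)
        also have "\<dots> = \<bar>R / norm x - 1\<bar> * norm x" by simp
        also have "\<bar>R / norm x - 1\<bar> = R / norm x - 1" using x n by simp
        also have "(R / norm x - 1) * norm x = R - norm x" using n by (simp add: left_diff_distrib)
        finally have "dist ?z x = R - norm x" .
        moreover have "R - norm x < min e R" using x by linarith
        ultimately have "x \<in> ball ?z e" by simp
        then obtain y where "y \<in> D" "x \<in> ball y (r y)" using e(2) z by blast
        moreover have "x \<in> \<Omega>" using R(2) x by auto
        ultimately show "u x \<le> m" using elim by blast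
      qed
    qed
  qed
qed

lemma sphere_sup_pos_nonneg:
  assumes "0 < R"
  shows "0 \<le> sphere_sup_pos \<Omega> (u :: real^'n \<Rightarrow> real) R"
proof -
  obtain y :: "real^'n" where y: "norm y = R" using vector_choose_size[of R] assms by auto
  have "0 \<le> max (usc_rep \<Omega> u y) 0" by simp
  also have "\<dots> \<le> sphere_sup_pos \<Omega> u R" unfolding sphere_sup_pos_def by (rule SUP_upper) (use y in simp)
  finally show ?thesis .
qed

lemma LpD: "g \<in> Lp q \<Omega> \<Longrightarrow> g \<in> borel_measurable (lebesgue_on \<Omega>)"
  by (simp add: Lp_def)

text \<open>Inside \<Omega> the functions \<open>u\<close>, \<open>f\<close> and the chosen weak
  gradient are altered on null sets only, which changes none of the integrals in the weak
  formulation.\<close>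

lemma weak_subsolution_borel_representative:
  fixes f u :: "real^'n \<Rightarrow> real"
  assumes p: "1 < p" "p < real CARD('n)" and \<Omega>: "open \<Omega>" "bounded \<Omega>"
    and f: "f \<in> Lp (real CARD('n) / p) \<Omega>" and u: "weak_subsolution p \<mu> \<Omega> f u"
  obtains f' u' G where "borel_subsolution \<Omega> p (real CARD('n) * p / (real CARD('n) - p)) \<mu> f' u' G"
    "AE x in lborel. x \<in> \<Omega> \<longrightarrow> f x = f' x" "AE x in lborel. x \<in> \<Omega> \<longrightarrow> u x = u' x"
proof -
  let ?ps = "real CARD('n) * p / (real CARD('n) - p)"
  let ?W = "weak_gradient \<Omega> u"
  have \<Omega>b: "\<Omega> \<in> sets borel" using \<Omega>(1) by simp
  have uD: "u \<in> D1p p \<Omega>" using u by (simp add: weak_subsolution_def)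
  have uL: "u \<in> Lp ?ps \<Omega>" and WL: "?W \<in> Lp p \<Omega>" and wd: "weakly_differentiable \<Omega> u"
    using uD by (auto simp: D1p_def)
  have wg: "has_weak_gradient \<Omega> u ?W"
    using wd unfolding weakly_differentiable_def weak_gradient_def by (rule someI_ex)
  obtain u' where u': "u' \<in> borel_measurable borel" "\<And>x. x \<notin> \<Omega> \<Longrightarrow> u' x = 0" "AE x in lborel. x \<in> \<Omega> \<longrightarrow> u x = u' x"
    by (rule borel_representative[OF \<Omega>b LpD[OF uL]]) (rule that; assumption)
  obtain f' where f': "f' \<in> borel_measurable borel" "\<And>x. x \<notin> \<Omega> \<Longrightarrow> f' x = 0" "AE x in lborel. x \<in> \<Omega> \<longrightarrow> f x = f' x"
    by (rule borel_representative[OF \<Omega>b LpD[OF f]]) (rule that; assumption)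
  obtain G where G: "G \<in> borel_measurable borel" "\<And>x. x \<notin> \<Omega> \<Longrightarrow> G x = 0" "AE x in lborel. x \<in> \<Omega> \<longrightarrow> ?W x = G x"
    by (rule borel_representative_vec[OF \<Omega>b LpD[OF WL]]) (rule that; assumption)
  have [measurable]: "u' \<in> borel_measurable borel" "f' \<in> borel_measurable borel" "G \<in> borel_measurable
      borel" by fact+
  have \<phi>m: "\<phi> \<in> borel_measurable borel" "gradient \<phi> \<in> borel_measurable borel" if "\<phi> \<in> test_functions \<Omega>" for \<phi>
  proof -
    have c: "Ck k \<phi>" for k using that by (simp add: test_functions_def)
    show "\<phi> \<in> borel_measurable borel" by (rule borel_measurable_continuous_onI[OF Ck_imp_continuous[OF
        c[of 0]]])
    show "gradient \<phi> \<in> borel_measurable borel" by (rule borel_measurable_continuous_onI[OF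
        Ck_Suc_gradient_continuous[OF c[of "Suc 0"]]])
  qed
  have "borel_subsolution \<Omega> p ?ps \<mu> f' u' G"
  proof
    have transfer: "integrable lborel (\<lambda>x. norm (g' x) powr q)"
      if "g \<in> Lp q \<Omega>" and [measurable]: "g' \<in> borel_measurable borel"
        and z: "\<And>x. x \<notin> \<Omega> \<Longrightarrow> g' x = 0" and ae: "AE x in lborel. x \<in> \<Omega> \<longrightarrow> g x = g' x"
      for g g' :: "real^'n \<Rightarrow> 'c::euclidean_space" and q
    proof -
      have "AE x in lborel. x \<in> \<Omega> \<longrightarrow> norm (g x) powr q = norm (g' x) powr q"
        using ae by eventually_elim simp
      then have "integrable (lebesgue_on \<Omega>) (\<lambda>x. norm (g x) powr q) \<longleftrightarrow> integrable lborel (\<lambda>x. norm (g' x)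
          powr q)"
        by (intro lebesgue_on_eq_lborel(1)[OF \<Omega>b]) (simp_all add: z)
      then show ?thesis using that(1) by (simp add: Lp_def)
    qed
    show "integrable lborel (\<lambda>x. \<bar>u' x\<bar> powr ?ps)" using transfer[OF uL u'] by simp
    show "integrable lborel (\<lambda>x. \<bar>f' x\<bar> powr (real CARD('n) / p))" using transfer[OF f f'] by simp
    show "integrable lborel (\<lambda>x. norm (G x) powr p)" using transfer[OF WL G] by simp
    fix \<phi> assume \<phi>: "\<phi> \<in> test_functions \<Omega>"
    note [measurable] = \<phi>m[OF \<phi>]
    have "(LINT x|lborel. u' x *\<^sub>R gradient \<phi> x) = (LINT x|lebesgue_on \<Omega>. u x *\<^sub>R gradient \<phi> x)"
    proof (rule lebesgue_on_eq_lborel(2)[OF \<Omega>b, symmetric])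
      show "AE x in lborel. x \<in> \<Omega> \<longrightarrow> u x *\<^sub>R gradient \<phi> x = u' x *\<^sub>R gradient \<phi> x" using u'(3) by
          eventually_elim simp
    qed (use u'(2) in auto)
    also have "\<dots> = - (LINT x|lebesgue_on \<Omega>. \<phi> x *\<^sub>R ?W x)"
      using wg \<phi> by (simp add: has_weak_gradient_def)
    also have "(LINT x|lebesgue_on \<Omega>. \<phi> x *\<^sub>R ?W x) = (LINT x|lborel. \<phi> x *\<^sub>R G x)"
    proof (rule lebesgue_on_eq_lborel(2)[OF \<Omega>b])
      show "AE x in lborel. x \<in> \<Omega> \<longrightarrow> \<phi> x *\<^sub>R ?W x = \<phi> x *\<^sub>R G x" using G(3) by eventually_elim simp
    qed (use G(2) in auto)
    finally show "(LINT x|lborel. u' x *\<^sub>R gradient \<phi> x) = - (LINT x|lborel. \<phi> x *\<^sub>R G x)" .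
    assume \<phi>0: "\<And>x. 0 \<le> \<phi> x"
    have "(LINT x|lborel. norm (G x) powr (p - 2) * (G x \<bullet> gradient \<phi> x) - \<mu> / norm x powr p * \<bar>u' x\<bar>
        powr (p - 2) * u' x * \<phi> x)
      = (LINT x|lebesgue_on \<Omega>. norm (?W x) powr (p - 2) * (?W x \<bullet> gradient \<phi> x) - \<mu> / norm x powr p * \<bar>u
          x\<bar> powr (p - 2) * u x * \<phi> x)"
    proof (rule lebesgue_on_eq_lborel(2)[OF \<Omega>b, symmetric])
      show "AE x in lborel. x \<in> \<Omega> \<longrightarrow> norm (?W x) powr (p - 2) * (?W x \<bullet> gradient \<phi> x) - \<mu> / norm x powr p
          * \<bar>u x\<bar> powr (p - 2) * u x * \<phi> x
        = norm (G x) powr (p - 2) * (G x \<bullet> gradient \<phi> x) - \<mu> / norm x powr p * \<bar>u' x\<bar> powr (p - 2) * u' x * \<phi> x"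
        using G(3) u'(3) by eventually_elim simp
    qed (use G(2) u'(2) in auto)
    also have "\<dots> \<le> (LINT x|lebesgue_on \<Omega>. f x * \<bar>u x\<bar> powr (p - 2) * u x * \<phi> x)"
      using u \<phi> \<phi>0 by (simp add: weak_subsolution_def)
    also have "\<dots> = (LINT x|lborel. f' x * \<bar>u' x\<bar> powr (p - 2) * u' x * \<phi> x)"
    proof (rule lebesgue_on_eq_lborel(2)[OF \<Omega>b])
      show "AE x in lborel. x \<in> \<Omega> \<longrightarrow> f x * \<bar>u x\<bar> powr (p - 2) * u x * \<phi> x = f' x * \<bar>u' x\<bar> powr (p - 2) *
          u' x * \<phi> x"
        using f'(3) u'(3) by eventually_elim simp
    qed (use f'(2) u'(2) in auto)
    finally show "(LINT x|lborel. norm (G x) powr (p - 2) * (G x \<bullet> gradient \<phi> x) - \<mu> / norm x powr p *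
        \<bar>u' x\<bar> powr (p - 2) * u' x * \<phi> x)
      \<le> (LINT x|lborel. f' x * \<bar>u' x\<bar> powr (p - 2) * u' x * \<phi> x)" .
  qed (use p \<Omega> u' f' G in auto)
  then show ?thesis using f'(3) u'(3) by (rule that)
qed

text \<open>The order of the quantifiers expresses the dependence of the constants. The bound lives
  in \<open>ereal\<close> because the supremum over the sphere may be infinite, and holds almost
  everywhere because \<open>u\<close> is determined only up to null sets.\<close>

theorem theorem1p3:
  fixes p \<mu> A \<alpha> \<gamma>\<^sub>1 \<gamma>\<^sub>2 :: real
  assumes p: "1 < p" "p < real CARD('n)"
    and mu: "0 \<le> \<mu>" "\<mu> < ((real CARD('n) - p) / p) powr p"
    and A: "0 < A"
    and alpha: "\<alpha> < p"
    and roots: "hardy_root (real CARD('n)) p \<mu> \<gamma>\<^sub>1" "hardy_root (real CARD('n)) p \<mu> \<gamma>\<^sub>2" "\<gamma>\<^sub>1 < \<gamma>\<^sub>2"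
  shows "\<exists>C>0. \<exists>\<rho>>0. \<forall>(\<Omega> :: (real^'n) set) (f :: real^'n \<Rightarrow> real) (u :: real^'n \<Rightarrow> real) R\<^sub>0.
           open \<Omega> \<and> connected \<Omega> \<and> bounded \<Omega> \<and> 0 \<in> \<Omega> \<and>
           f \<in> Lp (real CARD('n) / p) \<Omega> \<and>
           (AE x in lebesgue_on \<Omega>. f x \<le> A * norm x powr (-\<alpha>)) \<and>
           weak_subsolution p \<mu> \<Omega> f u \<and>
           0 < R\<^sub>0 \<and> R\<^sub>0 \<le> \<rho> \<and> cball 0 R\<^sub>0 \<subseteq> \<Omega> \<longrightarrow>
           (AE x in lebesgue_on (ball 0 R\<^sub>0).
              ereal (u x) \<le> ereal C * sphere_sup_pos \<Omega> u R\<^sub>0 * ereal (norm x powr (-\<gamma>\<^sub>1)))"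
proof -
  have \<gamma>: "0 \<le> \<gamma>\<^sub>1" "hardy_fun (real CARD('n)) p \<gamma>\<^sub>1 = \<mu>" using roots(1) hardy_root_iff[OF p(1)] by auto
  have \<gamma>_less: "\<gamma>\<^sub>1 < (real CARD('n) - p) / p" by (rule smaller_hardy_root_less[OF p roots])
  obtain K \<epsilon> \<rho> where K: "0 < K" "0 < \<epsilon>" and \<rho>: "0 < \<rho>"
    and par1: "\<And>r. 0 < r \<Longrightarrow> r \<le> \<rho> \<Longrightarrow> \<gamma>\<^sub>1 + K * r powr \<epsilon> \<le> (real CARD('n) - p) / p"
    and par2: "\<And>r. 0 < r \<Longrightarrow> r \<le> \<rho> \<Longrightarrow>
      A * r powr (p - \<alpha>) < (p - 1) * (\<gamma>\<^sub>1 + K * r powr \<epsilon>) powr (p - 2) * (K * \<epsilon> * r powr \<epsilon>)"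
    using barrier_parameters[OF p(1) \<gamma>(1) \<gamma>_less A alpha] by blast
  define C where "C = \<rho> powr \<gamma>\<^sub>1 * exp (K * \<rho> powr \<epsilon> / \<epsilon>)"
  have C: "C > 0" using \<rho> by (simp add: C_def)
  show ?thesis
  proof (rule exI[of _ C], rule conjI[OF C], rule exI[of _ \<rho>], rule conjI[OF \<rho>], intro allI impI)
    fix \<Omega> :: "(real^'n) set" and f u :: "real^'n \<Rightarrow> real" and R\<^sub>0 :: real
    assume asm: "open \<Omega> \<and> connected \<Omega> \<and> bounded \<Omega> \<and> 0 \<in> \<Omega> \<and>
           f \<in> Lp (real CARD('n) / p) \<Omega> \<and>
           (AE x in lebesgue_on \<Omega>. f x \<le> A * norm x powr (-\<alpha>)) \<and>
           weak_subsolution p \<mu> \<Omega> f u \<and>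
           0 < R\<^sub>0 \<and> R\<^sub>0 \<le> \<rho> \<and> cball 0 R\<^sub>0 \<subseteq> \<Omega>"
    then have \<Omega>: "open \<Omega>" "bounded \<Omega>" and R0: "0 < R\<^sub>0" "R\<^sub>0 \<le> \<rho>" "cball 0 R\<^sub>0 \<subseteq> \<Omega>"
      and fL: "f \<in> Lp (real CARD('n) / p) \<Omega>" and sub: "weak_subsolution p \<mu> \<Omega> f u"
      and fA: "AE x in lebesgue_on \<Omega>. f x \<le> A * norm x powr (-\<alpha>)" by auto
    obtain f' u' G where bs: "borel_subsolution \<Omega> p (real CARD('n) * p / (real CARD('n) - p)) \<mu> f' u' G"
      and f': "AE x in lborel. x \<in> \<Omega> \<longrightarrow> f x = f' x" and u': "AE x in lborel. x \<in> \<Omega> \<longrightarrow> u x = u' x"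
      by (rule weak_subsolution_borel_representative[OF p \<Omega> fL sub]) (rule that; assumption)
    interpret borel_subsolution \<Omega> p "real CARD('n) * p / (real CARD('n) - p)" \<mu> f' u' G by (rule bs)
    have f'A: "AE x in lborel. x \<in> \<Omega> \<longrightarrow> f' x \<le> A * norm x powr (-\<alpha>)"
    proof -
      have "AE x in lborel. x \<in> \<Omega> \<longrightarrow> f x \<le> A * norm x powr (-\<alpha>)"
        using fA \<Omega>(1) by (subst (asm) AE_lebesgue_on_iff) auto
      then show ?thesis using f' by eventually_elim auto
    qed
    define M where "M = sphere_sup_pos \<Omega> u R\<^sub>0"
    have M0: "0 \<le> M" unfolding M_def by (rule sphere_sup_pos_nonneg[OF R0(1)])
    \<comment> \<open>M < m leaves room to pass from the sphere to an annulus, and 0 < m keeps the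
      barrier positive when M = 0.\<close>
    have bound: "AE x in lborel. norm x < R\<^sub>0 \<longrightarrow> u' x \<le> C * m * norm x powr (-\<gamma>\<^sub>1)" if m: "0 < m" "M <
        ereal m" for m
    proof -
      obtain \<tau> where \<tau>: "0 < \<tau>" "AE x in lborel. R\<^sub>0 - \<tau> < norm x \<and> norm x < R\<^sub>0 \<longrightarrow> u x \<le> m"
        by (rule le_near_sphere[OF \<Omega>(1) R0(1,3) m(2)[unfolded M_def]]) (rule that; assumption)
      have near: "AE x in lborel. R\<^sub>0 - \<tau> < norm x \<and> norm x < R\<^sub>0 \<longrightarrow> u' x \<le> m"
        using \<tau>(2) u'
      proof eventually_elim
        case (elim x)
        have "x \<in> \<Omega>" if "norm x < R\<^sub>0" using R0(3) that by auto
        then show ?case using elim by auto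
      qed
      show ?thesis
        unfolding C_def by (rule barrier_bound[OF \<gamma> K par1 par2 f'A R0 \<tau>(1) m(1) near]; assumption)
    qed
    have "AE x in lborel. x \<in> ball 0 R\<^sub>0 \<longrightarrow> ereal (u x) \<le> ereal C * M * ereal (norm x powr (-\<gamma>\<^sub>1))"
    proof (cases M)
      case (real M')
      \<comment> \<open>m = M' + 1/(n+1) decreases to M', at the cost of countably many null
        sets.\<close>
      have "AE x in lborel. \<forall>n. norm x < R\<^sub>0 \<longrightarrow> u' x \<le> C * (M' + 1 / real (Suc n)) * norm x powr (-\<gamma>\<^sub>1)"
        unfolding AE_all_countable using M0 real by (intro allI bound) (auto simp: add_nonneg_pos)
      then show ?thesis
        using u'
      proof eventually_elim
        case (elim x)
        show ?case
        proof
          assume x: "x \<in> ball 0 R\<^sub>0"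
          have "(\<lambda>n. C * (M' + 1 / real (Suc n)) * norm x powr (-\<gamma>\<^sub>1)) \<longlonglongrightarrow> C * (M' + 0) * norm x powr (-\<gamma>\<^sub>1)"
            using LIMSEQ_inverse_real_of_nat
            by (intro tendsto_mult tendsto_add tendsto_const) (simp add: inverse_eq_divide)
          then have "u' x \<le> C * (M' + 0) * norm x powr (-\<gamma>\<^sub>1)"
            by (rule LIMSEQ_le_const) (use elim(1) x in auto)
          moreover have "x \<in> \<Omega>" using x R0(3) by auto
          then have "u x = u' x" using elim(2) by blast
          ultimately show "ereal (u x) \<le> ereal C * M * ereal (norm x powr (-\<gamma>\<^sub>1))" using real by simp
        qed
      qed
    next
      case PInf
      \<comment> \<open>The origin is set aside: there the power takes the value 0, and its product
        with infinity would be 0.\<close>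
      have "AE x in lborel. x \<noteq> (0 :: real^'n)" by (rule AE_lborel_singleton)
      then show ?thesis
      proof eventually_elim
        case (elim x)
        then have "norm x powr (-\<gamma>\<^sub>1) > 0" by simp
        then have "ereal C * M * ereal (norm x powr (-\<gamma>\<^sub>1)) = \<infinity>" using PInf C by simp
        then show ?case by (simp only:) simp
      qed
    qed (use M0 in simp)
    then show "AE x in lebesgue_on (ball 0 R\<^sub>0). ereal (u x) \<le> ereal C * sphere_sup_pos \<Omega> u R\<^sub>0 * ereal
        (norm x powr (-\<gamma>\<^sub>1))"
      unfolding M_def by (subst AE_lebesgue_on_iff) auto
  qed
qed

end
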